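(* Let $r > 0$ be a real number and let $k$ be an integer such that $k \ge r$. Let $Y \sim \mathrm{Gamma}(r,1)$ be independent of a positive random variable $X \sim \mathrm{HM}_k$. Then $Y \cdot X \sim \mathrm{GGC}$ and $Y/X \sim \mathrm{GGC}$.
   Context: Gamma distribution: for $u,t>0$, $\mathrm{Gamma}(u,t)$ is the distribution on $(0,\infty)$ with density $x \mapsto \Gamma(u)^{-1} t^u x^{u-1} e^{-xt}$. Hyperbolic monotonicity of order $k$: let $f$ be a nonnegative function on $(0,\infty)$. For each fixed $u>0$ the function $v \mapsto f(uv)f(u/v)$, $v>0$, is invariant under $v \mapsto v^{-1}$ and hence is a function $h(w)=h_u(w)$ of $w = v+v^{-1} \in [2,\infty)$. The function $f$ is called $\mathrm{HM}_k$ (hyperbolically monotone of order $k$, $k\ge 1$ an integer) if for every $u>0$ one has $(-1)^j h^{(j)}(w) \ge 0$ for $j=0,1,\dots,k-1$ and $(-1)^{k-1}h^{(k-1)}(w)$ is non-increasing in $w$. For $k=1$ this means that $h$ is non-increasing. Equivalently (this also fixes the meaning of the highest derivative where $h^{(k-2)}$ has kinks), for every $u>0$, $$h(w) = f(uv)f(u/v) = c_u + \int_{(w,\infty)} (\lambda-w)^{k-1} H_u(d\lambda)$$ (or possibly with $[w,\infty)$ in place of $(w,\infty)$), with a constant $c_u\ge 0$ and a nonnegative measure $H_u$. We write $X \sim \mathrm{HM}_k$ if the positive random variable $X$ has a probability density function on $(0,\infty)$ that is $\mathrm{HM}_k$. Generalized gamma convolution (GGC): a probability distribution on $[0,\infty)$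 whose Laplace transform is of the form $$\phi(s) = \exp\left(-as + \int_{(0,\infty)} \log\left(\frac{t}{t+s}\right)U(dt)\right), \quad s \ge 0,$$ where $a \ge 0$ and $U$ is a nonnegative measure on $(0,\infty)$, finite on compact subsets of $(0,\infty)$, with $\int_{(0,1)} |\log t|\,U(dt) < \infty$ and $\int_{(1,\infty)} t^{-1}U(dt) < \infty$. We write $Z \sim \mathrm{GGC}$ if the distribution of the random variable $Z$ is a GGC. *)

theory Defs
  imports "HOL-Probability.Probability"
begin

definition gamma_density :: "real \<Rightarrow> real \<Rightarrow> real \<Rightarrow> real" where
  "gamma_density u t x =
     (if x > 0 then t powr u * x powr (u - 1) * exp (- x * t) / Gamma u else 0)"

text \<open>
  The sign conditions on the derivatives of \<open>h\<close> up to order \<open>k - 1\<close> on \<open>[2, \<infinity>)\<close>, stated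
  through the integral representation, which also covers functions whose derivative of order
  \<open>k - 2\<close> has kinks. For \<open>k \<ge> 2\<close> the integrand vanishes at \<open>\<lambda> = w\<close>, so integrating over
  \<open>(w, \<infinity>)\<close> or over \<open>[w, \<infinity>)\<close> is the same. For \<open>k = 1\<close> the two versions give exactly the
  right-continuous and the left-continuous functions among the nonnegative non-increasing ones;
  the condition is then that \<open>h\<close> is non-increasing, whatever its values at jumps.
  The integral is a \<open>nn_integral\<close>, so the equation includes its finiteness.
\<close>

definition decreasing_of_order :: "nat \<Rightarrow> (real \<Rightarrow> real) \<Rightarrow> bool" where
  "decreasing_of_order k h \<longleftrightarrow>
     1 \<le> k \<and> (\<forall>w\<ge>2. 0 \<le> h w) \<and>
     (if k = 1 then antimono_on {2..} h
      else \<exists>(c::real) (H::real measure). 0 \<le> c \<and> sets H = sets borel \<and>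
        (\<forall>w\<ge>2. ennreal (h w) =
           ennreal c + (\<integral>\<^sup>+l\<in>{w<..}. ennreal ((l - w) ^ (k - 1)) \<partial>H)))"

text \<open>Only the values of \<open>f\<close> on \<open>(0, \<infinity>)\<close> matter.\<close>

definition hyperbolically_monotone :: "nat \<Rightarrow> (real \<Rightarrow> real) \<Rightarrow> bool" where
  "hyperbolically_monotone k f \<longleftrightarrow>
     (\<forall>x>0. 0 \<le> f x) \<and>
     (\<forall>u>0. \<exists>h. (\<forall>v>0. h (v + 1 / v) = f (u * v) * f (u / v)) \<and> decreasing_of_order k h)"

definition HM_distributed :: "'a measure \<Rightarrow> nat \<Rightarrow> ('a \<Rightarrow> real) \<Rightarrow> bool" where
  "HM_distributed M k X \<longleftrightarrow>
     (\<exists>f. hyperbolically_monotone k f \<and>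
          distributed M lborel X (\<lambda>x. ennreal (if x > 0 then f x else 0)))"

text \<open>
  The conditions on \<open>U\<close> make the integrand \<open>ln (t / (t + s))\<close> integrable for every \<open>s \<ge> 0\<close>,
  so the Bochner integral below is a genuine one.
\<close>

definition GGC :: "real measure \<Rightarrow> bool" where
  "GGC \<mu> \<longleftrightarrow>
     prob_space \<mu> \<and> sets \<mu> = sets borel \<and> (AE x in \<mu>. 0 \<le> x) \<and>
     (\<exists>(a::real) (U::real measure).
        0 \<le> a \<and> sets U = sets borel \<and> emeasure U {..0} = 0 \<and>
        (\<forall>K. compact K \<and> K \<subseteq> {0<..} \<longrightarrow> emeasure U K < \<infinity>) \<and>
        (\<integral>\<^sup>+t\<in>{0<..<1}. ennreal \<bar>ln t\<bar> \<partial>U) < \<infinity> \<and>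
        (\<integral>\<^sup>+t\<in>{1<..}. ennreal (1 / t) \<partial>U) < \<infinity> \<and>
        (\<forall>s\<ge>0. (\<integral>x. exp (- s * x) \<partial>\<mu>) =
           exp (- a * s + (LINT t:{0<..}|U. ln (t / (t + s))))))"

end

theory Submission
  imports Defs "HOL-Complex_Analysis.Complex_Analysis"
begin

text \<open>
  Let \<open>\<phi>(s) = E (1 + s X)\<^sup>-\<^sup>r\<close>, the Laplace transform of \<open>Y X\<close>, and let \<open>\<psi>(s) = - s \<phi>'(s) / \<phi>(s)\<close>.
  The law is a GGC exactly when \<open>\<psi>(s) = a s + \<integral> s / (t + s) U(dt)\<close>, and such a representation exists
  as soon as \<open>\<psi>\<close> is holomorphic off the negative half-line, commutes with conjugation, has
  nonnegative imaginary part on the upper half-plane and vanishes at \<open>0+\<close>. Since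
  \<open>Im \<psi>(\<rho> e\<^sup>i\<^sup>\<theta>)\<close> is the derivative of \<open>ln |\<phi>(\<rho> e\<^sup>i\<^sup>\<theta>)|\<close> in \<open>\<theta>\<close>, the sign of the imaginary part means
  that \<open>|\<phi>(\<rho> e\<^sup>i\<^sup>\<theta>)|\<close> is nondecreasing in \<open>\<theta> \<in> [0, \<pi>)\<close>; this also keeps \<open>\<phi>\<close> away from \<open>0\<close>, because
  \<open>\<phi>(\<rho>) > 0\<close>.

  Monotonicity of the modulus. Write \<open>|\<phi>|\<^sup>2\<close> as a double integral over two copies of \<open>X\<close>, and
  put \<open>x = u v\<close>, \<open>y = u / v\<close>, \<open>v = e\<^sup>q\<close>. The two kernels multiply to a positive multiple of
  \<open>(A + 2 cosh (q + i \<theta>))\<^sup>-\<^sup>r\<close> with \<open>A = \<rho> u + 1 / (\<rho> u) \<ge> 2\<close>, and the two densities to \<open>h(2 cosh q)\<close>, where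
  \<open>h\<close> is the function of the hyperbolic monotonicity condition. So it suffices that, for
  each \<open>u\<close>, the integral of \<open>(A + 2 cosh (q + i \<theta>))\<^sup>-\<^sup>r h(2 cosh q)\<close> over \<open>q\<close> is nondecreasing in \<open>\<theta>\<close>. For
  the extremal function \<open>h(w) = (\<lambda> - w)\<^sub>+\<^sup>r\<^sup>-\<^sup>1\<close> the substitution
  \<open>tanh (q / 2) = tanh (l / 2) tanh (\<xi> / 2)\<close>, \<open>\<lambda> = 2 cosh l\<close>, turns it into a constant times the
  integral of \<open>(Q + 2 m cosh (\<xi> + i \<eta>))\<^sup>-\<^sup>r\<close> with \<open>Q = 4 cos \<theta> + A \<lambda>\<close> and
  \<open>m = |A + 2 cosh (l + i \<theta>)|\<close>, \<open>2 m \<le> Q\<close>; the phase \<open>\<eta>\<close> disappears by a contour shift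
  (\<open>integral_shifted_cosh_powr_shift\<close>), and \<open>Q\<close> and \<open>m\<close> decrease in \<open>\<theta>\<close>
  (\<open>integral_shifted_cosh_powr_extremal_mono\<close>). Because \<open>r \<le> k\<close>, Euler's Beta integral writes
  \<open>(\<lambda> - w)\<^sub>+\<^sup>k\<^sup>-\<^sup>1\<close> as a mixture of the functions \<open>(\<mu> - w)\<^sub>+\<^sup>r\<^sup>-\<^sup>1\<close>; up to a constant, \<open>h\<close> itself is a
  mixture of the former; and mixtures preserve the inequality (\<open>norm_stieltjes_mono\<close>).

  From the half-plane property to the Thorin measure. With \<open>s = ((1 + z) / (1 - z))\<^sup>2\<close>, \<open>\<psi>\<close> becomes a
  typically real function on the unit disc: the imaginary part has the sign of \<open>Im z\<close>. Up
  to an additive constant, such functions are mixtures of \<open>z / (1 - 2 c z + z\<^sup>2)\<close>, \<open>c \<in> [-1, 1]\<close>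
  (\<open>typically_real_representation\<close>); on a circle inside the disc this is Cauchy's formula, and the
  radius tends to \<open>1\<close> by tightness. The mass at \<open>c = 1\<close> yields the drift \<open>a\<close>, and
  \<open>t = (1 + c) / (1 - c)\<close> carries the rest to \<open>U\<close>; the condition \<open>\<psi>(0+) = 0\<close>
  excludes mass at \<open>c = -1\<close> (\<open>thorin_representation\<close>).

  Finally \<open>1 / X\<close> has the same property as \<open>X\<close>: in terms of the density of \<open>ln X\<close>, passing to the
  reciprocal is the reflection \<open>a \<mapsto> - a\<close>.
\<close>

section \<open>Changes of variables\<close>

text \<open>
  Substitution on the whole line as an identity of measures, so that it serves complex
  integrands and integrability statements at once.
\<close>
lemma distr_density_deriv_lborel:
  fixes g g' :: "real \<Rightarrow> real"
  assumes deriv: "\<And>x. (g has_real_derivative g' x) (at x)"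
    and cont: "continuous_on UNIV g'" and nonneg: "\<And>x. 0 \<le> g' x"
  shows "distr (density lborel (\<lambda>x. ennreal (g' x))) borel g
       = density lborel (indicator (range g))"
    and "range g \<in> sets borel"
proof -
  have contg: "continuous_on UNIV g"
    using deriv by (meson DERIV_isCont continuous_at_imp_continuous_on)
  have [measurable]: "g \<in> borel_measurable borel" "g' \<in> borel_measurable borel"
    using contg cont by (auto intro: borel_measurable_continuous_onI)
  have mono: "g x \<le> g y" if "x \<le> y" for x y
    using that deriv nonneg by (meson DERIV_nonneg_imp_nondecreasing)
  have range_eq: "range g = (\<Union>n. {g (- real (Suc n))..g (real (Suc n))})"
  proof (intro equalityI subsetI)
    fix y assume "y \<in> range g"
    then obtain x where x: "y = g x" by auto
    obtain n where "\<bar>x\<bar> \<le> real n" using real_arch_simple by blast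
    then have "- real (Suc n) \<le> x" "x \<le> real (Suc n)" by auto
    then show "y \<in> (\<Union>n. {g (- real (Suc n))..g (real (Suc n))})"
      unfolding x using mono by (intro UN_I[of n]) auto
  next
    fix y assume "y \<in> (\<Union>n. {g (- real (Suc n))..g (real (Suc n))})"
    then obtain n where n: "g (- real (Suc n)) \<le> y" "y \<le> g (real (Suc n))" by auto
    have "\<exists>x\<ge>- real (Suc n). x \<le> real (Suc n) \<and> g x = y"
      by (rule IVT') (use n in \<open>auto intro: continuous_on_subset[OF contg]\<close>)
    then show "y \<in> range g" by auto
  qed
  show R[measurable]: "range g \<in> sets borel" unfolding range_eq by measurable
  show "distr (density lborel (\<lambda>x. ennreal (g' x))) borel g
       = density lborel (indicator (range g))"
  proof (rule measure_eqI)
    fix A assume "A \<in> sets (distr (density lborel (\<lambda>x. ennreal (g' x))) borel g)"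
    then have A[measurable]: "A \<in> sets borel" by simp
    let ?L = "\<lambda>n x. indicator A (g x) * ennreal (g' x) * indicator {- real (Suc n)..real (Suc n)} x"
    let ?R = "\<lambda>n x. indicator A x * indicator {g (- real (Suc n))..g (real (Suc n))} x :: ennreal"
    have eq: "(\<integral>\<^sup>+x. ?R n x \<partial>lborel) = (\<integral>\<^sup>+x. ?L n x \<partial>lborel)" for n
      by (rule nn_integral_substitution_aux)
         (auto intro: deriv nonneg continuous_on_subset[OF cont])
    have lim1: "(\<lambda>n. \<integral>\<^sup>+x. ?L n x \<partial>lborel) \<longlonglongrightarrow> (\<integral>\<^sup>+x. indicator A (g x) * ennreal (g' x) \<partial>lborel)"
    proof (rule nn_integral_LIMSEQ)
      show "incseq (\<lambda>n x. ?L n x)"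
        by (auto simp: incseq_def le_fun_def indicator_def)
      fix x :: real
      obtain N where N: "\<bar>x\<bar> \<le> real N" using real_arch_simple by blast
      have "\<forall>\<^sub>F n in sequentially. ?L n x = indicator A (g x) * ennreal (g' x)"
        using eventually_ge_at_top[of N]
      proof eventually_elim
        case (elim n)
        then have "x \<in> {- real (Suc n)..real (Suc n)}" using N by auto
        then show ?case by simp
      qed
      then show "(\<lambda>n. ?L n x) \<longlonglongrightarrow> indicator A (g x) * ennreal (g' x)"
        by (rule tendsto_eventually)
    qed auto
    have lim2: "(\<lambda>n. \<integral>\<^sup>+x. ?R n x \<partial>lborel) \<longlonglongrightarrow> (\<integral>\<^sup>+x. indicator A x * indicator (range g) x \<partial>lborel)"
    proof (rule nn_integral_LIMSEQ)
      have "{g (- real (Suc m))..g (real (Suc m))} \<subseteq> {g (- real (Suc n))..g (real (Suc n))}"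
        if "m \<le> n" for m n
        using mono[of "- real (Suc n)" "- real (Suc m)"] mono[of "real (Suc m)" "real (Suc n)"] that
        by auto
      then show "incseq (\<lambda>n x. ?R n x)"
        by (auto simp: incseq_def le_fun_def split: split_indicator) (meson order_trans)+
      fix x :: real
      show "(\<lambda>n. ?R n x) \<longlonglongrightarrow> indicator A x * indicator (range g) x"
      proof (cases "x \<in> range g")
        case True
        then obtain z where z: "x = g z" by auto
        obtain N where N: "\<bar>z\<bar> \<le> real N" using real_arch_simple by blast
        have "\<forall>\<^sub>F n in sequentially. ?R n x = indicator A x * indicator (range g) x"
          using eventually_ge_at_top[of N]
        proof eventually_elim
          case (elim n)
          have "g (- real (Suc n)) \<le> x" "x \<le> g (real (Suc n))"
            unfolding z using elim N by (auto intro!: mono)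
          then show ?case using True by (auto split: split_indicator)
        qed
        then show ?thesis by (rule tendsto_eventually)
      next
        case False
        then have "x \<notin> {g (- real (Suc n))..g (real (Suc n))}" for n
          unfolding range_eq by blast
        then have "(\<lambda>n. ?R n x) = (\<lambda>_. 0)" by (intro ext) (simp del: of_nat_Suc)
        then show ?thesis using False by (simp del: of_nat_Suc)
      qed
    qed auto
    have "emeasure (distr (density lborel (\<lambda>x. ennreal (g' x))) borel g) A
        = (\<integral>\<^sup>+x. indicator A x \<partial>distr (density lborel (\<lambda>x. ennreal (g' x))) borel g)"
      by simp
    also have "\<dots> = (\<integral>\<^sup>+x. indicator A (g x) \<partial>density lborel (\<lambda>x. ennreal (g' x)))"
      by (rule nn_integral_distr) auto
    also have "\<dots> = (\<integral>\<^sup>+x. indicator A (g x) * ennreal (g' x) \<partial>lborel)"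
      by (subst nn_integral_density) (auto simp: mult.commute)
    also have "\<dots> = (\<integral>\<^sup>+x. indicator A x * indicator (range g) x \<partial>lborel)"
      by (rule LIMSEQ_unique[OF lim1]) (use lim2 in \<open>simp only: eq\<close>)
    also have "\<dots> = emeasure (density lborel (indicator (range g))) A"
      by (auto simp: emeasure_density mult.commute intro!: nn_integral_cong)
    finally show "emeasure (distr (density lborel (\<lambda>x. ennreal (g' x))) borel g) A
        = emeasure (density lborel (indicator (range g))) A" .
  qed simp
qed

text \<open>
  In logarithmic coordinates this is the substitution \<open>x = u v\<close>, \<open>y = u / v\<close>. The factor \<open>2\<close> is the
  Jacobian of \<open>(p, q) \<mapsto> (p + q, p - q)\<close>; one variable at a time, only affine substitutions occur.
\<close>
lemma distr_lborel_sum_diff: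
  "distr (density (lborel \<Otimes>\<^sub>M lborel) (\<lambda>_. 2)) (borel \<Otimes>\<^sub>M borel)
     (\<lambda>(p, q). (p + q, p - q)) = (lborel \<Otimes>\<^sub>M lborel :: (real \<times> real) measure)"
proof (rule measure_eqI)
  fix A :: "(real \<times> real) set"
  assume "A \<in> sets (distr (density (lborel \<Otimes>\<^sub>M lborel) (\<lambda>_. 2)) (borel \<Otimes>\<^sub>M borel)
     (\<lambda>(p, q). (p + q, p - q)))"
  then have [measurable]: "A \<in> sets (borel \<Otimes>\<^sub>M borel)" by simp
  have "emeasure (lborel \<Otimes>\<^sub>M lborel) A
      = (\<integral>\<^sup>+a. \<integral>\<^sup>+b. indicator A (a, b) \<partial>lborel \<partial>lborel)"
    by (simp add: lborel.emeasure_pair_measure)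
  also have "\<dots> = (\<integral>\<^sup>+a. \<integral>\<^sup>+q. 2 * indicator A (a, a - 2 * q) \<partial>lborel \<partial>lborel)"
  proof (rule nn_integral_cong)
    fix a :: real
    show "(\<integral>\<^sup>+b. indicator A (a, b) \<partial>lborel) = (\<integral>\<^sup>+q. 2 * indicator A (a, a - 2 * q) \<partial>lborel)"
      by (subst nn_integral_real_affine[of _ "-2" a]) (simp_all add: nn_integral_cmult)
  qed
  also have "\<dots> = (\<integral>\<^sup>+q. \<integral>\<^sup>+a. 2 * indicator A (a, a - 2 * q) \<partial>lborel \<partial>lborel)"
    by (rule lborel_pair.Fubini') measurable
  also have "\<dots> = (\<integral>\<^sup>+q. \<integral>\<^sup>+p. 2 * indicator A (p + q, p - q) \<partial>lborel \<partial>lborel)"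
  proof (rule nn_integral_cong)
    fix q :: real
    show "(\<integral>\<^sup>+a. 2 * indicator A (a, a - 2 * q) \<partial>lborel)
        = (\<integral>\<^sup>+p. 2 * indicator A (p + q, p - q) \<partial>lborel)"
      by (subst nn_integral_real_affine[of _ 1 q]) (simp_all add: algebra_simps)
  qed
  also have "\<dots> = (\<integral>\<^sup>+p. \<integral>\<^sup>+q. 2 * indicator A (p + q, p - q) \<partial>lborel \<partial>lborel)"
    by (rule lborel_pair.Fubini') measurable
  also have "\<dots> = (\<integral>\<^sup>+z. 2 * indicator A (fst z + snd z, fst z - snd z) \<partial>(lborel \<Otimes>\<^sub>M lborel))"
    by (subst lborel.nn_integral_fst[symmetric]) simp_all
  also have "\<dots> = emeasure (distr (density (lborel \<Otimes>\<^sub>M lborel) (\<lambda>_. 2)) (borel \<Otimes>\<^sub>M borel)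
     (\<lambda>(p, q). (p + q, p - q))) A"
  proof -
    let ?B = "{z \<in> space (lborel \<Otimes>\<^sub>M lborel). (fst z + snd z, fst z - snd z) \<in> A}"
    have "emeasure (distr (density (lborel \<Otimes>\<^sub>M lborel) (\<lambda>_. 2)) (borel \<Otimes>\<^sub>M borel)
        (\<lambda>(p, q). (p + q, p - q))) A = emeasure (density (lborel \<Otimes>\<^sub>M lborel) (\<lambda>_. 2)) ?B"
      by (subst emeasure_distr) (auto intro!: arg_cong2[where f=emeasure])
    also have "\<dots> = (\<integral>\<^sup>+z. 2 * indicator ?B z \<partial>(lborel \<Otimes>\<^sub>M lborel))"
      by (rule emeasure_density) measurable
    finally show ?thesis
      by (auto intro!: nn_integral_cong split: split_indicator)
  qed
  finally show "emeasure (distr (density (lborel \<Otimes>\<^sub>M lborel) (\<lambda>_. 2)) (borel \<Otimes>\<^sub>M borel)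
     (\<lambda>(p, q). (p + q, p - q))) A = emeasure (lborel \<Otimes>\<^sub>M lborel) A" by simp
qed (simp cong: sets_pair_measure_cong)

section \<open>The kernel A + 2 cosh z on horizontal lines\<close>

text \<open>
  \<open>2 cosh z\<close> is spelled out with exponentials because all algebra below takes place in the
  variable \<open>e\<^sup>z\<close>.
\<close>
definition shifted_cosh :: "real \<Rightarrow> complex \<Rightarrow> complex" where
  "shifted_cosh A z = of_real A + (exp z + exp (- z))"

lemma Re_shifted_cosh: "Re (shifted_cosh A (Complex x y)) = A + 2 * cosh x * cos y"
  by (simp add: shifted_cosh_def Re_exp cosh_def algebra_simps)

lemma Im_shifted_cosh: "Im (shifted_cosh A (Complex x y)) = 2 * sinh x * sin y"
  by (simp add: shifted_cosh_def Im_exp sinh_def algebra_simps)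

lemma shifted_cosh_real: "shifted_cosh A (Complex x 0) = of_real (A + 2 * cosh x)"
  by (simp add: complex_eq_iff Re_shifted_cosh Im_shifted_cosh)

text \<open>
  For \<open>A = b + 1 / b\<close> the kernel is \<open>(b + e\<^sup>z) (1 / b + e\<^sup>z) e\<^sup>-\<^sup>z\<close>, and
  \<open>|b + \<rho> e\<^sup>i\<^sup>y| \<ge> cos (y / 2) (b + \<rho>)\<close> for both factors. The proof squares the claim and checks it as a
  polynomial inequality in \<open>cos y\<close>, \<open>cosh x\<close> and \<open>A\<close>.
\<close>
lemma norm_shifted_cosh_lower:
  assumes "2 \<le> A"
  shows "((1 + cos y) / 2) * (A + 2 * cosh x) \<le> norm (shifted_cosh A (Complex x y))"
proof (rule power2_le_imp_le)
  define c where "c = cos y"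
  define B where "B = A / 2"
  define C where "C = cosh x"
  have c: "-1 \<le> c" "c \<le> 1" by (auto simp: c_def)
  have BC: "1 \<le> B" "1 \<le> C" using assms by (auto simp: B_def C_def cosh_real_ge_1)
  have "(norm (shifted_cosh A (Complex x y)))\<^sup>2 = (2 * B + 2 * C * c)\<^sup>2 + 4 * (sinh x)\<^sup>2 * (sin y)\<^sup>2"
    by (simp only: cmod_power2 Re_shifted_cosh Im_shifted_cosh) (simp add: B_def C_def c_def power_mult_distrib)
  also have "(sinh x)\<^sup>2 = C\<^sup>2 - 1" by (simp add: C_def cosh_square_eq)
  also have "(sin y)\<^sup>2 = 1 - c\<^sup>2" by (simp add: c_def sin_squared_eq)
  finally have n: "(norm (shifted_cosh A (Complex x y)))\<^sup>2
      = 4 * ((B + C)\<^sup>2 - 2 * (B * C) * (1 - c) - (1 - c\<^sup>2))"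
    by (simp add: power2_eq_square algebra_simps)
  have 1: "2 * (B * C) * (1 - c) \<le> (B + C)\<^sup>2 / 2 * (1 - c)"
    using c sum_squares_ge_zero[of "B - C" 0]
    by (intro mult_right_mono) (auto simp: power2_eq_square algebra_simps)
  have "2\<^sup>2 \<le> (B + C)\<^sup>2" using BC by (intro power_mono) auto
  then have 2: "1 * (1 - c\<^sup>2) \<le> (B + C)\<^sup>2 / 4 * (1 - c\<^sup>2)"
    using c by (intro mult_right_mono) (auto simp: abs_square_le_1 abs_le_iff)
  have "(((1 + cos y) / 2) * (A + 2 * cosh x))\<^sup>2 = (1 + c)\<^sup>2 * (B + C)\<^sup>2"
    by (simp add: B_def C_def c_def power2_eq_square algebra_simps)
  also have "\<dots> = 4 * ((B + C)\<^sup>2 - (B + C)\<^sup>2 / 2 * (1 - c) - (B + C)\<^sup>2 / 4 * (1 - c\<^sup>2))"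
    by (simp add: power2_eq_square field_simps)
  also have "\<dots> \<le> (norm (shifted_cosh A (Complex x y)))\<^sup>2"
    unfolding n using 1 2 by (intro mult_left_mono) auto
  finally show "(((1 + cos y) / 2) * (A + 2 * cosh x))\<^sup>2 \<le> (norm (shifted_cosh A (Complex x y)))\<^sup>2" .
qed simp

lemma one_plus_cos_pos: "0 < 1 + cos y" if "\<bar>y\<bar> < pi" for y :: real
proof -
  have "cos pi < cos \<bar>y\<bar>" using that by (intro cos_monotone_0_pi) auto
  then show ?thesis by simp
qed

lemma shifted_cosh_not_nonpos:
  assumes "2 \<le> A" "\<bar>y\<bar> < pi"
  shows "shifted_cosh A (Complex x y) \<notin> \<real>\<^sub>\<le>\<^sub>0"
proof
  assume "shifted_cosh A (Complex x y) \<in> \<real>\<^sub>\<le>\<^sub>0"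
  then have *: "A + 2 * cosh x * cos y \<le> 0" "sinh x * sin y = 0"
    by (auto simp: complex_nonpos_Reals_iff Re_shifted_cosh Im_shifted_cosh)
  show False
  proof (cases "sinh x = 0")
    case True
    then have "x = 0" by simp
    then show False using * one_plus_cos_pos[OF assms(2)] assms(1) by simp
  next
    case False
    then have "sin \<bar>y\<bar> = 0" using * by (simp add: abs_if)
    then have "y = 0" using sin_gt_zero[of "\<bar>y\<bar>"] assms by (cases "y = 0") auto
    then show False using * assms cosh_real_pos[of x] by simp
  qed
qed

lemma norm_shifted_cosh_powr_le:
  assumes "2 \<le> A" "\<bar>y\<bar> < pi" "0 < r"
  shows "norm (shifted_cosh A (Complex x y) powr (- of_real r))
       \<le> ((1 + cos y) / 2) powr (- r) * (A + 2 * cosh x) powr (- r)"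
proof -
  have pos: "0 < (1 + cos y) / 2" "0 < A + 2 * cosh x"
    using one_plus_cos_pos assms cosh_real_pos[of x] by (auto intro: add_pos_pos)
  have "norm (shifted_cosh A (Complex x y) powr (- of_real r)) = norm (shifted_cosh A (Complex x y)) powr (- r)"
    using norm_powr_real_powr'[of "- of_real r"] by simp
  also have "\<dots> \<le> (((1 + cos y) / 2) * (A + 2 * cosh x)) powr (- r)"
    using norm_shifted_cosh_lower[OF assms(1)] pos assms(3)
    by (intro powr_mono2') auto
  also have "\<dots> = ((1 + cos y) / 2) powr (- r) * (A + 2 * cosh x) powr (- r)"
    by (rule powr_mult)
  finally show ?thesis .
qed

lemma integrable_exp_neg_abs:
  assumes "0 < (r::real)"
  shows "integrable lborel (\<lambda>x::real. exp (- r * \<bar>x\<bar>))"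
proof -
  interpret prob_space "density lborel (exponential_density r)"
    by (rule prob_space_exponential_density[OF assms])
  have "integrable (density lborel (exponential_density r)) (\<lambda>_. 1 :: real)" by simp
  then have 1: "integrable lborel (exponential_density r)"
    by (subst (asm) integrable_density)
       (use assms in \<open>auto simp: exponential_density_nonneg\<close>)
  then have 2: "integrable lborel (\<lambda>x. exponential_density r (0 + (-1) * x))"
    by (subst lborel_integrable_real_affine_iff) auto
  have "integrable lborel (\<lambda>x. (exponential_density r x + exponential_density r (0 + (-1) * x)) / r)"
    using 1 2 by (intro integrable_divide Bochner_Integration.integrable_add)
  then show ?thesis
    by (rule Bochner_Integration.integrable_bound)
       (use assms in \<open>auto simp: exponential_density_def abs_if mult.commute\<close>)
qed

lemma two_cosh_ge_exp_abs: "exp \<bar>x\<bar> \<le> 2 * cosh (x::real)"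
  by (auto simp: cosh_def abs_if)

lemma shifted_cosh_powr_le_exp:
  fixes A r x :: real
  assumes "0 \<le> A" "0 < r"
  shows "(A + 2 * cosh x) powr (- r) \<le> exp (- r * \<bar>x\<bar>)"
proof -
  have "(A + 2 * cosh x) powr (- r) \<le> exp \<bar>x\<bar> powr (- r)"
    using two_cosh_ge_exp_abs[of x] assms by (intro powr_mono2') auto
  also have "\<dots> = exp (- r * \<bar>x\<bar>)" by (simp add: powr_def)
  finally show ?thesis .
qed

lemma borel_measurable_cosh [measurable (raw)]:
  fixes f :: "'b \<Rightarrow> real"
  assumes [measurable]: "f \<in> borel_measurable M"
  shows "(\<lambda>x. cosh (f x)) \<in> borel_measurable M"
  unfolding cosh_def by measurable

lemma borel_measurable_shifted_cosh_powr [measurable]: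
  "(\<lambda>x. shifted_cosh A (Complex x y) powr (- of_real r)) \<in> borel_measurable borel"
  unfolding shifted_cosh_def Complex_eq by measurable

lemma integrable_shifted_cosh_powr_real:
  fixes A r :: real
  assumes "0 \<le> A" "0 < r"
  shows "integrable lborel (\<lambda>x. (A + 2 * cosh x) powr (- r))"
  by (rule Bochner_Integration.integrable_bound[OF integrable_exp_neg_abs[OF assms(2)]])
     (use shifted_cosh_powr_le_exp[OF assms] in auto)

lemma integrable_shifted_cosh_powr:
  assumes "2 \<le> A" "0 < r" "\<bar>y\<bar> < pi"
  shows "integrable lborel (\<lambda>x. shifted_cosh A (Complex x y) powr (- of_real r))"
proof (rule Bochner_Integration.integrable_bound)
  show "integrable lborel (\<lambda>x. ((1 + cos y) / 2) powr (- r) * (A + 2 * cosh x) powr (- r))"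
    using assms by (intro integrable_mult_right integrable_shifted_cosh_powr_real) auto
  show "AE x in lborel. norm (shifted_cosh A (Complex x y) powr (- of_real r))
      \<le> norm (((1 + cos y) / 2) powr (- r) * (A + 2 * cosh x) powr (- r))"
    using norm_shifted_cosh_powr_le assms by auto
qed simp

text \<open>
  The integrand is holomorphic and exponentially small at both ends of the strip \<open>|Im z| < \<pi>\<close>. With
  a primitive \<open>F\<close> on this convex set, the integrals over \<open>[-N, N]\<close> and over its translate by
  \<open>i y\<close> are increments of \<open>F\<close>, and they differ by two increments of \<open>F\<close> along short vertical
  segments, which vanish as \<open>N\<close> grows.
\<close>
lemma integral_shifted_cosh_powr_shift:
  assumes A: "2 \<le> A" and r: "0 < r" and y: "\<bar>y\<bar> < pi"
  shows "(\<integral>x. shifted_cosh A (Complex x y) powr (- of_real r) \<partial>lborel)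
       = of_real (\<integral>x. (A + 2 * cosh x) powr (- r) \<partial>lborel)"
proof -
  define S where "S = {z::complex. \<bar>Im z\<bar> < pi}"
  define f where "f z = shifted_cosh A z powr (- of_real r)" for z
  have S_eq: "S = {z. Im z < pi} \<inter> {z. - pi < Im z}" by (auto simp: S_def)
  have "convex S" "open S" unfolding S_eq
    by (auto intro!: convex_Int convex_halfspace_Im_lt convex_halfspace_Im_gt
        open_Int open_halfspace_Im_lt open_halfspace_Im_gt)
  moreover have "f holomorphic_on S"
    unfolding f_def
  proof (intro holomorphic_on_powr)
    show "shifted_cosh A holomorphic_on S"
      unfolding shifted_cosh_def by (intro holomorphic_intros)
    fix z assume "z \<in> S"
    then show "shifted_cosh A z \<notin> \<real>\<^sub>\<le>\<^sub>0"
      using shifted_cosh_not_nonpos[OF A, of "Im z" "Re z"] by (simp add: S_def complex_eq)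
  qed simp
  ultimately obtain F where F: "\<And>z. z \<in> S \<Longrightarrow> (F has_field_derivative f z) (at z within S)"
    using holomorphic_convex_primitive' by blast
  \<comment> \<open>The bound on the kernel is weakest on the outer line, so this constant serves the whole strip.\<close>
  define K where "K = ((1 + cos y) / 2) powr (- r)"
  have fb: "norm (f (Complex x v)) \<le> K * exp (- r * \<bar>x\<bar>)" if "\<bar>v\<bar> \<le> \<bar>y\<bar>" for x v
  proof -
    have v: "\<bar>v\<bar> < pi" using that y by simp
    have "cos \<bar>y\<bar> \<le> cos \<bar>v\<bar>" using that y by (intro cos_monotone_0_pi_le) auto
    then have "((1 + cos v) / 2) powr (- r) \<le> K"
      unfolding K_def using one_plus_cos_pos[OF y] r by (intro powr_mono2') auto
    then have "((1 + cos v) / 2) powr (- r) * (A + 2 * cosh x) powr (- r) \<le> K * exp (- r * \<bar>x\<bar>)"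
      using shifted_cosh_powr_le_exp[of A r x] A r by (intro mult_mono) (auto simp: K_def)
    then show ?thesis
      using norm_shifted_cosh_powr_le[OF A v r, of x] by (simp add: f_def)
  qed
  have FTC: "(LBINT x:{-N..N}. f (Complex x v)) = F (Complex N v) - F (Complex (-N) v)"
    if "\<bar>v\<bar> < pi" "0 \<le> N" for N v
  proof -
    have "((\<lambda>x. f (Complex x v)) has_integral F (Complex N v) - F (Complex (-N) v)) {-N..N}"
    proof (rule fundamental_theorem_of_calculus)
      fix x assume "x \<in> {-N..N}"
      have S: "Complex x v \<in> S" using that by (simp add: S_def)
      have "(F has_field_derivative f (Complex x v)) (at (Complex x v))"
        using F[OF S] at_within_open[OF S \<open>open S\<close>] by simp
      moreover have "((\<lambda>x. Complex x v) has_vector_derivative 1) (at x within {-N..N})"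
        unfolding Complex_eq by (auto intro!: derivative_eq_intros simp: scaleR_conv_of_real)
      ultimately have "(F \<circ> (\<lambda>x. Complex x v) has_vector_derivative 1 * f (Complex x v)) (at x within {-N..N})"
        by (rule field_vector_diff_chain_within[rotated, OF has_field_derivative_at_within])
      then show "((\<lambda>x. F (Complex x v)) has_vector_derivative f (Complex x v)) (at x within {-N..N})"
        by (simp add: o_def)
    qed (use that in simp)
    moreover have "integrable lborel (\<lambda>x. f (Complex x v))"
      unfolding f_def using A r that by (intro integrable_shifted_cosh_powr)
    then have "set_integrable lborel {-N..N} (\<lambda>x. f (Complex x v))"
      unfolding set_integrable_def by (intro integrable_mult_indicator) auto
    ultimately show ?thesis
      by (simp add: set_borel_integral_eq_integral integral_unique)
  qed
  have side: "norm (F (Complex x y) - F (Complex x 0)) \<le> K * exp (- r * \<bar>x\<bar>) * \<bar>y\<bar>" for x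
  proof -
    let ?T = "{z. Re z = x \<and> \<bar>Im z\<bar> \<le> \<bar>y\<bar>}"
    have T_eq: "?T = {z. Re z = x} \<inter> ({z. Im z \<le> \<bar>y\<bar>} \<inter> {z. - \<bar>y\<bar> \<le> Im z})" by auto
    have "norm (F (Complex x y) - F (Complex x 0))
       \<le> K * exp (- r * \<bar>x\<bar>) * norm (Complex x y - Complex x 0)"
    proof (rule field_differentiable_bound[of ?T _ f])
      show "convex ?T" unfolding T_eq
        by (intro convex_Int convex_halfspace_Im_le convex_halfspace_Im_ge)
           (auto simp: convex_alt algebra_simps)
      fix z assume z: "z \<in> ?T"
      then have "z \<in> S" using y by (auto simp: S_def)
      from F[OF this] show "(F has_field_derivative f z) (at z within ?T)"
        by (rule has_field_derivative_subset) (use y in \<open>auto simp: S_def\<close>)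
      show "norm (f z) \<le> K * exp (- r * \<bar>x\<bar>)"
        using fb[of "Im z" "Re z"] z by (simp add: complex_eq)
    qed auto
    also have "norm (Complex x y - Complex x 0) = \<bar>y\<bar>"
      by (simp add: cmod_def)
    finally show ?thesis .
  qed
  have lim: "(\<lambda>n. LBINT x:{-real n..real n}. f (Complex x v)) \<longlonglongrightarrow> (\<integral>x. f (Complex x v) \<partial>lborel)"
    if "\<bar>v\<bar> < pi" for v
    unfolding set_lebesgue_integral_def
  proof (rule integral_dominated_convergence)
    show "integrable lborel (\<lambda>x. norm (f (Complex x v)))"
      unfolding f_def using A r that by (intro integrable_norm integrable_shifted_cosh_powr)
    show "AE x in lborel. (\<lambda>n. indicator {- real n..real n} x *\<^sub>R f (Complex x v)) \<longlonglongrightarrow> f (Complex x v)"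
    proof (intro AE_I2 tendsto_eventually)
      fix x :: real
      obtain N where N: "\<bar>x\<bar> \<le> real N" using real_arch_simple by blast
      show "\<forall>\<^sub>F n in sequentially. indicator {- real n..real n} x *\<^sub>R f (Complex x v) = f (Complex x v)"
        using eventually_ge_at_top[of N]
      proof eventually_elim
        case (elim n)
        then have "x \<in> {- real n..real n}" using N by auto
        then show ?case by simp
      qed
    qed
    show "AE x in lborel. norm (indicator {- real n..real n} x *\<^sub>R f (Complex x v)) \<le> norm (f (Complex x v))" for n
      by (auto split: split_indicator)
  qed (auto simp: f_def)
  have "(\<lambda>n. (LBINT x:{-real n..real n}. f (Complex x y)) - (LBINT x:{-real n..real n}. f (Complex x 0))) \<longlonglongrightarrow> 0"
  proof (rule Lim_null_comparison)
    show "\<forall>\<^sub>F n in sequentially. norm ((LBINT x:{-real n..real n}. f (Complex x y))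
        - (LBINT x:{-real n..real n}. f (Complex x 0))) \<le> 2 * K * \<bar>y\<bar> * exp (- r * real n)"
    proof (intro always_eventually allI)
      fix n :: nat
      have "(LBINT x:{-real n..real n}. f (Complex x y)) - (LBINT x:{-real n..real n}. f (Complex x 0))
          = (F (Complex (real n) y) - F (Complex (real n) 0))
            - (F (Complex (- real n) y) - F (Complex (- real n) 0))"
        using y by (simp add: FTC)
      also have "norm \<dots> \<le> norm (F (Complex (real n) y) - F (Complex (real n) 0))
            + norm (F (Complex (- real n) y) - F (Complex (- real n) 0))"
        by (rule norm_triangle_ineq4)
      also have "\<dots> \<le> 2 * K * \<bar>y\<bar> * exp (- r * real n)"
      proof -
        have "2 * K * \<bar>y\<bar> * exp (- r * real n)
            = K * exp (- r * \<bar>real n\<bar>) * \<bar>y\<bar> + K * exp (- r * \<bar>- real n\<bar>) * \<bar>y\<bar>"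
          by simp
        then show ?thesis using side[of "real n"] side[of "- real n"] by linarith
      qed
      finally show "norm ((LBINT x:{-real n..real n}. f (Complex x y))
        - (LBINT x:{-real n..real n}. f (Complex x 0))) \<le> 2 * K * \<bar>y\<bar> * exp (- r * real n)" .
    qed
    show "(\<lambda>n. 2 * K * \<bar>y\<bar> * exp (- r * real n)) \<longlonglongrightarrow> 0"
      using r by real_asymp
  qed
  moreover have "(\<lambda>n. (LBINT x:{-real n..real n}. f (Complex x y)) - (LBINT x:{-real n..real n}. f (Complex x 0)))
     \<longlonglongrightarrow> (\<integral>x. f (Complex x y) \<partial>lborel) - (\<integral>x. f (Complex x 0) \<partial>lborel)"
    by (intro tendsto_diff lim) (use y in auto)
  ultimately have "(\<integral>x. f (Complex x y) \<partial>lborel) - (\<integral>x. f (Complex x 0) \<partial>lborel) = 0"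
    using LIMSEQ_unique by blast
  moreover have "f (Complex x 0) = of_real ((A + 2 * cosh x) powr (- r))" for x
    unfolding f_def shifted_cosh_real using A cosh_real_pos[of x]
    by (subst powr_of_real[symmetric]) (auto intro: add_nonneg_nonneg)
  ultimately show ?thesis by (simp add: f_def)
qed

lemma norm_shifted_cosh_sq:
  "(norm (shifted_cosh A (Complex l y)))\<^sup>2
     = A\<^sup>2 + (2 * cosh l)\<^sup>2 - 4 + 2 * A * (2 * cosh l) * cos y + 4 * (cos y)\<^sup>2"
proof -
  have "(norm (shifted_cosh A (Complex l y)))\<^sup>2 = (A + 2 * cosh l * cos y)\<^sup>2 + 4 * (sinh l)\<^sup>2 * (sin y)\<^sup>2"
    by (simp only: cmod_power2 Re_shifted_cosh Im_shifted_cosh) (simp add: power_mult_distrib)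
  also have "(sinh l)\<^sup>2 = (cosh l)\<^sup>2 - 1" by (simp add: cosh_square_eq)
  also have "(sin y)\<^sup>2 = 1 - (cos y)\<^sup>2" by (simp add: sin_squared_eq)
  finally show ?thesis by (simp add: power2_eq_square algebra_simps)
qed

section \<open>The extremal case\<close>

text \<open>
  The difference of the squares is \<open>(A\<^sup>2 - 4) ((2 cosh l)\<^sup>2 - 4)\<close>. The inequality is what allows
  the contour shift to be applied to \<open>Q + 2 m cosh\<close> in the next lemma.
\<close>
lemma two_norm_shifted_cosh_le:
  assumes "2 \<le> A"
  shows "2 * norm (shifted_cosh A (Complex l y)) \<le> 4 * cos y + A * (2 * cosh l)"
proof (rule power2_le_imp_le)
  have l: "2 \<le> 2 * cosh l" using cosh_real_ge_1[of l] by simp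
  have "0 \<le> (A\<^sup>2 - 4) * ((2 * cosh l)\<^sup>2 - 4)"
    using power_mono[OF assms, of 2] power_mono[OF l, of 2] by (intro mult_nonneg_nonneg) auto
  also have "\<dots> = (4 * cos y + A * (2 * cosh l))\<^sup>2 - (2 * norm (shifted_cosh A (Complex l y)))\<^sup>2"
    by (simp only: power_mult_distrib[of 2 "norm _"] norm_shifted_cosh_sq)
       (simp add: power2_eq_square algebra_simps)
  finally show "(2 * norm (shifted_cosh A (Complex l y)))\<^sup>2 \<le> (4 * cos y + A * (2 * cosh l))\<^sup>2" by simp
  have "2 * 2 \<le> A * (2 * cosh l)" using assms l by (intro mult_mono) auto
  then show "0 \<le> 4 * cos y + A * (2 * cosh l)" using cos_ge_minus_one[of y] by linarith
qed

text \<open>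
  With \<open>v = e\<^sup>x\<close> the integral runs over \<open>(e\<^sup>-\<^sup>l, e\<^sup>l)\<close>, and the Moebius map
  \<open>v = (e\<^sup>-\<^sup>l + e\<^sup>\<xi>) / (1 + e\<^sup>-\<^sup>l e\<^sup>\<xi>)\<close> sends the whole line of \<open>\<xi>\<close> to it. The Jacobian, the truncated power and the
  kernel all acquire powers of the same factor \<open>p \<xi>\<close>, and these cancel because the exponents
  \<open>1\<close>, \<open>r - 1\<close> and \<open>-r\<close> add up to \<open>0\<close>.
\<close>
lemma integral_shifted_cosh_powr_extremal:
  assumes A: "2 \<le> A" and r: "0 < r" and y: "\<bar>y\<bar> < pi" and l: "0 < l"
  shows "integrable lborel (\<lambda>x. Re (shifted_cosh A (Complex x y) powr (- of_real r))
              * max 0 (2 * cosh l - 2 * cosh x) powr (r - 1))"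
    and "(\<integral>x. Re (shifted_cosh A (Complex x y) powr (- of_real r))
              * max 0 (2 * cosh l - 2 * cosh x) powr (r - 1) \<partial>lborel)
       = (2 * sinh l) powr (2 * r - 1)
         * (\<integral>x. (4 * cos y + A * (2 * cosh l)
                  + 2 * norm (shifted_cosh A (Complex l y)) * cosh x) powr (- r) \<partial>lborel)"
proof -
  define a where "a = exp (- l)"
  have a: "0 < a" "a < 1" using l by (auto simp: a_def)
  have expl: "exp l = 1 / a" by (simp add: a_def exp_minus field_simps)
  define S where "S = 2 * sinh l"
  have S: "0 < S" "S = 1 / a - a"
    using l by (simp add: S_def) (simp add: S_def sinh_def expl a_def[symmetric])
  define g where "g x = ln (a + exp x) - ln (1 + a * exp x)" for x
  define p where "p x = a * exp x / ((a + exp x) * (1 + a * exp x))" for x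
  have ppos: "0 < p x" for x unfolding p_def using a by (auto intro!: divide_pos_pos mult_pos_pos add_pos_pos)
  have nz: "a + exp x > 0" "1 + a * exp x > 0" for x
    using a by (auto intro!: add_pos_pos mult_pos_pos)
  have nz': "a + exp x \<noteq> 0" "1 + a * exp x \<noteq> 0" for x using nz[of x] by auto
  have expg: "exp (g x) = (a + exp x) / (1 + a * exp x)" for x
    unfolding g_def exp_diff using nz[of x] by simp
  have deriv: "(g has_real_derivative S * p x) (at x)" for x
  proof -
    have "(g has_real_derivative exp x / (a + exp x) - a * exp x / (1 + a * exp x)) (at x)"
      unfolding g_def using nz[of x] by (auto intro!: derivative_eq_intros)
    also have "exp x / (a + exp x) - a * exp x / (1 + a * exp x) = S * p x"
    proof -
      have "exp x / (a + exp x) - a * exp x / (1 + a * exp x)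
          = (exp x * (1 + a * exp x) - a * exp x * (a + exp x)) / ((a + exp x) * (1 + a * exp x))"
        using nz'[of x] by (rule diff_frac_eq)
      also have "exp x * (1 + a * exp x) - a * exp x * (a + exp x) = S * (a * exp x)"
        using a by (simp add: S(2) field_simps)
      finally show ?thesis by (simp add: p_def)
    qed
    finally show ?thesis .
  qed
  have contp: "continuous_on UNIV (\<lambda>x. S * p x)"
    unfolding p_def using nz' by (auto intro!: continuous_intros)
  have coshg: "2 * cosh l - 2 * cosh (g x) = S\<^sup>2 * p x" for x
  proof -
    have "2 * cosh (g x) = (a + exp x) / (1 + a * exp x) + (1 + a * exp x) / (a + exp x)"
    proof -
      have "2 * cosh (g x) = exp (g x) + inverse (exp (g x))" by (simp add: cosh_def exp_minus)
      then show ?thesis unfolding expg by simp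
    qed
    moreover have "2 * cosh l = 1 / a + a" by (simp add: cosh_def expl a_def[symmetric])
    moreover have "1 / a + a - ((a + E) / (1 + a * E) + (1 + a * E) / (a + E))
        = (1 / a - a)\<^sup>2 * (a * E / ((a + E) * (1 + a * E)))" if "a + E \<noteq> 0" "1 + a * E \<noteq> 0" for E
    proof -
      let ?D = "a + E" and ?D' = "1 + a * E"
      have "1 / a + a - (?D / ?D' + ?D' / ?D)
          = ((1 + a * a) * (?D * ?D') - (?D * ?D + ?D' * ?D') * a) / (a * (?D * ?D'))"
      proof -
        have "1 / a + a = (1 + a * a) / a" using a by (simp add: field_simps)
        moreover have "?D / ?D' + ?D' / ?D = (?D * ?D + ?D' * ?D') / (?D * ?D')"
          using that by (subst add_frac_eq) (simp_all add: mult_ac)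
        moreover have "(1 + a * a) / a - (?D * ?D + ?D' * ?D') / (?D * ?D')
            = ((1 + a * a) * (?D * ?D') - (?D * ?D + ?D' * ?D') * a) / (a * (?D * ?D'))"
          using that a by (intro diff_frac_eq) auto
        ultimately show ?thesis by simp
      qed
      also have "(1 + a * a) * (?D * ?D') - (?D * ?D + ?D' * ?D') * a = (1 - a * a)\<^sup>2 * E"
        by (simp add: power2_eq_square algebra_simps)
      also have "1 - a * a = (1 / a - a) * a" using a by (simp add: left_diff_distrib)
      also have "((1 / a - a) * a)\<^sup>2 * E / (a * (?D * ?D')) = (1 / a - a)\<^sup>2 * (a * E / (?D * ?D'))"
        using a by (simp add: power_mult_distrib power2_eq_square)
      finally show ?thesis .
    qed
    ultimately show ?thesis using nz'[of x] by (simp only: S(2) p_def)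
  qed
  have range: "range g = {-l<..<l}"
  proof (intro equalityI subsetI)
    fix x assume "x \<in> range g"
    then obtain t where x: "x = g t" by auto
    have "a + exp t < (1 + a * exp t) * exp l" "(1 + a * exp t) * a < a + exp t"
      using a by (auto simp: expl field_simps) (smt (verit) mult_less_cancel_right1 mult_strict_mono)+
    then have "exp x < exp l" "exp (- l) < exp x"
      unfolding x expg a_def[symmetric] using nz[of t] by (auto simp: field_simps)
    then show "x \<in> {-l<..<l}" by simp
  next
    fix x assume "x \<in> {-l<..<l}"
    then have x: "a < exp x" "a * exp x < 1"
      by (auto simp: a_def exp_add[symmetric])
    define t where "t = ln ((exp x - a) / (1 - a * exp x))"
    have et: "exp t = (exp x - a) / (1 - a * exp x)" unfolding t_def using x by simp
    have "exp (g t) = exp x"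
    proof -
      have n: "1 - a * exp x \<noteq> 0" "1 - a * a \<noteq> 0"
        using x a mult_strict_mono[of a 1 a 1] by auto
      have 1: "a + exp t = (1 - a * a) * exp x / (1 - a * exp x)"
        unfolding et using n by (simp add: field_simps)
      have 2: "1 + a * exp t = (1 - a * a) / (1 - a * exp x)"
        unfolding et using n by (simp add: field_simps)
      show ?thesis unfolding expg 1 2 using n by simp
    qed
    then show "x \<in> range g" by auto
  qed
  define z where "z = shifted_cosh A (Complex l y)"
  define Q where "Q = 4 * cos y + A * (2 * cosh l)"
  define m where "m = norm z"
  define v where "v = Arg z"
  have z: "z \<notin> \<real>\<^sub>\<le>\<^sub>0" unfolding z_def by (rule shifted_cosh_not_nonpos[OF A y])
  then have "z \<noteq> 0" by auto
  then have m: "0 < m" by (simp add: m_def)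
  have "v \<noteq> pi" using z by (auto simp: v_def Arg_eq_pi complex_nonpos_Reals_iff complex_is_Real_iff)
  then have v: "\<bar>v\<bar> < pi" unfolding v_def using mpi_less_Arg[of z] Arg_le_pi[of z] by auto
  have zv: "z = of_real m * exp (\<i> * of_real v)"
    unfolding m_def v_def using Arg_eq[OF \<open>z \<noteq> 0\<close>] .
  have Qm: "2 \<le> Q / m" using two_norm_shifted_cosh_le[OF A, of l y] m by (simp add: Q_def m_def z_def field_simps)
  \<comment> \<open>The phase of \<open>z\<close> becomes the height \<open>v\<close> of the horizontal line.\<close>
  have hypg: "shifted_cosh A (Complex (g x) y) = of_real (p x * m) * shifted_cosh (Q / m) (Complex x v)" for x
  proof -
    define t where "t = cis y"
    define E where "E = complex_of_real (exp x)"
    define b where "b = complex_of_real a"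
    have t: "t \<noteq> 0" "cnj t = inverse t" by (auto simp: t_def cis_cnj cis_inverse)
    have E: "E \<noteq> 0" "b \<noteq> 0" using a by (auto simp: E_def b_def)
    have nzc: "b + E \<noteq> 0" "1 + b * E \<noteq> 0"
    proof -
      have "b + E = of_real (a + exp x)" "1 + b * E = of_real (1 + a * exp x)"
        by (simp_all add: E_def b_def)
      then show "b + E \<noteq> 0" "1 + b * E \<noteq> 0"
        using nz'[of x] by (simp_all only: of_real_eq_0_iff not_False_eq_True)
    qed
    have expC: "exp (Complex u w) = of_real (exp u) * cis w" for u w
      by (simp add: exp_eq_polar)
    have expC': "exp (- Complex u w) = inverse (of_real (exp u) * cis w)" for u w
      by (simp add: exp_minus expC)
    have 1: "shifted_cosh A (Complex (g x) y) = of_real A + ((b + E) / (1 + b * E) * t + inverse ((b + E) / (1 + b * E) * t))"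
      unfolding shifted_cosh_def expC expC' expg by (simp add: E_def b_def t_def)
    have z1: "z = of_real A + (t / b + b / t)"
      unfolding z_def shifted_cosh_def expC expC' expl by (simp add: b_def t_def field_simps)
    have z2: "cnj z = of_real A + (1 / (b * t) + b * t)"
      unfolding z1 by (simp add: t b_def field_simps)
    have Q1: "complex_of_real Q = 2 * (t + 1 / t) + of_real A * (1 / b + b)"
    proof -
      have "complex_of_real (2 * cosh l) = 1 / b + b"
        by (simp add: cosh_def expl b_def a_def[symmetric])
      moreover have "complex_of_real (4 * cos y) = 2 * (t + 1 / t)"
      proof -
        have "1 / t = cis (- y)" unfolding t_def by (simp only: cis_inverse flip: inverse_eq_divide)
        then show ?thesis unfolding \<open>1 / t = cis (- y)\<close> by (simp add: t_def complex_eq_iff)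
      qed
      ultimately show ?thesis by (simp add: Q_def)
    qed
    have "of_real m * shifted_cosh (Q / m) (Complex x v) = of_real Q + (z * E + cnj z / E)"
    proof -
      have c: "exp (\<i> * of_real v) = cis v" by (simp add: cis_conv_exp)
      have "cnj z / E = of_real m * inverse (E * cis v)"
        unfolding zv c by (simp add: cis_cnj cis_inverse divide_inverse)
      moreover have "z * E = of_real m * (E * cis v)" unfolding zv c by simp
      ultimately show ?thesis
        unfolding shifted_cosh_def expC expC' using m by (simp add: E_def algebra_simps)
    qed
    then have "of_real (p x * m) * shifted_cosh (Q / m) (Complex x v)
       = b * E / ((b + E) * (1 + b * E)) * (of_real Q + (z * E + cnj z / E))"
      by (simp add: p_def E_def b_def)
    also have "\<dots> = shifted_cosh A (Complex (g x) y)"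
    proof -
      let ?D = "b + E" and ?D' = "1 + b * E"
      have "b * E * (of_real Q + (z * E + cnj z / E)) * t
          = E * t * (b * of_real Q) + E * E * (t * (b * z)) + t * (b * cnj z)"
        using E by (simp add: algebra_simps)
      also have "b * of_real Q = 2 * b * (t + 1 / t) + of_real A * (1 + b * b)"
        unfolding Q1 using E by (simp add: algebra_simps)
      also have "t * (b * z) = t * b * of_real A + (t * t + b * b)"
        unfolding z1 using E t by (simp add: algebra_simps)
      also have "t * (b * cnj z) = t * b * of_real A + (1 + b * b * (t * t))"
        unfolding z2 using E t by (simp add: algebra_simps)
      also have "E * t * (2 * b * (t + 1 / t) + of_real A * (1 + b * b)) =
          2 * E * b * (t * t + 1) + E * t * (of_real A * (1 + b * b))"
        using t by (simp add: algebra_simps)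
      also have "2 * E * b * (t * t + 1) + E * t * (of_real A * (1 + b * b))
          + E * E * (t * b * of_real A + (t * t + b * b))
          + (t * b * of_real A + (1 + b * b * (t * t)))
        = of_real A * t * (?D * ?D') + ?D * ?D * (t * t) + ?D' * ?D'"
        by (simp add: algebra_simps)
      finally have eq: "b * E * (of_real Q + (z * E + cnj z / E))
        = (of_real A * t * (?D * ?D') + ?D * ?D * (t * t) + ?D' * ?D') / t"
        using t by (simp add: eq_divide_eq)
      have "b * E / (?D * ?D') * (of_real Q + (z * E + cnj z / E))
        = (of_real A * t * (?D * ?D') + ?D * ?D * (t * t) + ?D' * ?D') / t / (?D * ?D')"
        unfolding eq[symmetric] by simp
      also have "\<dots> = of_real A + (?D / ?D' * t + inverse (?D / ?D' * t))"
      proof -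
        have "(X * t * (D * D') + D * D * (t * t) + D' * D') / t / (D * D')
            = X + (D / D' * t + inverse (D / D' * t))" if "D \<noteq> 0" "D' \<noteq> 0" for X D D' :: complex
          using that t(1) by (simp add: add_divide_distrib)
        then show ?thesis using nzc by blast
      qed
      finally show ?thesis unfolding 1 .
    qed
    finally show ?thesis by simp
  qed
  let ?k = "\<lambda>x. max 0 (2 * cosh l - 2 * cosh x) powr (r - 1)"
  let ?F = "\<lambda>x. Re (shifted_cosh A (Complex x y) powr (- of_real r)) * ?k x"
  have [measurable]: "g \<in> borel_measurable borel" "p \<in> borel_measurable borel"
    unfolding g_def p_def by measurable
  have [measurable]: "?k \<in> borel_measurable borel" by measurable
  have F_range: "?F x = indicator (range g) x *\<^sub>R ?F x" for x
    proof (cases "\<bar>x\<bar> < l")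
      case True then show ?thesis by (auto simp: range abs_less_iff)
    next
      case False
      then have "cosh l \<le> cosh \<bar>x\<bar>" using l cosh_real_nonneg_le_iff[of l "\<bar>x\<bar>"] by auto
      then show ?thesis by (simp add: max_def)
    qed
  have subst: "density lborel (\<lambda>x. ennreal (indicator (range g) x))
      = distr (density lborel (\<lambda>x. ennreal (S * p x))) borel g"
    by (subst distr_density_deriv_lborel[OF deriv contp])
       (use S ppos in \<open>auto simp: ennreal_indicator less_imp_le\<close>)
  \<comment> \<open>The powers of \<open>p x\<close> cancel here.\<close>
  have F_g: "(S * p x) *\<^sub>R ?F (g x) = S powr (2 * r - 1) * m powr (- r)
      * Re (shifted_cosh (Q / m) (Complex x v) powr (- of_real r))" for x
  proof -
    let ?R = "Re (shifted_cosh (Q / m) (Complex x v) powr (- of_real r))"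
    have p: "0 < p x" by (rule ppos)
    have "shifted_cosh A (Complex (g x) y) powr (- of_real r)
        = of_real ((p x * m) powr (- r)) * shifted_cosh (Q / m) (Complex x v) powr (- of_real r)"
      unfolding hypg using p m
      by (subst powr_times_real_left) (auto simp flip: powr_of_real)
    then have "Re (shifted_cosh A (Complex (g x) y) powr (- of_real r)) = (p x * m) powr (- r) * ?R" by simp
    moreover have "?k (g x) = (S\<^sup>2 * p x) powr (r - 1)"
      unfolding coshg using p by (simp add: max_def)
    ultimately have "(S * p x) *\<^sub>R ?F (g x)
        = (S * p x) * ((p x * m) powr (- r) * (S\<^sup>2 * p x) powr (r - 1)) * ?R" by simp
    also have "(p x * m) powr (- r) * (S\<^sup>2 * p x) powr (r - 1)
        = m powr (- r) * (S powr (2 * r - 2) * (p x powr (- r) * p x powr (r - 1)))"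
    proof -
      have "S\<^sup>2 = S powr 2" using S by simp
      then have "S\<^sup>2 powr (r - 1) = S powr (2 * r - 2)"
        by (simp only: powr_powr) (simp add: algebra_simps)
      then show ?thesis by (simp add: powr_mult)
    qed
    also have "p x powr (- r) * p x powr (r - 1) = inverse (p x)"
    proof -
      have "p x powr (- r) * p x powr (r - 1) = p x powr (- 1)" unfolding powr_add[symmetric] by simp
      then show ?thesis using p by (simp add: powr_minus)
    qed
    also have "S * p x * (m powr (- r) * (S powr (2 * r - 2) * inverse (p x)))
        = m powr (- r) * (S powr 1 * S powr (2 * r - 2))"
      using p S by simp
    also have "S powr 1 * S powr (2 * r - 2) = S powr (2 * r - 1)"
      unfolding powr_add[symmetric] by simp
    finally show ?thesis by simp
  qed
  have F_eq: "?F = (\<lambda>x. indicator (range g) x *\<^sub>R ?F x)" by (rule ext) (rule F_range)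
  have [measurable]: "range g \<in> sets borel" unfolding range by simp
  have "integrable lborel ?F \<longleftrightarrow> integrable lborel (\<lambda>x. indicator (range g) x *\<^sub>R ?F x)"
    using F_eq by (rule arg_cong)
  also have "\<dots> \<longleftrightarrow> integrable (density lborel (\<lambda>x. ennreal (indicator (range g) x))) ?F"
    by (rule integrable_density[symmetric]) auto
  also have "\<dots> \<longleftrightarrow> integrable (density lborel (\<lambda>x. ennreal (S * p x))) (\<lambda>x. ?F (g x))"
    unfolding subst by (rule integrable_distr_eq) auto
  also have "\<dots> \<longleftrightarrow> integrable lborel (\<lambda>x. (S * p x) *\<^sub>R ?F (g x))"
    by (rule integrable_density) (use S ppos in \<open>auto simp: less_imp_le\<close>)
  also have "\<dots>"
    unfolding F_g using integrable_shifted_cosh_powr[OF Qm r v] by (intro integrable_mult_right integrable_Re)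
  finally show "integrable lborel ?F" .
  have "(\<integral>x. ?F x \<partial>lborel) = (\<integral>x. indicator (range g) x *\<^sub>R ?F x \<partial>lborel)"
    using F_eq by (rule arg_cong)
  also have "\<dots> = (\<integral>x. ?F x \<partial>density lborel (\<lambda>x. ennreal (indicator (range g) x)))"
    by (rule integral_density[symmetric]) auto
  also have "\<dots> = (\<integral>x. ?F (g x) \<partial>density lborel (\<lambda>x. ennreal (S * p x)))"
    unfolding subst by (rule integral_distr) auto
  also have "\<dots> = (\<integral>x. (S * p x) *\<^sub>R ?F (g x) \<partial>lborel)"
    by (rule integral_density) (use S ppos in \<open>auto simp: less_imp_le\<close>)
  also have "\<dots> = S powr (2 * r - 1) * m powr (- r) * (\<integral>x. (Q / m + 2 * cosh x) powr (- r) \<partial>lborel)"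
    unfolding F_g using integral_shifted_cosh_powr_shift[OF Qm r v] integrable_shifted_cosh_powr[OF Qm r v]
    by (simp add: integral_Re)
  also have "\<dots> = S powr (2 * r - 1) * (\<integral>x. (Q + 2 * m * cosh x) powr (- r) \<partial>lborel)"
  proof -
    have "(Q + 2 * m * cosh x) powr (- r) = m powr (- r) * (Q / m + 2 * cosh x) powr (- r)" for x
      unfolding powr_mult[symmetric] using m by (simp add: distrib_left mult_ac)
    then show ?thesis by simp
  qed
  finally show "(\<integral>x. ?F x \<partial>lborel) = (2 * sinh l) powr (2 * r - 1)
         * (\<integral>x. (4 * cos y + A * (2 * cosh l)
                  + 2 * norm (shifted_cosh A (Complex l y)) * cosh x) powr (- r) \<partial>lborel)"
    by (simp add: S_def Q_def m_def z_def)
qed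

text \<open>
  Both coefficients of the transformed integrand decrease in the angle, the second one because
  its square has derivative \<open>2 A \<lambda> + 8 cos \<theta> \<ge> 0\<close> with respect to \<open>cos \<theta>\<close>.
\<close>
lemma integral_shifted_cosh_powr_extremal_mono:
  assumes A: "2 \<le> A" and r: "0 < r" and l: "0 < l"
    and u: "0 \<le> u" and uv: "u \<le> v" and v: "v < pi"
  shows "(\<integral>x. Re (shifted_cosh A (Complex x u) powr (- of_real r))
              * max 0 (2 * cosh l - 2 * cosh x) powr (r - 1) \<partial>lborel)
      \<le> (\<integral>x. Re (shifted_cosh A (Complex x v) powr (- of_real r))
              * max 0 (2 * cosh l - 2 * cosh x) powr (r - 1) \<partial>lborel)"
proof -
  define m where "m y = norm (shifted_cosh A (Complex l y))" for y
  define Q where "Q y = 4 * cos y + A * (2 * cosh l)" for y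
  have cos: "cos v \<le> cos u" using u uv v by (intro cos_monotone_0_pi_le) auto
  have L: "2 * 2 \<le> A * (2 * cosh l)" using A cosh_real_ge_1[of l] by (intro mult_mono) auto
  have Q: "Q v \<le> Q u" using cos by (simp add: Q_def)
  have "m v \<le> m u"
  proof (rule power2_le_imp_le)
    have "0 \<le> (cos u - cos v) * (2 * (A * (2 * cosh l)) + 4 * (cos u + cos v))"
    proof (rule mult_nonneg_nonneg)
      show "0 \<le> 2 * (A * (2 * cosh l)) + 4 * (cos u + cos v)"
        using L cos_ge_minus_one[of u] cos_ge_minus_one[of v] by argo
    qed (use cos in simp)
    also have "\<dots> = (m u)\<^sup>2 - (m v)\<^sup>2"
      unfolding m_def norm_shifted_cosh_sq by (simp add: power2_eq_square algebra_simps)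
    finally show "(m v)\<^sup>2 \<le> (m u)\<^sup>2" by simp
  qed (simp add: m_def)
  have mpos: "0 < m y" if "0 \<le> y" "y < pi" for y
    using shifted_cosh_not_nonpos[OF A, of y l] that by (auto simp: m_def)
  have int: "integrable lborel (\<lambda>x. (Q y + 2 * m y * cosh x) powr (- r))" if "0 \<le> y" "y < pi" for y
  proof -
    have "(Q y + 2 * m y * cosh x) powr (- r) = m y powr (- r) * (Q y / m y + 2 * cosh x) powr (- r)" for x
      unfolding powr_mult[symmetric] using mpos[OF that] by (simp add: distrib_left mult_ac)
    moreover have "0 \<le> Q y / m y"
      using two_norm_shifted_cosh_le[OF A, of l y] norm_ge_zero[of "shifted_cosh A (Complex l y)"]
      by (intro divide_nonneg_nonneg) (unfold Q_def m_def, linarith+)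
    ultimately show ?thesis using r by (simp add: integrable_shifted_cosh_powr_real)
  qed
  have "(\<integral>x. (Q u + 2 * m u * cosh x) powr (- r) \<partial>lborel)
      \<le> (\<integral>x. (Q v + 2 * m v * cosh x) powr (- r) \<partial>lborel)"
  proof (rule integral_mono)
    fix x
    have "0 < Q v + 2 * m v * cosh x"
      using two_norm_shifted_cosh_le[OF A, of l v] mpos[of v] u uv v cosh_real_pos[of x]
      by (intro add_nonneg_pos) (auto simp: Q_def m_def intro: order_trans[OF _ two_norm_shifted_cosh_le[OF A, of l v]])
    moreover have "Q v + 2 * m v * cosh x \<le> Q u + 2 * m u * cosh x"
      using Q \<open>m v \<le> m u\<close> cosh_real_pos[of x] by (intro add_mono mult_right_mono) auto
    ultimately show "(Q u + 2 * m u * cosh x) powr (- r) \<le> (Q v + 2 * m v * cosh x) powr (- r)"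
      using r by (intro powr_mono2') auto
  qed (use int u uv v in auto)
  then have "(2 * sinh l) powr (2 * r - 1) * (\<integral>x. (Q u + 2 * m u * cosh x) powr (- r) \<partial>lborel)
      \<le> (2 * sinh l) powr (2 * r - 1) * (\<integral>x. (Q v + 2 * m v * cosh x) powr (- r) \<partial>lborel)"
    by (rule mult_left_mono) simp
  then show ?thesis
    using integral_shifted_cosh_powr_extremal(2)[OF A r _ l, of u] integral_shifted_cosh_powr_extremal(2)[OF A r _ l, of v] u uv v
    by (simp add: Q_def m_def)
qed

section \<open>Mixtures\<close>

text \<open>
  The inequality \<open>\<integral> D H \<ge> 0\<close> passes from the components \<open>\<kappa> \<mu>\<close> to a mixture \<open>H\<close> by Fubini's theorem. The
  majorant \<open>W\<close> of \<open>|D|\<close> turns the integrability of \<open>W H\<close> into integrability on the product.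
\<close>
lemma integral_mixture_nonneg:
  fixes D W H :: "real \<Rightarrow> real" and \<kappa> :: "'b \<Rightarrow> real \<Rightarrow> real"
  assumes N: "sigma_finite_measure N"
    and [measurable]: "D \<in> borel_measurable borel" "W \<in> borel_measurable borel"
      "H \<in> borel_measurable borel" "(\<lambda>(\<mu>, x). \<kappa> \<mu> x) \<in> borel_measurable (N \<Otimes>\<^sub>M borel)"
    and DW: "\<And>x. \<bar>D x\<bar> \<le> W x" and nonneg: "\<And>\<mu> x. 0 \<le> \<kappa> \<mu> x" "\<And>x. 0 \<le> H x"
    and H: "AE x in lborel. ennreal (H x) = (\<integral>\<^sup>+\<mu>. ennreal (\<kappa> \<mu> x) \<partial>N)"
    and fin: "integrable lborel (\<lambda>x. W x * H x)"
    and pos: "\<And>\<mu>. \<mu> \<in> space N \<Longrightarrow> 0 \<le> (\<integral>x. D x * \<kappa> \<mu> x \<partial>lborel)"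
  shows "0 \<le> (\<integral>x. D x * H x \<partial>lborel)"
proof -
  interpret N: sigma_finite_measure N by fact
  interpret P: pair_sigma_finite N "lborel :: real measure" by standard
  have [measurable]: "(\<lambda>(\<mu>, x). \<kappa> \<mu> x) \<in> borel_measurable (N \<Otimes>\<^sub>M lborel)"
    using assms(5) by (simp cong: measurable_cong_sets sets_pair_measure_cong)
  have kx[measurable]: "(\<lambda>\<mu>. \<kappa> \<mu> x) \<in> borel_measurable N" for x by measurable
  have "integrable (N \<Otimes>\<^sub>M lborel) (\<lambda>(\<mu>, x). D x * \<kappa> \<mu> x)"
  proof (rule integrableI_bounded)
    have "(\<integral>\<^sup>+z. ennreal (norm (case z of (\<mu>, x) \<Rightarrow> D x * \<kappa> \<mu> x)) \<partial>(N \<Otimes>\<^sub>M lborel))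
        = (\<integral>\<^sup>+x. \<integral>\<^sup>+\<mu>. ennreal (norm (D x * \<kappa> \<mu> x)) \<partial>N \<partial>lborel)"
      by (subst P.nn_integral_snd[symmetric]) simp_all
    also have "\<dots> \<le> (\<integral>\<^sup>+x. ennreal (W x * H x) \<partial>lborel)"
    proof (rule nn_integral_mono_AE)
      show "AE x in lborel. (\<integral>\<^sup>+\<mu>. ennreal (norm (D x * \<kappa> \<mu> x)) \<partial>N) \<le> ennreal (W x * H x)"
        using H
      proof eventually_elim
        case (elim x)
        have "(\<integral>\<^sup>+\<mu>. ennreal (norm (D x * \<kappa> \<mu> x)) \<partial>N) \<le> (\<integral>\<^sup>+\<mu>. ennreal (W x) * ennreal (\<kappa> \<mu> x) \<partial>N)"
          using DW[of x] nonneg(1)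
          by (intro nn_integral_mono)
             (auto simp: abs_mult intro!: mult_right_mono simp flip: ennreal_mult'')
        also have "\<dots> = ennreal (W x) * ennreal (H x)"
          by (subst nn_integral_cmult) (auto simp: elim)
        also have "\<dots> = ennreal (W x * H x)" using nonneg(2) by (simp add: ennreal_mult'')
        finally show ?case .
      qed
    qed
    also have "\<dots> < \<infinity>"
    proof -
      have "0 \<le> W x" for x using DW[of x] by linarith
      then have "(\<integral>\<^sup>+x. ennreal (W x * H x) \<partial>lborel) = (\<integral>\<^sup>+x. ennreal (norm (W x * H x)) \<partial>lborel)"
        using nonneg(2) by (simp add: abs_mult)
      then show ?thesis using fin by (simp add: integrable_iff_bounded)
    qed
    finally show "(\<integral>\<^sup>+z. ennreal (norm (case z of (\<mu>, x) \<Rightarrow> D x * \<kappa> \<mu> x)) \<partial>(N \<Otimes>\<^sub>M lborel)) < \<infinity>" .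
  qed simp
  then have "(\<integral>\<mu>. (\<integral>x. D x * \<kappa> \<mu> x \<partial>lborel) \<partial>N) = (\<integral>x. (\<integral>\<mu>. D x * \<kappa> \<mu> x \<partial>N) \<partial>lborel)"
    by (rule P.Fubini_integral[symmetric])
  also have "\<dots> = (\<integral>x. D x * H x \<partial>lborel)"
  proof (rule integral_cong_AE)
    show "AE x in lborel. (\<integral>\<mu>. D x * \<kappa> \<mu> x \<partial>N) = D x * H x"
      using H
    proof eventually_elim
      case (elim x)
      have "(\<integral>\<mu>. \<kappa> \<mu> x \<partial>N) = enn2real (\<integral>\<^sup>+\<mu>. ennreal (\<kappa> \<mu> x) \<partial>N)"
        using nonneg by (intro integral_eq_nn_integral) auto
      also have "\<dots> = H x" using nonneg by (simp flip: elim)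
      finally show ?case by simp
    qed
  qed measurable
  finally show ?thesis
    using Bochner_Integration.integral_nonneg[of N "\<lambda>\<mu>. \<integral>x. D x * \<kappa> \<mu> x \<partial>lborel"] pos
    by simp
qed

text \<open>
  This is the source of the condition \<open>r \<le> k\<close>: a truncated power of higher order is a mixture of
  truncated powers of lower order.
\<close>
lemma nn_integral_Beta_convolution:
  fixes a b w :: real
  assumes a: "0 < a" and b: "0 < b"
  shows "(\<integral>\<^sup>+\<mu>. ennreal (max 0 (c - \<mu>) powr (b - 1) * max 0 (\<mu> - w) powr (a - 1)) \<partial>lborel)
       = ennreal (Beta a b * max 0 (c - w) powr (a + b - 1))"
proof (cases "w < c")
  case False
  then have "max 0 (c - \<mu>) = 0 \<or> max 0 (\<mu> - w) = 0" for \<mu>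
    by (auto simp: max_def)
  then have *: "max 0 (c - \<mu>) powr (b - 1) * max 0 (\<mu> - w) powr (a - 1) = 0" for \<mu>
    by (metis mult_eq_0_iff powr_eq_0_iff)
  have "max 0 (c - w) = 0" using False by simp
  then show ?thesis unfolding * by simp
next
  case True
  define d where "d = c - w"
  have d: "0 < d" using True by (simp add: d_def)
  have unit: "(\<integral>\<^sup>+t. ennreal (max 0 (1 - t) powr (b - 1) * max 0 t powr (a - 1)) \<partial>lborel)
      = ennreal (Beta a b)"
  proof (rule nn_integral_has_integral_lborel)
    have "((\<lambda>t. if t \<in> {0..1} then t powr (a - 1) * (1 - t) powr (b - 1) else 0)
        has_integral Beta a b) UNIV"
      using has_integral_Beta_real[OF a b] by (subst has_integral_restrict_UNIV)
    also have "(\<lambda>t. if t \<in> {0..1} then t powr (a - 1) * (1 - t) powr (b - 1) else 0)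
        = (\<lambda>t. max 0 (1 - t) powr (b - 1) * max 0 t powr (a - 1))"
      by (auto simp: max_def fun_eq_iff)
    finally show "((\<lambda>t. max 0 (1 - t) powr (b - 1) * max 0 t powr (a - 1)) has_integral Beta a b) UNIV" .
  qed auto
  have "(\<integral>\<^sup>+\<mu>. ennreal (max 0 (c - \<mu>) powr (b - 1) * max 0 (\<mu> - w) powr (a - 1)) \<partial>lborel)
      = ennreal d * (\<integral>\<^sup>+t. ennreal (max 0 (c - (w + d * t)) powr (b - 1)
           * max 0 ((w + d * t) - w) powr (a - 1)) \<partial>lborel)"
    using d by (subst nn_integral_real_affine[of _ d w]) auto
  also have "\<dots> = ennreal d * (\<integral>\<^sup>+t. ennreal (d powr (a + b - 2))
       * ennreal (max 0 (1 - t) powr (b - 1) * max 0 t powr (a - 1)) \<partial>lborel)"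
  proof -
    have m1: "max 0 (c - (w + d * t)) = d * max 0 (1 - t)" for t
    proof -
      have "c - (w + d * t) = d * (1 - t)" by (simp add: d_def algebra_simps)
      then show ?thesis using d by (auto simp: max_def mult_le_0_iff zero_le_mult_iff)
    qed
    have m2: "max 0 ((w + d * t) - w) = d * max 0 t" for t
      using d by (auto simp: max_def mult_le_0_iff zero_le_mult_iff)
    have pw: "d powr (b - 1) * d powr (a - 1) = d powr (a + b - 2)"
      unfolding powr_add[symmetric] by (simp add: algebra_simps)
    have "max 0 (c - (w + d * t)) powr (b - 1) * max 0 ((w + d * t) - w) powr (a - 1)
        = d powr (a + b - 2) * (max 0 (1 - t) powr (b - 1) * max 0 t powr (a - 1))" for t
      unfolding m1 m2 powr_mult pw[symmetric] by (simp only: mult_ac)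
    then show ?thesis by (simp add: ennreal_mult')
  qed
  also have "\<dots> = ennreal d * (ennreal (d powr (a + b - 2)) * ennreal (Beta a b))"
    by (subst nn_integral_cmult) (auto simp: unit)
  also have "\<dots> = ennreal (d powr 1 * d powr (a + b - 2) * Beta a b)"
    using d a b by (simp add: ennreal_mult' mult.assoc)
  also have "d powr 1 * d powr (a + b - 2) = d powr (a + b - 1)"
    unfolding powr_add[symmetric] by simp
  finally show ?thesis using True by (simp add: d_def mult.commute max_def)
qed

text \<open>
  Two angles \<open>u \<le> v\<close> are fixed, and monotonicity in the angle of the integral against
  \<open>h(2 cosh x)\<close> is expressed as \<open>\<integral> D(x) h(2 cosh x) dx \<ge> 0\<close>, which is linear in \<open>h\<close>.
\<close>
locale angle_increment =
  fixes A r u v :: real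
  assumes A: "2 \<le> A" and r: "0 < r" and u: "0 \<le> u" and uv: "u \<le> v" and v: "v < pi"
begin

definition D :: "real \<Rightarrow> real" where
  "D x = Re (shifted_cosh A (Complex x v) powr (- of_real r)) - Re (shifted_cosh A (Complex x u) powr (- of_real r))"

definition W :: "real \<Rightarrow> real" where
  "W x = norm (shifted_cosh A (Complex x v) powr (- of_real r)) + norm (shifted_cosh A (Complex x u) powr (- of_real r))"

lemma measurable_D [measurable]: "D \<in> borel_measurable borel"
  and measurable_W [measurable]: "W \<in> borel_measurable borel"
  unfolding D_def W_def by measurable

lemma abs_D_le: "\<bar>D x\<bar> \<le> W x"
  using abs_Re_le_cmod[of "shifted_cosh A (Complex x v) powr (- of_real r)"]
    abs_Re_le_cmod[of "shifted_cosh A (Complex x u) powr (- of_real r)"]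
  unfolding D_def W_def by linarith

lemma W_nonneg: "0 \<le> W x" by (simp add: W_def)

lemma integrable_W: "integrable lborel W"
  unfolding W_def using A r u uv v
  by (intro Bochner_Integration.integrable_add integrable_norm integrable_shifted_cosh_powr) auto

lemma integrable_W_bounded:
  assumes [measurable]: "H \<in> borel_measurable borel" and "\<And>x. \<bar>H x\<bar> \<le> B"
  shows "integrable lborel (\<lambda>x. W x * H x)"
proof (rule Bochner_Integration.integrable_bound)
  show "integrable lborel (\<lambda>x. W x * B)" by (intro integrable_mult_left integrable_W)
  show "AE x in lborel. norm (W x * H x) \<le> norm (W x * B)"
    using order_trans[OF assms(2) abs_ge_self] W_nonneg
    by (auto simp: abs_mult intro!: mult_left_mono)
qed simp

text \<open>
  By the contour shift. This disposes of the constant in the representation of \<open>h\<close>.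
\<close>
lemma integral_D: "(\<integral>x. D x \<partial>lborel) = 0"
  unfolding D_def using A r u uv v
  by (subst Bochner_Integration.integral_diff)
     (auto simp: integrable_shifted_cosh_powr integral_Re integral_shifted_cosh_powr_shift)

lemma integral_D_truncated_power_same:
  "0 \<le> (\<integral>x. D x * max 0 (c - 2 * cosh x) powr (r - 1) \<partial>lborel)"
proof (cases "2 < c")
  case False
  then have "max 0 (c - 2 * cosh x) = 0" for x
    using cosh_real_ge_1[of x] by (auto simp: max_def)
  then show ?thesis by simp
next
  case True
  define l where "l = arcosh (c / 2)"
  have l: "0 < l" "c = 2 * cosh l" using True by (auto simp: l_def cosh_arcosh_real)
  have "(\<integral>x. D x * max 0 (c - 2 * cosh x) powr (r - 1) \<partial>lborel)
      = (\<integral>x. Re (shifted_cosh A (Complex x v) powr (- of_real r))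
              * max 0 (2 * cosh l - 2 * cosh x) powr (r - 1) \<partial>lborel)
        - (\<integral>x. Re (shifted_cosh A (Complex x u) powr (- of_real r))
              * max 0 (2 * cosh l - 2 * cosh x) powr (r - 1) \<partial>lborel)"
    unfolding D_def left_diff_distrib l(2) using A r l u uv v
    by (intro Bochner_Integration.integral_diff integral_shifted_cosh_powr_extremal) auto
  then show ?thesis
    using integral_shifted_cosh_powr_extremal_mono[OF A r l(1) u uv v] by simp
qed

lemma integral_D_truncated_power:
  assumes b: "1 \<le> b" "r \<le> b"
  shows "0 \<le> (\<integral>x. D x * max 0 (c - 2 * cosh x) powr (b - 1) \<partial>lborel)"
proof (cases "b = r")
  case True then show ?thesis using integral_D_truncated_power_same by simp
next
  case False
  define \<kappa> where "\<kappa> \<mu> x = max 0 (c - \<mu>) powr (b - r - 1)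
     * max 0 (\<mu> - 2 * cosh x) powr (r - 1) / Beta r (b - r)" for \<mu> x :: real
  have br: "0 < b - r" using False b by simp
  have Beta: "0 < Beta r (b - r)" using r br by (simp add: Beta_def Gamma_real_pos)
  show ?thesis
  proof (rule integral_mixture_nonneg[where N=lborel and \<kappa>=\<kappa> and W=W])
    show "(\<lambda>(\<mu>, x). \<kappa> \<mu> x) \<in> borel_measurable (lborel \<Otimes>\<^sub>M borel)"
      unfolding \<kappa>_def by measurable
    show "AE x in lborel. ennreal (max 0 (c - 2 * cosh x) powr (b - 1)) = (\<integral>\<^sup>+\<mu>. ennreal (\<kappa> \<mu> x) \<partial>lborel)"
    proof (rule AE_I2)
      fix x :: real
      have "(\<integral>\<^sup>+\<mu>. ennreal (\<kappa> \<mu> x) \<partial>lborel) = (\<integral>\<^sup>+\<mu>. ennreal (1 / Beta r (b - r)) *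
          ennreal (max 0 (c - \<mu>) powr (b - r - 1) * max 0 (\<mu> - 2 * cosh x) powr (r - 1)) \<partial>lborel)"
        using Beta by (intro nn_integral_cong) (simp add: \<kappa>_def flip: ennreal_mult')
      also have "\<dots> = ennreal (1 / Beta r (b - r)) * ennreal (Beta r (b - r) * max 0 (c - 2 * cosh x) powr (b - 1))"
        using nn_integral_Beta_convolution[OF r br, of c "2 * cosh x"]
        by (subst nn_integral_cmult) (auto simp: algebra_simps)
      also have "\<dots> = ennreal (max 0 (c - 2 * cosh x) powr (b - 1))"
        using Beta by (simp flip: ennreal_mult')
      finally show "ennreal (max 0 (c - 2 * cosh x) powr (b - 1)) = (\<integral>\<^sup>+\<mu>. ennreal (\<kappa> \<mu> x) \<partial>lborel)" by simp
    qed
    show "integrable lborel (\<lambda>x. W x * max 0 (c - 2 * cosh x) powr (b - 1))"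
    proof (rule integrable_W_bounded)
      show "(\<lambda>x. max 0 (c - 2 * cosh x) powr (b - 1)) \<in> borel_measurable borel"
        by measurable
      fix x :: real
      have "max 0 (c - 2 * cosh x) \<le> max 0 c" using cosh_real_pos[of x] by linarith
      then show "\<bar>max 0 (c - 2 * cosh x) powr (b - 1)\<bar> \<le> max 0 c powr (b - 1)"
        using b by (auto intro!: powr_mono2)
    qed
    show "0 \<le> (\<integral>x. D x * \<kappa> \<mu> x \<partial>lborel)" for \<mu>
    proof -
      have "(\<integral>x. D x * \<kappa> \<mu> x \<partial>lborel) = (\<integral>x. max 0 (c - \<mu>) powr (b - r - 1) / Beta r (b - r) *
         (D x * max 0 (\<mu> - 2 * cosh x) powr (r - 1)) \<partial>lborel)"
        by (simp add: \<kappa>_def mult_ac)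
      also have "\<dots> = max 0 (c - \<mu>) powr (b - r - 1) / Beta r (b - r) *
         (\<integral>x. D x * max 0 (\<mu> - 2 * cosh x) powr (r - 1) \<partial>lborel)"
        by simp
      also have "\<dots> \<ge> 0" using Beta integral_D_truncated_power_same[of \<mu>]
        by (intro mult_nonneg_nonneg) auto
      finally show ?thesis .
    qed
    show "(\<lambda>x. max 0 (c - 2 * cosh x) powr (b - 1)) \<in> borel_measurable borel"
      by measurable
  qed (use Beta in \<open>auto simp: \<kappa>_def abs_D_le lborel.sigma_finite_measure_axioms\<close>)
qed

end

context angle_increment begin

text \<open>
  For order \<open>1\<close> the layer cake formula replaces the integral representation: a superlevel set of a
  non-increasing function is an initial interval of \<open>[2, \<infinity>)\<close>, whose indicator is a truncated
  power with exponent \<open>0\<close> up to one end point, or all of \<open>[2, \<infinity>)\<close>.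
\<close>
lemma integral_D_antimono:
  assumes r1: "r \<le> 1" and h: "antimono_on {2..} h" "\<And>w. 2 \<le> w \<Longrightarrow> 0 \<le> h w"
    and [measurable]: "(\<lambda>x. h (2 * cosh x)) \<in> borel_measurable borel"
  shows "0 \<le> (\<integral>x. D x * h (2 * cosh x) \<partial>lborel)"
proof -
  have ge2: "2 \<le> 2 * cosh x" for x :: real using cosh_real_ge_1[of x] by simp
  have anti: "h w' \<le> h w" if "2 \<le> w" "w \<le> w'" for w w'
    using h(1) that by (auto simp: monotone_on_def)
  define \<kappa> where "\<kappa> y x = (if 0 < y \<and> y < h (2 * cosh x) then 1 else 0 :: real)" for y x
  show ?thesis
  proof (rule integral_mixture_nonneg[where N=lborel and \<kappa>=\<kappa> and W=W])
    show "(\<lambda>(y, x). \<kappa> y x) \<in> borel_measurable (lborel \<Otimes>\<^sub>M borel)"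
      unfolding \<kappa>_def by measurable
    show "AE x in lborel. ennreal (h (2 * cosh x)) = (\<integral>\<^sup>+y. ennreal (\<kappa> y x) \<partial>lborel)"
    proof (rule AE_I2)
      fix x :: real
      have "(\<integral>\<^sup>+y. ennreal (\<kappa> y x) \<partial>lborel) = (\<integral>\<^sup>+y. indicator {0<..<h (2 * cosh x)} y \<partial>lborel)"
        by (intro nn_integral_cong) (auto simp: \<kappa>_def)
      then show "ennreal (h (2 * cosh x)) = (\<integral>\<^sup>+y. ennreal (\<kappa> y x) \<partial>lborel)"
        using h(2)[OF ge2[of x]] by simp
    qed
    show "integrable lborel (\<lambda>x. W x * h (2 * cosh x))"
      using anti[OF _ ge2] h(2)[OF ge2] by (intro integrable_W_bounded[where B="h 2"]) auto
    show "0 \<le> (\<integral>x. D x * \<kappa> y x \<partial>lborel)" for y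
    proof -
      define S where "S = {w. 2 \<le> w \<and> y < h w}"
      show ?thesis
      proof (cases "0 < y \<and> S \<noteq> {}")
        case False
        then have "\<kappa> y x = 0" for x using ge2[of x] by (auto simp: \<kappa>_def S_def)
        then show ?thesis by simp
      next
        case True
        show ?thesis
        proof (cases "bdd_above S")
          case False
          have "\<kappa> y x = 1" for x
          proof -
            obtain w where "w \<in> S" "2 * cosh x \<le> w"
              using False unfolding bdd_above_def by (meson linear)
            then show ?thesis using True anti[OF ge2, of x w] by (simp add: \<kappa>_def S_def)
          qed
          then show ?thesis by (simp add: integral_D)
        next
          case bdd: True
          define c where "c = Sup S"
          have eq: "\<kappa> y x = max 0 (c - 2 * cosh x) powr (1 - 1)" if "2 * cosh x \<noteq> c" for x
          proof (cases "2 * cosh x < c")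
            case lt: True
            then obtain w where "w \<in> S" "2 * cosh x < w"
              using True bdd by (auto simp: c_def less_cSup_iff)
            then show ?thesis using True lt anti[OF ge2, of x w] by (simp add: \<kappa>_def S_def)
          next
            case False
            then have "2 * cosh x \<notin> S" using that cSup_upper[OF _ bdd, of "2 * cosh x"] by (auto simp: c_def)
            then show ?thesis using False ge2[of x] by (auto simp: \<kappa>_def S_def)
          qed
          have "AE x in lborel. x \<noteq> arcosh (c / 2)" "AE x in lborel. x \<noteq> - arcosh (c / 2)"
            by (rule AE_lborel_singleton)+
          then have "AE x in lborel. D x * \<kappa> y x = D x * max 0 (c - 2 * cosh x) powr (1 - 1)"
          proof eventually_elim
            case (elim x)
            have "2 * cosh x \<noteq> c"
            proof
              assume "2 * cosh x = c"
              then have "\<bar>x\<bar> = arcosh (c / 2)"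
                using arcosh_cosh_real[of "\<bar>x\<bar>"] by auto
              then show False using elim by (auto simp: abs_if split: if_splits)
            qed
            then show ?case using eq by simp
          qed
          moreover have [measurable]: "\<kappa> y \<in> borel_measurable borel"
            unfolding \<kappa>_def by measurable
          ultimately have "(\<integral>x. D x * \<kappa> y x \<partial>lborel) = (\<integral>x. D x * max 0 (c - 2 * cosh x) powr (1 - 1) \<partial>lborel)"
            by (intro integral_cong_AE) auto
          then show ?thesis using integral_D_truncated_power[of 1 c] r1 by simp
        qed
      qed
    qed
    show "sigma_finite_measure (lborel :: real measure)" by (rule lborel.sigma_finite_measure_axioms)
    show "\<bar>D x\<bar> \<le> W x" "0 \<le> \<kappa> y x" "0 \<le> h (2 * cosh x)" for x y
      using h(2)[OF ge2[of x]] abs_D_le by (simp_all add: \<kappa>_def)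
  qed measurable
qed

text \<open>
  Fubini's theorem requires a \<open>\<sigma>\<close>-finite mixing measure. On \<open>(2, \<infinity>)\<close> finiteness of \<open>h(2)\<close> makes
  the representing measure \<open>\<sigma>\<close>-finite, by Markov's inequality; it is restricted to this set.
\<close>
lemma integral_D_power_mixture:
  fixes H :: "real measure"
  assumes k: "2 \<le> k" "r \<le> real k" and C: "0 \<le> C" and H: "sets H = sets borel"
    and rep: "\<And>w. 2 \<le> w \<Longrightarrow> ennreal (h w) = ennreal C + (\<integral>\<^sup>+l\<in>{w<..}. ennreal ((l - w) ^ (k - 1)) \<partial>H)"
    and nonneg: "\<And>w. 2 \<le> w \<Longrightarrow> 0 \<le> h w"
    and [measurable]: "(\<lambda>x. h (2 * cosh x)) \<in> borel_measurable borel"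
  shows "0 \<le> (\<integral>x. D x * h (2 * cosh x) \<partial>lborel)"
proof -
  note [measurable_cong] = H
  have ge2: "2 \<le> 2 * cosh x" for x :: real using cosh_real_ge_1[of x] by simp
  let ?I = "\<lambda>w. \<integral>\<^sup>+l\<in>{w<..}. ennreal ((l - w) ^ (k - 1)) \<partial>H"
  have hC: "C \<le> h w" and I: "?I w = ennreal (h w - C)" if "2 \<le> w" for w
  proof -
    have "ennreal C \<le> ennreal (h w)" unfolding rep[OF that] by simp
    then show "C \<le> h w" using nonneg[OF that] by (simp add: ennreal_le_iff)
    have "ennreal C + ?I w = ennreal C + ennreal (h w - C)"
      using rep[OF that] C \<open>C \<le> h w\<close> by (simp flip: ennreal_plus)
    then show "?I w = ennreal (h w - C)" by (simp add: ennreal_add_left_cancel)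
  qed
  define N where "N = density H (indicator {2<..})"
  have [measurable_cong]: "sets N = sets borel" by (simp add: N_def H)
  have N: "sigma_finite_measure N"
  proof
    \<comment> \<open>The null set \<open>{..2}\<close> is added to each set of the exhaustion so that they cover the line.\<close>
    let ?A = "range (\<lambda>n. {..2} \<union> {2 + 1 / real (Suc n)<..})"
    have "emeasure N ({..2} \<union> {2 + 1 / real (Suc n)<..}) \<noteq> \<infinity>" for n
    proof -
      have "emeasure N ({..2} \<union> {2 + 1 / real (Suc n)<..})
          = (\<integral>\<^sup>+l. indicator {2<..} l * indicator ({..2} \<union> {2 + 1 / real (Suc n)<..}) l \<partial>H)"
        unfolding N_def by (rule emeasure_density) (auto simp: H)
      also have "\<dots> \<le> (\<integral>\<^sup>+l. ennreal (real (Suc n) ^ (k - 1)) *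
          (ennreal ((l - 2) ^ (k - 1)) * indicator {2<..} l) \<partial>H)"
      proof (rule nn_integral_mono)
        fix l :: real
        show "indicator {2<..} l * indicator ({..2} \<union> {2 + 1 / real (Suc n)<..}) l
          \<le> ennreal (real (Suc n) ^ (k - 1)) * (ennreal ((l - 2) ^ (k - 1)) * indicator {2<..} l)"
        proof (cases "2 + 1 / real (Suc n) < l")
          case True
          have "1 \<le> real (Suc n) * (l - 2)"
            using True by (simp add: field_simps del: of_nat_Suc)
          then have "1 \<le> (real (Suc n) * (l - 2)) ^ (k - 1)" by (rule one_le_power)
          then have "ennreal 1 \<le> ennreal ((real (Suc n) * (l - 2)) ^ (k - 1))" by (rule ennreal_leI)
          also have "\<dots> = ennreal (real (Suc n) ^ (k - 1)) * ennreal ((l - 2) ^ (k - 1))"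
            unfolding power_mult_distrib by (rule ennreal_mult') simp
          finally have "1 \<le> ennreal (real (Suc n) ^ (k - 1)) * ennreal ((l - 2) ^ (k - 1))" by simp
          moreover have "0 < 1 / real (Suc n)" by simp
          then have "2 < l" using True by linarith
          ultimately show ?thesis using True by (simp del: of_nat_Suc)
        qed (auto split: split_indicator simp del: of_nat_Suc)
      qed
      also have "\<dots> = ennreal (real (Suc n) ^ (k - 1)) * ?I 2"
        by (rule nn_integral_cmult) auto
      also have "\<dots> < \<infinity>" unfolding I[OF order_refl] by (simp add: ennreal_mult_less_top)
      finally show ?thesis by simp
    qed
    moreover have "\<Union>?A = space N"
    proof -
      have "x \<in> \<Union>?A" for x
      proof (cases "2 < x")
        case True
        then obtain n where "1 / real (Suc n) < x - 2" using nat_approx_posE[of "x - 2"] by auto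
        then show ?thesis by (intro UnionI[OF rangeI[of _ n]]) auto
      qed auto
      then show ?thesis using sets_eq_imp_space_eq[OF \<open>sets N = sets borel\<close>] by auto
    qed
    ultimately show "\<exists>A. countable A \<and> A \<subseteq> sets N \<and> \<Union>A = space N \<and> (\<forall>a\<in>A. emeasure N a \<noteq> \<infinity>)"
      by (intro exI[of _ ?A]) (auto simp: \<open>sets N = sets borel\<close>)
  qed
  define \<kappa> where "\<kappa> l x = max 0 (l - 2 * cosh x) powr (real k - 1)" for l x :: real
  have kpow: "max 0 t powr (real k - 1) = (if 0 < t then t ^ (k - 1) else 0)" for t :: real
    using k powr_realpow[of t "k - 1"] by (auto simp: max_def of_nat_diff)
  have le: "h (2 * cosh x) \<le> h 2" for x
  proof -
    have "?I (2 * cosh x) \<le> ?I 2"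
      using ge2[of x] by (intro nn_integral_mono) (auto split: split_indicator intro!: power_mono)
    then have "h (2 * cosh x) - C \<le> h 2 - C"
      unfolding I[OF ge2] I[OF order_refl] using hC[OF order_refl] by (simp add: ennreal_le_iff)
    then show ?thesis by simp
  qed
  have int: "integrable lborel (\<lambda>x. W x * (h (2 * cosh x) - C))"
    using le hC[OF ge2] C by (intro integrable_W_bounded[where B="h 2"]) (auto simp: abs_le_iff add_increasing2 diff_le_eq)
  have "0 \<le> (\<integral>x. D x * (h (2 * cosh x) - C) \<partial>lborel)"
  proof (rule integral_mixture_nonneg[where N=N and \<kappa>=\<kappa> and W=W])
    show "(\<lambda>(l, x). \<kappa> l x) \<in> borel_measurable (N \<Otimes>\<^sub>M borel)"
      unfolding \<kappa>_def by measurable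
    show "AE x in lborel. ennreal (h (2 * cosh x) - C) = (\<integral>\<^sup>+l. ennreal (\<kappa> l x) \<partial>N)"
    proof (rule AE_I2)
      fix x :: real
      have "(\<integral>\<^sup>+l. ennreal (\<kappa> l x) \<partial>N) = (\<integral>\<^sup>+l. indicator {2<..} l * ennreal (\<kappa> l x) \<partial>H)"
        unfolding N_def by (rule nn_integral_density) (auto simp: \<kappa>_def)
      also have "\<dots> = ?I (2 * cosh x)"
        using ge2[of x] by (intro nn_integral_cong) (auto simp: \<kappa>_def kpow split: split_indicator)
      finally show "ennreal (h (2 * cosh x) - C) = (\<integral>\<^sup>+l. ennreal (\<kappa> l x) \<partial>N)"
        using I[OF ge2] by simp
    qed
    show "0 \<le> (\<integral>x. D x * \<kappa> l x \<partial>lborel)" for l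
      unfolding \<kappa>_def using k by (intro integral_D_truncated_power) auto
    show "\<bar>D x\<bar> \<le> W x" "0 \<le> \<kappa> l x" "0 \<le> h (2 * cosh x) - C" for x l
      using hC[OF ge2[of x]] abs_D_le by (simp_all add: \<kappa>_def)
  qed (use N int in measurable)
  also have "\<dots> = (\<integral>x. D x * h (2 * cosh x) \<partial>lborel)"
  proof -
    have 1: "integrable lborel (\<lambda>x. D x * h (2 * cosh x))"
    proof (rule Bochner_Integration.integrable_bound)
      show "integrable lborel (\<lambda>x. W x * h 2)" by (intro integrable_mult_left integrable_W)
      show "AE x in lborel. norm (D x * h (2 * cosh x)) \<le> norm (W x * h 2)"
        using abs_D_le le nonneg[OF ge2] nonneg[OF order_refl] W_nonneg
        by (auto simp: abs_mult intro!: mult_mono)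
    qed simp
    have 2: "integrable lborel D"
      by (rule Bochner_Integration.integrable_bound[OF integrable_W]) (use abs_D_le W_nonneg in auto)
    show ?thesis
      using 1 2 integral_D by (simp add: right_diff_distrib)
  qed
  finally show ?thesis .
qed

lemma integral_D_decreasing_of_order:
  assumes "decreasing_of_order k h" "r \<le> real k"
    and "(\<lambda>x. h (2 * cosh x)) \<in> borel_measurable borel"
  shows "0 \<le> (\<integral>x. D x * h (2 * cosh x) \<partial>lborel)"
proof (cases "k = 1")
  case True
  then show ?thesis
    using assms by (intro integral_D_antimono) (auto simp: decreasing_of_order_def)
next
  case False
  then obtain C and H :: "real measure" where "0 \<le> C" "sets H = sets borel"
    "\<And>w. 2 \<le> w \<Longrightarrow> ennreal (h w) = ennreal C + (\<integral>\<^sup>+l\<in>{w<..}. ennreal ((l - w) ^ (k - 1)) \<partial>H)"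
    and "1 \<le> k" "\<And>w. 2 \<le> w \<Longrightarrow> 0 \<le> h w"
    using assms(1) unfolding decreasing_of_order_def by auto
  then show ?thesis
    using False assms by (intro integral_D_power_mixture[of k C H h]) auto
qed

end

section \<open>The modulus along circles\<close>

text \<open>
  The arguments lie in \<open>[0, \<pi>)\<close> and \<open>(-\<pi>, 0]\<close>, so their sum is again a principal argument.
\<close>
lemma powr_mult_upper_lower:
  assumes "w \<notin> \<real>\<^sub>\<le>\<^sub>0" "z \<notin> \<real>\<^sub>\<le>\<^sub>0" "0 \<le> Im w" "Im z \<le> 0"
  shows "(w * z) powr s = w powr s * z powr s"
proof -
  have nz: "w \<noteq> 0" "z \<noteq> 0" using assms by auto
  have w: "0 \<le> Im (Ln w)" "Im (Ln w) < pi"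
    using assms(1,3) nz Im_Ln_pos_le[of w] Im_Ln_less_pi[of w] by auto
  have z: "Im (Ln z) \<le> 0" "- pi < Im (Ln z)"
  proof -
    have "0 \<le> Im (Ln (cnj z))"
      using assms(4) nz Im_Ln_pos_le[of "cnj z"] by auto
    then show "Im (Ln z) \<le> 0" unfolding cnj_Ln[OF assms(2), symmetric] by simp
    show "- pi < Im (Ln z)" using mpi_less_Im_Ln nz by auto
  qed
  have "Ln (w * z) = Ln w + Ln z"
    using w z nz by (intro Ln_times_simple) auto
  then show ?thesis using nz by (simp add: powr_def exp_add algebra_simps)
qed

lemma one_plus_mult_not_nonpos:
  fixes s :: complex
  assumes "s \<notin> \<real>\<^sub>\<le>\<^sub>0" "0 \<le> x"
  shows "1 + s * of_real x \<notin> \<real>\<^sub>\<le>\<^sub>0"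
proof
  assume "1 + s * of_real x \<in> \<real>\<^sub>\<le>\<^sub>0"
  then have *: "1 + Re s * x \<le> 0" "Im s * x = 0" by (auto simp: complex_nonpos_Reals_iff)
  then have "x \<noteq> 0" "Im s = 0" by auto
  then have "0 < Re s" using assms by (auto simp: complex_nonpos_Reals_iff)
  then show False using *(1) assms(2) mult_nonneg_nonneg[of "Re s" x] assms(2) by linarith
qed

lemma exp_Complex_not_nonpos: "\<bar>y\<bar> < pi \<Longrightarrow> exp (Complex x y) \<notin> \<real>\<^sub>\<le>\<^sub>0"
proof
  assume y: "\<bar>y\<bar> < pi" and "exp (Complex x y) \<in> \<real>\<^sub>\<le>\<^sub>0"
  then have "cos y \<le> 0" "sin y = 0"
    by (auto simp: complex_nonpos_Reals_iff Re_exp Im_exp mult_le_0_iff)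
  moreover have "sin \<bar>y\<bar> = 0" using \<open>sin y = 0\<close> by (simp add: abs_if)
  then have "y = 0" using sin_gt_zero[of "\<bar>y\<bar>"] y by (cases "y = 0") auto
  ultimately show False by simp
qed

text \<open>
  Here \<open>\<rho> = e\<^sup>c\<close>, \<open>u = e\<^sup>p\<close> and \<open>v = e\<^sup>q\<close>; the product of the two bases is
  \<open>1 + \<rho>\<^sup>2 u\<^sup>2 + 2 \<rho> u cosh (q + i y)\<close>.
\<close>
lemma kernel_product:
  assumes y: "0 \<le> y" "y < pi"
  shows "(1 + exp (Complex c y) * of_real (exp (p + q))) powr (- of_real r)
      * cnj ((1 + exp (Complex c y) * of_real (exp (p - q))) powr (- of_real r))
    = of_real (exp (p + c) powr (- r)) * shifted_cosh (2 * cosh (p + c)) (Complex q y) powr (- of_real r)"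
proof -
  let ?w = "1 + exp (Complex c y) * of_real (exp (p + q))"
  let ?z = "1 + exp (Complex c (- y)) * of_real (exp (p - q))"
  have w: "?w \<notin> \<real>\<^sub>\<le>\<^sub>0" "?z \<notin> \<real>\<^sub>\<le>\<^sub>0"
    using y by (intro one_plus_mult_not_nonpos exp_Complex_not_nonpos; simp)+
  have cnjz: "cnj (1 + exp (Complex c y) * of_real (exp (p - q))) = ?z"
    by (simp add: exp_cnj complex_cnj)
  have "1 + exp (Complex c y) * of_real (exp (p - q)) \<notin> \<real>\<^sub>\<le>\<^sub>0"
    using y by (intro one_plus_mult_not_nonpos exp_Complex_not_nonpos; simp)
  then have "cnj ((1 + exp (Complex c y) * of_real (exp (p - q))) powr (- of_real r))
      = ?z powr (- of_real r)"
    unfolding cnjz[symmetric] by (subst cnj_powr) (auto simp: complex_nonpos_Reals_iff)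
  moreover have "(?w * ?z) powr (- of_real r) = ?w powr (- of_real r) * ?z powr (- of_real r)"
    using w y sin_ge_zero[of y] by (intro powr_mult_upper_lower) (auto simp: Im_exp)
  moreover have "?w * ?z = of_real (exp (p + c)) * shifted_cosh (2 * cosh (p + c)) (Complex q y)"
  proof -
    define P where "P = complex_of_real (exp (p + c))"
    define E where "E = exp (Complex q y)"
    have nz: "P \<noteq> 0" "E \<noteq> 0" by (auto simp: P_def E_def)
    have 1: "exp (Complex c y) * of_real (exp (p + q)) = P * E"
      unfolding P_def E_def exp_of_real[symmetric] exp_add[symmetric]
      by (rule arg_cong[where f=exp]) (simp add: complex_eq_iff)
    have 2: "exp (Complex c (- y)) * of_real (exp (p - q)) = P * inverse E"
      unfolding P_def E_def exp_of_real[symmetric] exp_add[symmetric] exp_minus[symmetric]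
      by (rule arg_cong[where f=exp]) (simp add: complex_eq_iff)
    have 3: "complex_of_real (2 * cosh (p + c)) = P + inverse P"
      unfolding P_def cosh_def exp_minus by simp
    show ?thesis
      unfolding 1 2 shifted_cosh_def 3 exp_minus E_def[symmetric] P_def[symmetric]
      using nz by (simp add: algebra_simps)
  qed
  moreover have "(of_real (exp (p + c)) * shifted_cosh (2 * cosh (p + c)) (Complex q y)) powr (- of_real r)
      = of_real (exp (p + c) powr (- r)) * shifted_cosh (2 * cosh (p + c)) (Complex q y) powr (- of_real r)"
    by (subst powr_times_real_left) (auto simp flip: powr_of_real)
  ultimately show ?thesis by simp
qed

text \<open>
  The generalized Stieltjes transform \<open>E (1 + s X)\<^sup>-\<^sup>r\<close> of a positive variable \<open>X\<close>, written with the
  density \<open>g\<close> of \<open>ln X\<close>.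
\<close>
definition stieltjes :: "real \<Rightarrow> (real \<Rightarrow> real) \<Rightarrow> complex \<Rightarrow> complex" where
  "stieltjes r g s = (\<integral>a. of_real (g a) * (1 + s * of_real (exp a)) powr (- of_real r) \<partial>lborel)"

text \<open>
  The segment from \<open>1\<close> to \<open>w\<close> avoids \<open>0\<close> for \<open>w\<close> off the negative half-line, uniformly on compact
  sets of such \<open>w\<close>; dividing \<open>1 + w x\<close> by \<open>1 + x\<close> gives a point of this segment. The bound
  dominates the integrals and difference quotients below.
\<close>
lemma one_plus_mult_bound:
  fixes s :: complex
  assumes s: "s \<notin> \<real>\<^sub>\<le>\<^sub>0"
  obtains c \<delta> where "0 < c" "0 < \<delta>" "cball s \<delta> \<inter> \<real>\<^sub>\<le>\<^sub>0 = {}"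
    "\<And>w x. w \<in> cball s \<delta> \<Longrightarrow> 0 \<le> x \<Longrightarrow> c * (1 + x) \<le> norm (1 + w * of_real x)"
proof -
  have "open (- \<real>\<^sub>\<le>\<^sub>0 :: complex set)" by (simp add: open_Compl)
  then obtain \<delta> where \<delta>: "0 < \<delta>" "cball s \<delta> \<subseteq> - \<real>\<^sub>\<le>\<^sub>0"
    using s unfolding open_contains_cball by (metis ComplI)
  let ?T = "cball s \<delta> \<times> {0..1::real}"
  let ?f = "\<lambda>(w, t). norm (of_real (1 - t) + w * of_real t)"
  have "\<exists>z\<in>?T. \<forall>y\<in>?T. ?f z \<le> ?f y"
    using \<delta> by (intro continuous_attains_inf compact_Times)
       (auto simp: case_prod_beta intro!: continuous_intros)
  then obtain w0 t0 where w0: "w0 \<in> cball s \<delta>" "0 \<le> t0" "t0 \<le> 1"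
    and min: "\<And>w t. w \<in> cball s \<delta> \<Longrightarrow> 0 \<le> t \<Longrightarrow> t \<le> 1 \<Longrightarrow> ?f (w0, t0) \<le> ?f (w, t)"
    by auto
  have "?f (w0, t0) \<noteq> 0"
  proof
    assume "?f (w0, t0) = 0"
    then have *: "1 - t0 + Re w0 * t0 = 0" "Im w0 * t0 = 0" by (auto simp: complex_eq_iff)
    then have "t0 \<noteq> 0" "Im w0 = 0" by auto
    then have "0 < Re w0" using \<delta> w0 by (force simp: complex_nonpos_Reals_iff)
    then have "0 < Re w0 * t0" using \<open>t0 \<noteq> 0\<close> w0 by simp
    then show False using * w0 by linarith
  qed
  then have c: "0 < ?f (w0, t0)" by simp
  show ?thesis
  proof (rule that[OF c \<delta>(1)])
    show "cball s \<delta> \<inter> \<real>\<^sub>\<le>\<^sub>0 = {}" using \<delta> by auto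
    fix w x assume w: "w \<in> cball s \<delta>" and x: "0 \<le> (x::real)"
    let ?t = "x / (1 + x)"
    have t: "1 - ?t = 1 / (1 + x)" "0 \<le> ?t" "?t \<le> 1" using x by (auto simp: field_simps)
    have "?f (w0, t0) * (1 + x) \<le> ?f (w, ?t) * (1 + x)"
      using min[OF w t(2,3)] x by (intro mult_right_mono) auto
    also have "\<dots> = norm ((of_real (1 - ?t) + w * of_real ?t) * of_real (1 + x))"
      using x by (simp only: norm_mult norm_of_real case_prod_conv)
    also have "(of_real (1 - ?t) + w * of_real ?t) * of_real (1 + x) = 1 + w * of_real x"
    proof -
      have nz: "complex_of_real (1 + x) \<noteq> 0" using x by (simp only: of_real_eq_0_iff)
      show ?thesis unfolding t(1) of_real_divide distrib_right
        using nz by simp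
    qed
    finally show "?f (w0, t0) * (1 + x) \<le> norm (1 + w * of_real x)" .
  qed
qed

lemma measurable_stieltjes_kernel [measurable]:
  fixes s w :: complex
  shows "(\<lambda>a. (1 + s * of_real (exp a)) powr w) \<in> borel_measurable borel"
  by measurable

lemma borel_measurable_cnj [measurable]: "cnj \<in> borel_measurable borel"
  by (intro borel_measurable_continuous_onI continuous_intros)

lemma integrable_stieltjes:
  fixes s :: complex
  assumes g: "integrable lborel g" and r: "0 < r" and s: "s \<notin> \<real>\<^sub>\<le>\<^sub>0"
  shows "integrable lborel (\<lambda>a. of_real (g a) * (1 + s * of_real (exp a)) powr (- of_real r))"
proof -
  obtain c \<delta> where c: "0 < c" "0 < \<delta>"
    and bd: "\<And>w x. w \<in> cball s \<delta> \<Longrightarrow> 0 \<le> x \<Longrightarrow> c * (1 + x) \<le> norm (1 + w * of_real x)"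
    using one_plus_mult_bound[OF s] by metis
  have [measurable]: "g \<in> borel_measurable lborel" using g by auto
  show ?thesis
  proof (rule Bochner_Integration.integrable_bound)
    show "integrable lborel (\<lambda>a. c powr (- r) * g a)" using g by simp
    show "AE a in lborel. norm (of_real (g a) * (1 + s * of_real (exp a)) powr (- of_real r))
        \<le> norm (c powr (- r) * g a)"
    proof (rule AE_I2)
      fix a :: real
      have "c \<le> c * (1 + exp a)" using c by simp
      also have "\<dots> \<le> norm (1 + s * of_real (exp a))" using bd[of s "exp a"] c by simp
      finally have "norm (1 + s * of_real (exp a)) powr (- r) \<le> c powr (- r)"
        using c r by (intro powr_mono2') auto
      then show "norm (of_real (g a) * (1 + s * of_real (exp a)) powr (- of_real r))
        \<le> norm (c powr (- r) * g a)"
        using norm_powr_real_powr'[of "- of_real r" "1 + s * of_real (exp a)"]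
        by (auto simp: norm_mult abs_mult mult.commute intro!: mult_left_mono)
    qed
  qed measurable
qed

text \<open>
  The squared modulus is an integral over pairs \<open>(a, b)\<close>. Sum and difference coordinates separate
  a positive weight in \<open>p\<close> from an inner integral over \<open>q\<close>, and the increment of the inner
  integral is nonnegative for every single \<open>p\<close> by \<open>integral_D_decreasing_of_order\<close>.
\<close>
lemma norm_stieltjes_mono:
  assumes g: "integrable lborel g" and gn: "\<And>a. 0 \<le> g a" and rk: "0 < r" "r \<le> real k"
    and [measurable]: "g \<in> borel_measurable borel"
    and HM: "\<And>p. \<exists>h K. 0 \<le> K \<and> (\<forall>q. g (p + q) * g (p - q) = K * h (2 * cosh q)) \<and> decreasing_of_order k h"
    and ang: "0 \<le> u" "u \<le> v" "v < pi"
  shows "norm (stieltjes r g (exp (Complex c u))) \<le> norm (stieltjes r g (exp (Complex c v)))"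
proof -
  define P where "P y a = of_real (g a) * (1 + exp (Complex c y) * of_real (exp a)) powr (- of_real r)" for y a
  have [measurable]: "P y \<in> borel_measurable borel" for y unfolding P_def by measurable
  have intP: "integrable lborel (P y)" if "\<bar>y\<bar> < pi" for y
    unfolding P_def using g rk exp_Complex_not_nonpos[OF that] by (intro integrable_stieltjes) auto
  define F where "F y z = (case z of (a, b) \<Rightarrow> Re (P y a * cnj (P y b)))" for y z
  have [measurable]: "F y \<in> borel_measurable (borel \<Otimes>\<^sub>M borel)" for y
    unfolding F_def by measurable
  have [measurable]: "F y \<in> borel_measurable (lborel \<Otimes>\<^sub>M lborel)" for y
    unfolding F_def by measurable
  have intc: "integrable (lborel \<Otimes>\<^sub>M lborel) (\<lambda>(a, b). P y a * cnj (P y b))" if y: "\<bar>y\<bar> < pi" for y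
  proof (rule lborel_pair.Fubini_integrable)
    show "(\<lambda>(a, b). P y a * cnj (P y b)) \<in> borel_measurable (lborel \<Otimes>\<^sub>M lborel)" by measurable
    show "integrable lborel (\<lambda>a. \<integral>b. norm (case (a, b) of (a, b) \<Rightarrow> P y a * cnj (P y b)) \<partial>lborel)"
      using intP[OF y] by (simp add: norm_mult)
    show "AE a in lborel. integrable lborel (\<lambda>b. case (a, b) of (a, b) \<Rightarrow> P y a * cnj (P y b))"
      using intP[OF y] by simp
  qed
  have F_Re: "F y = (\<lambda>z. Re ((\<lambda>(a, b). P y a * cnj (P y b)) z))" for y
    by (auto simp: F_def)
  have intF: "integrable (lborel \<Otimes>\<^sub>M lborel) (F y)" if "\<bar>y\<bar> < pi" for y
    unfolding F_Re by (intro integrable_Re intc that)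
  have sq: "(norm (stieltjes r g (exp (Complex c y))))\<^sup>2 = (\<integral>z. F y z \<partial>(lborel \<Otimes>\<^sub>M lborel))"
    if y: "\<bar>y\<bar> < pi" for y
  proof -
    have gP: "stieltjes r g (exp (Complex c y)) = (\<integral>a. P y a \<partial>lborel)"
      by (simp add: stieltjes_def P_def)
    have "(\<integral>z. F y z \<partial>(lborel \<Otimes>\<^sub>M lborel)) = Re (\<integral>z. (\<lambda>(a, b). P y a * cnj (P y b)) z \<partial>(lborel \<Otimes>\<^sub>M lborel))"
      unfolding F_Re by (rule integral_Re[OF intc[OF y]])
    also have "(\<integral>z. (\<lambda>(a, b). P y a * cnj (P y b)) z \<partial>(lborel \<Otimes>\<^sub>M lborel))
        = (\<integral>a. \<integral>b. P y a * cnj (P y b) \<partial>lborel \<partial>lborel)"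
      using lborel_pair.integral_fst'[OF intc[OF y]] by simp
    also have "\<dots> = (\<integral>a. P y a \<partial>lborel) * cnj (\<integral>a. P y a \<partial>lborel)"
      using intP[OF y] by (simp add: integral_cnj)
    also have "Re \<dots> = (norm (stieltjes r g (exp (Complex c y))))\<^sup>2"
      unfolding gP by (simp add: complex_mult_cnj cmod_power2)
    finally show ?thesis by simp
  qed
  have uv: "\<bar>u\<bar> < pi" "\<bar>v\<bar> < pi" using ang by auto
  let ?G = "\<lambda>z. F v z - F u z"
  let ?M = "distr (density (lborel \<Otimes>\<^sub>M lborel) (\<lambda>_. 2)) (borel \<Otimes>\<^sub>M borel)
     (\<lambda>(p, q). (p + q, p - q :: real))"
  have intG: "integrable ?M ?G" unfolding distr_lborel_sum_diff using intF uv by simp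
  have intG': "integrable (lborel \<Otimes>\<^sub>M lborel) (\<lambda>z. 2 * ?G (case z of (p, q) \<Rightarrow> (p + q, p - q)))"
  proof -
    have "integrable (density (lborel \<Otimes>\<^sub>M lborel) (\<lambda>_. ennreal 2)) (\<lambda>z. ?G (case z of (p, q) \<Rightarrow> (p + q, p - q)))"
      using intG by (subst (asm) integrable_distr_eq) auto
    then show ?thesis by (subst (asm) integrable_density) auto
  qed
  have "(norm (stieltjes r g (exp (Complex c v))))\<^sup>2 - (norm (stieltjes r g (exp (Complex c u))))\<^sup>2
      = (\<integral>z. ?G z \<partial>(lborel \<Otimes>\<^sub>M lborel))"
    using sq intF uv by simp
  also have "\<dots> = (\<integral>z. ?G z \<partial>?M)" unfolding distr_lborel_sum_diff ..
  also have "\<dots> = (\<integral>z. ?G (case z of (p, q) \<Rightarrow> (p + q, p - q)) \<partial>density (lborel \<Otimes>\<^sub>M lborel) (\<lambda>_. ennreal 2))"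
    by (subst integral_distr) auto
  also have "\<dots> = (\<integral>z. 2 * ?G (case z of (p, q) \<Rightarrow> (p + q, p - q)) \<partial>(lborel \<Otimes>\<^sub>M lborel))"
    by (subst integral_density) auto
  also have "\<dots> = (\<integral>p. \<integral>q. 2 * ?G (p + q, p - q) \<partial>lborel \<partial>lborel)"
    using lborel_pair.integral_fst'[OF intG'] by simp
  also have "\<dots> \<ge> 0"
  proof (rule Bochner_Integration.integral_nonneg)
    fix p :: real
    have "angle_increment (2 * cosh (p + c)) r u v"
      using cosh_real_ge_1[of "p + c"] rk ang by unfold_locales auto
    then interpret angle_increment "2 * cosh (p + c)" r u v .
    obtain h K where hK: "0 \<le> K" "\<And>q. g (p + q) * g (p - q) = K * h (2 * cosh q)" "decreasing_of_order k h"
      using HM[of p] by auto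
    have F: "F y (p + q, p - q) = exp (p + c) powr (- r) * (g (p + q) * g (p - q))
        * Re (shifted_cosh (2 * cosh (p + c)) (Complex q y) powr (- of_real r))" if "0 \<le> y" "y < pi" for y q
    proof -
      have "P y (p + q) * cnj (P y (p - q)) = of_real (g (p + q) * g (p - q)) *
        ((1 + exp (Complex c y) * of_real (exp (p + q))) powr (- of_real r)
      * cnj ((1 + exp (Complex c y) * of_real (exp (p - q))) powr (- of_real r)))"
        by (simp add: P_def)
      also have "\<dots> = of_real (exp (p + c) powr (- r) * (g (p + q) * g (p - q)))
          * shifted_cosh (2 * cosh (p + c)) (Complex q y) powr (- of_real r)"
        unfolding kernel_product[OF that] by simp
      finally have e: "P y (p + q) * cnj (P y (p - q)) = of_real (exp (p + c) powr (- r) * (g (p + q) * g (p - q)))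
          * shifted_cosh (2 * cosh (p + c)) (Complex q y) powr (- of_real r)" .
      show ?thesis
        unfolding F_def case_prod_conv e
        by (simp only: times_complex.sel(1) Re_complex_of_real Im_complex_of_real)
    qed
    have "(\<integral>q. 2 * ?G (p + q, p - q) \<partial>lborel)
        = (\<integral>q. 2 * exp (p + c) powr (- r) * (D q * (g (p + q) * g (p - q))) \<partial>lborel)"
    proof (intro Bochner_Integration.integral_cong refl)
      fix q
      have "0 \<le> v" "u < pi" using ang by auto
      then show "2 * ?G (p + q, p - q) = 2 * exp (p + c) powr (- r) * (D q * (g (p + q) * g (p - q)))"
        unfolding F[OF ang(1) \<open>u < pi\<close>] F[OF \<open>0 \<le> v\<close> ang(3)] D_def
        by (simp only: left_diff_distrib right_diff_distrib mult_ac)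
    qed
    also have "\<dots> = 2 * exp (p + c) powr (- r) * (\<integral>q. D q * (g (p + q) * g (p - q)) \<partial>lborel)"
      by simp
    also have "\<dots> \<ge> 0"
    proof (cases "K = 0")
      case True
      then show ?thesis by (simp add: hK(2))
    next
      case False
      then have h: "h (2 * cosh q) = g (p + q) * g (p - q) / K" for q using hK by simp
      have "(\<lambda>q. h (2 * cosh q)) \<in> borel_measurable borel" unfolding h by measurable
      then have "0 \<le> (\<integral>q. D q * h (2 * cosh q) \<partial>lborel)"
        using hK rk by (intro integral_D_decreasing_of_order) auto
      moreover have "(\<integral>q. D q * (g (p + q) * g (p - q)) \<partial>lborel) = K * (\<integral>q. D q * h (2 * cosh q) \<partial>lborel)"
        by (simp add: hK(2) mult.left_commute)
      ultimately show ?thesis using hK(1) by simp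
    qed
    finally show "0 \<le> (\<integral>q. 2 * ?G (p + q, p - q) \<partial>lborel)" .
  qed
  finally have "(norm (stieltjes r g (exp (Complex c u))))\<^sup>2 \<le> (norm (stieltjes r g (exp (Complex c v))))\<^sup>2" by simp
  then show ?thesis by (rule power2_le_imp_le) simp
qed

lemma poisson_denominator_ge:
  fixes x c :: real
  assumes "\<bar>x\<bar> < 1" "\<bar>c\<bar> \<le> 1"
  shows "(1 - \<bar>x\<bar>)\<^sup>2 \<le> 1 - 2 * x * c + x\<^sup>2"
proof -
  have "x * c \<le> \<bar>x\<bar> * \<bar>c\<bar>" by (metis abs_ge_self abs_mult)
  also have "\<dots> \<le> \<bar>x\<bar> * 1" using assms by (intro mult_left_mono) auto
  finally show ?thesis by (simp add: power2_eq_square algebra_simps)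
qed

section \<open>Typically real functions\<close>

text \<open>
  Cauchy's formula for \<open>(1 - w\<^sup>2) G(w) / (1 - x w)\<close> at the point \<open>x\<close>, where \<open>G\<close> is the difference quotient of
  \<open>f\<close> at \<open>0\<close>. On the unit circle \<open>1 - w\<^sup>2 = - 2 i sin(a) w\<close> and
  \<open>(1 - x w) (w - x) = |w - x|\<^sup>2 w\<close>, so that the real part of the integrand only sees \<open>Im f\<close>,
  weighted by the sine.
\<close>
lemma typically_real_circle:
  assumes f: "f holomorphic_on S" and S: "open S" "cball 0 1 \<subseteq> S" and x: "\<bar>x\<bar> < 1"
    and im0: "Im (f 0) = 0"
  shows "set_integrable lborel {0..1} (\<lambda>t. 2 * sin (2 * pi * t) * Im (f (cis (2 * pi * t)))
           / (1 - 2 * x * cos (2 * pi * t) + x\<^sup>2))"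
    and "(LBINT t:{0..1}. 2 * sin (2 * pi * t) * Im (f (cis (2 * pi * t)))
           / (1 - 2 * x * cos (2 * pi * t) + x\<^sup>2))
       = Re (if x = 0 then deriv f 0 else (f (of_real x) - f 0) / of_real x)"
proof -
  define G where "G w = (if w = 0 then deriv f 0 else (f w - f 0) / (w - 0))" for w
  have G: "G holomorphic_on S" unfolding G_def by (rule pole_lemma_open[OF f S(1)])
  \<comment> \<open>The factor \<open>1 - w\<^sup>2\<close> produces the sine, and \<open>1 - x w\<close> completes \<open>w - x\<close> to a squared modulus.\<close>
  define q where "q w = (1 - w\<^sup>2) * G w / (1 - of_real x * w)" for w
  have nz: "1 - of_real x * w \<noteq> 0" if "norm w \<le> 1" for w :: complex
  proof
    assume "1 - of_real x * w = 0"
    then have "norm (of_real x * w) = 1" by simp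
    moreover have "norm (of_real x * w) \<le> \<bar>x\<bar> * 1"
      using that by (simp add: norm_mult mult_left_le)
    ultimately show False using x by simp
  qed
  have "q holomorphic_on cball 0 1"
    unfolding q_def using nz G S(2)
    by (intro holomorphic_intros) (auto intro: holomorphic_on_subset)
  then have "((\<lambda>u. q u / (u - of_real x)) has_contour_integral (2 * of_real pi * \<i> * q (of_real x))) (circlepath 0 1)"
    using x by (intro Cauchy_integral_circlepath_simple) auto
  also have "q (of_real x) = G (of_real x)"
  proof -
    have "1 - (of_real x :: complex)\<^sup>2 \<noteq> 0"
      using nz[of "of_real x"] x by (simp add: power2_eq_square)
    then show ?thesis by (simp add: q_def power2_eq_square)
  qed
  finally have "((\<lambda>t. q (circlepath 0 1 t) / (circlepath 0 1 t - of_real x)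
      * vector_derivative (circlepath 0 1) (at t within {0..1})) has_integral
      (2 * of_real pi * \<i> * G (of_real x))) {0..1}"
    by (simp only: has_contour_integral_def)
  then have "((\<lambda>t. q (cis (2 * pi * t)) / (cis (2 * pi * t) - of_real x)
      * (of_real (2 * pi) * \<i> * cis (2 * pi * t))) has_integral (2 * of_real pi * \<i> * G (of_real x))) {0..1}"
  proof (rule has_integral_eq[rotated])
    fix t :: real assume "t \<in> {0..1}"
    then have "vector_derivative (circlepath 0 1) (at t within {0..1}) = of_real (2 * pi) * \<i> * cis (2 * pi * t)"
      by (simp add: vector_derivative_circlepath01 cis_conv_exp mult_ac)
    moreover have "circlepath 0 1 t = cis (2 * pi * t)"
      by (simp add: circlepath cis_conv_exp mult_ac)
    ultimately show "q (circlepath 0 1 t) / (circlepath 0 1 t - of_real x)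
      * vector_derivative (circlepath 0 1) (at t within {0..1})
      = q (cis (2 * pi * t)) / (cis (2 * pi * t) - of_real x) * (of_real (2 * pi) * \<i> * cis (2 * pi * t))"
      by simp
  qed
  then have "((\<lambda>t. q (cis (2 * pi * t)) / (cis (2 * pi * t) - of_real x)
      * (of_real (2 * pi) * \<i> * cis (2 * pi * t)) * (1 / (2 * of_real pi * \<i>))) has_integral
      (2 * of_real pi * \<i> * G (of_real x)) * (1 / (2 * of_real pi * \<i>))) {0..1}"
    by (rule has_integral_mult_left)
  then have "((\<lambda>t. q (cis (2 * pi * t)) / (cis (2 * pi * t) - of_real x)
      * cis (2 * pi * t)) has_integral G (of_real x)) {0..1}"
    by (simp add: field_simps)
  then have "((\<lambda>t. Re (q (cis (2 * pi * t)) / (cis (2 * pi * t) - of_real x)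
      * cis (2 * pi * t))) has_integral Re (G (of_real x))) {0..1}"
    by (rule has_integral_Re)
  also have "(\<lambda>t. Re (q (cis (2 * pi * t)) / (cis (2 * pi * t) - of_real x) * cis (2 * pi * t)))
      = (\<lambda>t. 2 * sin (2 * pi * t) * Im (f (cis (2 * pi * t))) / (1 - 2 * x * cos (2 * pi * t) + x\<^sup>2))"
  proof
    fix t :: real
    define a where "a = 2 * pi * t"
    define w where "w = cis a"
    have w: "norm w = 1" "w \<noteq> 0" "w * cnj w = 1"
      by (auto simp: w_def complex_norm_square[symmetric] simp flip: of_real_power)
    define d where "d = 1 - 2 * x * cos a + x\<^sup>2"
    have d: "(1 - of_real x * w) * (w - of_real x) = w * of_real d"
    proof -
      have "(1 - of_real x * w) * (w - of_real x) = w * ((1 - of_real x * w) * (1 - of_real x * cnj w))"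
      proof -
        have "w * ((1 - of_real x * w) * (1 - of_real x * cnj w))
            = (1 - of_real x * w) * (w - of_real x * (w * cnj w))"
          by (simp add: algebra_simps)
        then show ?thesis by (simp only: w(3) mult_1_right)
      qed
      also have "(1 - of_real x * w) * (1 - of_real x * cnj w) = of_real d"
      proof -
        have "(1 - of_real x * w) * (1 - of_real x * cnj w)
            = 1 - of_real x * (w + cnj w) + of_real x * of_real x * (w * cnj w)"
          by (simp add: algebra_simps)
        also have "w + cnj w = of_real (2 * cos a)" by (simp add: complex_add_cnj w_def)
        finally show ?thesis using w(3) by (simp add: d_def power2_eq_square)
      qed
      finally show ?thesis .
    qed
    have dnz: "d \<noteq> 0"
    proof
      assume "d = 0"
      then have "w - of_real x = 0" using d nz[of w] w by auto
      then have "norm w = \<bar>x\<bar>" by simp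
      then show False using w x by simp
    qed
    have w2: "1 - w\<^sup>2 = w * (- 2 * \<i> * of_real (sin a))"
    proof -
      have "1 - w\<^sup>2 = w * (cnj w - w)" using w(3) by (simp add: algebra_simps power2_eq_square)
      also have "cnj w - w = - 2 * \<i> * of_real (sin a)" by (simp add: w_def complex_eq_iff)
      finally show ?thesis .
    qed
    have "q w / (w - of_real x) * w = (1 - w\<^sup>2) * (w * G w) / ((1 - of_real x * w) * (w - of_real x))"
      by (simp add: q_def)
    also have "w * G w = f w - f 0" using w(2) by (simp add: G_def)
    also have "(1 - w\<^sup>2) * (f w - f 0) / ((1 - of_real x * w) * (w - of_real x))
        = of_real (1 / d) * (- 2 * \<i> * of_real (sin a) * (f w - f 0))"
      unfolding d w2 using w dnz by (simp add: field_simps)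
    finally have eq: "q w / (w - of_real x) * w = of_real (1 / d) * (- 2 * \<i> * of_real (sin a) * (f w - f 0))" .
    have "Re (q w / (w - of_real x) * w) = 2 * sin a * Im (f w) / d"
      unfolding eq using im0 by (simp add: algebra_simps)
    then show "Re (q (cis (2 * pi * t)) / (cis (2 * pi * t) - of_real x) * cis (2 * pi * t))
        = 2 * sin (2 * pi * t) * Im (f (cis (2 * pi * t))) / (1 - 2 * x * cos (2 * pi * t) + x\<^sup>2)"
      by (simp add: w_def d_def a_def)
  qed
  finally have hi: "((\<lambda>t. 2 * sin (2 * pi * t) * Im (f (cis (2 * pi * t)))
      / (1 - 2 * x * cos (2 * pi * t) + x\<^sup>2)) has_integral Re (G (of_real x))) {0..1}" .
  have dpos: "0 < 1 - 2 * x * cos a + x\<^sup>2" for a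
    using less_le_trans[OF _ poisson_denominator_ge[OF x abs_cos_le_one]] x by simp
  have contf: "continuous_on S f" using f by (rule holomorphic_on_imp_continuous_on)
  have "continuous_on {0..1} (\<lambda>t. f (cis (2 * pi * t)))"
    by (rule continuous_on_compose2[OF contf]) (use S in \<open>auto intro!: continuous_intros simp: cis_conv_exp\<close>)
  then have "continuous_on {0..1} (\<lambda>t. 2 * sin (2 * pi * t) * Im (f (cis (2 * pi * t)))
      / (1 - 2 * x * cos (2 * pi * t) + x\<^sup>2))"
    using dpos by (intro continuous_intros) (auto simp: less_imp_neq[symmetric])
  then show si: "set_integrable lborel {0..1} (\<lambda>t. 2 * sin (2 * pi * t) * Im (f (cis (2 * pi * t)))
           / (1 - 2 * x * cos (2 * pi * t) + x\<^sup>2))"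
    by (rule borel_integrable_atLeastAtMost')
  show "(LBINT t:{0..1}. 2 * sin (2 * pi * t) * Im (f (cis (2 * pi * t)))
           / (1 - 2 * x * cos (2 * pi * t) + x\<^sup>2))
       = Re (if x = 0 then deriv f 0 else (f (of_real x) - f 0) / of_real x)"
    using set_borel_integral_eq_integral(2)[OF si] integral_unique[OF hi] by (simp add: G_def)
qed

text \<open>
  Cutting the parameter off outside \<open>[-1, 1]\<close> makes the kernels bounded and continuous on the
  whole line, so that weak convergence of laws on the line applies to them.
\<close>
definition clip :: "real \<Rightarrow> real" where "clip c = max (- 1) (min 1 c)"

lemma isCont_clip: "isCont clip c"
  unfolding clip_def[abs_def] by (intro continuous_intros)

lemma measurable_clip [measurable]: "clip \<in> borel_measurable borel"
  unfolding clip_def[abs_def] by measurable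

lemma clip_cos [simp]: "clip (cos t) = cos t"
  by (simp add: clip_def)

text \<open>
  The previous lemma applies to \<open>z \<mapsto> f(\<rho> z)\<close> with \<open>\<rho> < 1\<close>. The weights are nonnegative with
  total mass \<open>\<rho> f'(0)\<close>; normalized and transported by the cosine they are laws on \<open>[-1, 1]\<close>, and
  Helly's theorem gives a limit as \<open>\<rho>\<close> tends to \<open>1\<close>. If \<open>f'(0) = 0\<close>, then \<open>Re f\<close> is constant on the
  real diameter and the zero measure serves.
\<close>
lemma typically_real_representation:
  assumes f: "f holomorphic_on ball 0 1"
    and pos: "\<And>z. norm z < 1 \<Longrightarrow> 0 \<le> Im z \<Longrightarrow> 0 \<le> Im (f z)"
    and neg: "\<And>z. norm z < 1 \<Longrightarrow> Im z \<le> 0 \<Longrightarrow> Im (f z) \<le> 0"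
  obtains \<nu> :: "real measure" where "finite_measure \<nu>" "sets \<nu> = sets borel"
    "AE c in \<nu>. c \<in> {-1..1}"
    "\<And>x. \<bar>x\<bar> < 1 \<Longrightarrow> Re (f (of_real x)) - Re (f 0) = (\<integral>c. x / (1 - 2 * x * c + x\<^sup>2) \<partial>\<nu>)"
proof -
  have im0: "Im (f 0) = 0" using pos[of 0] neg[of 0] by simp
  define \<rho> where "\<rho> n = real (Suc n) / real (Suc (Suc n))" for n
  have \<rho>: "0 < \<rho> n" "\<rho> n < 1" for n by (auto simp: \<rho>_def)
  have \<rho>_lim: "\<rho> \<longlonglongrightarrow> 1" unfolding \<rho>_def[abs_def] by real_asymp
  define F where "F n z = f (of_real (\<rho> n) * z)" for n z
  have Fhol: "F n holomorphic_on ball 0 (1 / \<rho> n)" for n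
  proof -
    have "f \<circ> (\<lambda>z. of_real (\<rho> n) * z) holomorphic_on ball 0 (1 / \<rho> n)"
    proof (rule holomorphic_on_compose_gen[OF _ f])
      show "(\<lambda>z :: complex. of_real (\<rho> n) * z) ` ball 0 (1 / \<rho> n) \<subseteq> ball 0 1"
        using \<rho>[of n] by (auto simp: dist_norm norm_mult field_simps)
    qed (intro holomorphic_intros)
    then show ?thesis by (simp add: F_def[abs_def] o_def)
  qed
  have ball: "cball 0 1 \<subseteq> (ball 0 (1 / \<rho> n) :: complex set)" for n
  proof -
    have "1 < 1 / \<rho> n" using \<rho>[of n] by simp
    then show ?thesis by auto
  qed
  have F0: "F n 0 = f 0" for n by (simp add: F_def)
  have imF0: "Im (F n 0) = 0" for n using im0 by (simp add: F0)
  define w where "w n t = 2 * sin (2 * pi * t) * Im (F n (cis (2 * pi * t)))" for n t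
  have w_nonneg: "0 \<le> w n t" for n t
  proof (cases "0 \<le> sin (2 * pi * t)")
    case True
    then have "0 \<le> Im (F n (cis (2 * pi * t)))"
      unfolding F_def using \<rho>[of n] by (intro pos) (auto simp: norm_mult)
    then show ?thesis using True by (simp add: w_def)
  next
    case False
    then have "Im (F n (cis (2 * pi * t))) \<le> 0"
      unfolding F_def using \<rho>[of n] by (intro neg) (auto simp: norm_mult mult_le_0_iff)
    then show ?thesis using False by (simp add: w_def mult_nonpos_nonpos)
  qed
  note circle = typically_real_circle[OF Fhol open_ball ball _ imF0]
  have int: "set_integrable lborel {0..1} (\<lambda>t. w n t / (1 - 2 * x * cos (2 * pi * t) + x\<^sup>2))"
    and eq: "(LBINT t:{0..1}. w n t / (1 - 2 * x * cos (2 * pi * t) + x\<^sup>2))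
       = Re (if x = 0 then deriv (F n) 0 else (F n (of_real x) - f 0) / of_real x)"
    if "\<bar>x\<bar> < 1" for n x
    using circle[OF that, of n] by (simp_all add: w_def F0)
  define d where "d = Re (deriv f 0)"
  have derivF: "deriv (F n) 0 = of_real (\<rho> n) * deriv f 0" for n
  proof -
    have "(f has_field_derivative deriv f 0) (at (of_real (\<rho> n) * 0))"
      using holomorphic_derivI[OF f open_ball, of 0] by simp
    then have "(F n has_field_derivative deriv f 0 * of_real (\<rho> n)) (at 0)"
      unfolding F_def[abs_def] by (rule DERIV_chain2) (auto intro!: derivative_eq_intros)
    then show ?thesis by (simp add: DERIV_imp_deriv mult.commute)
  qed
  have int0: "set_integrable lborel {0..1} (w n)" and mass: "(LBINT t:{0..1}. w n t) = \<rho> n * d" for n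
    using int[of 0 n] eq[of 0 n] by (simp_all add: derivF d_def)
  have d_nonneg: "0 \<le> d"
  proof -
    have "0 \<le> (LBINT t:{0..1}. w 0 t)"
      unfolding set_lebesgue_integral_def using w_nonneg
      by (intro Bochner_Integration.integral_nonneg) auto
    then show ?thesis using \<rho>[of 0] unfolding mass by (simp add: zero_le_mult_iff)
  qed
  have F_lim: "(\<lambda>n. Re (F n (of_real x))) \<longlonglongrightarrow> Re (f (of_real x))" if "\<bar>x\<bar> < 1" for x
  proof -
    have "isCont f (of_real x)"
      using holomorphic_on_imp_continuous_on[OF f] that
      by (auto simp: continuous_on_eq_continuous_at)
    moreover have "(\<lambda>n. of_real (\<rho> n) * of_real x) \<longlonglongrightarrow> (of_real x :: complex)"
      using tendsto_mult[OF tendsto_of_real[OF \<rho>_lim] tendsto_const[of "of_real x :: complex"]] by simp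
    ultimately have "(\<lambda>n. f (of_real (\<rho> n) * of_real x)) \<longlonglongrightarrow> f (of_real x)"
      by (rule isCont_tendsto_compose)
    then show ?thesis unfolding F_def by (rule tendsto_Re)
  qed
  show ?thesis
  proof (cases "d = 0")
    case True
    have "Re (F n (of_real x)) = Re (f 0)" if x: "\<bar>x\<bar> < 1" for n x
    proof (cases "x = 0")
      case False
      let ?q = "\<lambda>t. w n t / (1 - 2 * x * cos (2 * pi * t) + x\<^sup>2)"
      have K: "0 < (1 - \<bar>x\<bar>)\<^sup>2" using x by simp
      have q: "0 \<le> ?q t" "?q t \<le> w n t / (1 - \<bar>x\<bar>)\<^sup>2" for t
      proof -
        note den = poisson_denominator_ge[OF x abs_cos_le_one, of "2 * pi * t"]
        note D = less_le_trans[OF K den]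
        show "0 \<le> ?q t" by (rule divide_nonneg_pos[OF w_nonneg D])
        show "?q t \<le> w n t / (1 - \<bar>x\<bar>)\<^sup>2"
          by (rule divide_left_mono[OF den w_nonneg mult_pos_pos[OF D K]])
      qed
      have "(LBINT t:{0..1}. ?q t) \<le> (LBINT t:{0..1}. w n t / (1 - \<bar>x\<bar>)\<^sup>2)"
        using q int[OF x] int0 by (intro set_integral_mono set_integrable_divide) auto
      also have "\<dots> = 0" using mass[of n] True by simp
      finally have "(LBINT t:{0..1}. ?q t) \<le> 0" .
      moreover have "0 \<le> (LBINT t:{0..1}. ?q t)"
        unfolding set_lebesgue_integral_def
        by (intro Bochner_Integration.integral_nonneg scaleR_nonneg_nonneg q(1)) simp
      ultimately have "Re ((F n (of_real x) - f 0) / of_real x) = 0"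
        using eq[OF x, of n] False by simp
      then show ?thesis using False by simp
    qed (simp add: F0)
    then have "Re (f (of_real x)) = Re (f 0)" if "\<bar>x\<bar> < 1" for x
      using F_lim[OF that] that LIMSEQ_unique[OF _ tendsto_const] by auto
    then show ?thesis
      by (intro that[of "null_measure borel"] AE_I'[of UNIV])
         (auto intro!: finite_measureI simp: null_sets_def)
  next
    case False
    then have d: "0 < d" using d_nonneg by simp
    define Q where "Q n = density lborel (\<lambda>t. ennreal (indicator {0..1} t * (w n t / (\<rho> n * d))))" for n
    define P where "P n = distr (Q n) borel (\<lambda>t. cos (2 * pi * t))" for n
    have wmeas: "(\<lambda>t. indicator {0..1} t * (w n t / (\<rho> n * d))) \<in> borel_measurable lborel" for n
    proof -
      have "(\<lambda>t. indicator {0..1} t *\<^sub>R w n t) \<in> borel_measurable lborel"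
        using int0[of n] unfolding set_integrable_def by (rule borel_measurable_integrable)
      then have "(\<lambda>t. (indicator {0..1} t *\<^sub>R w n t) / (\<rho> n * d)) \<in> borel_measurable lborel" by measurable
      then show ?thesis by simp
    qed
    have wnn: "0 \<le> indicator {0..1} t * (w n t / (\<rho> n * d))" for n t
      using w_nonneg[of n t] \<rho>[of n] d by simp
    have intP: "(\<integral>c. k c \<partial>P n) = (LBINT t:{0..1}. w n t * k (cos (2 * pi * t))) / (\<rho> n * d)"
      if [measurable]: "k \<in> borel_measurable borel" for k :: "real \<Rightarrow> real" and n
    proof -
      have "(\<integral>c. k c \<partial>P n) = (\<integral>t. k (cos (2 * pi * t)) \<partial>Q n)"
        unfolding P_def by (rule integral_distr) (auto simp: Q_def)
      also have "\<dots> = (\<integral>t. (indicator {0..1} t * (w n t / (\<rho> n * d))) *\<^sub>R k (cos (2 * pi * t)) \<partial>lborel)"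
        unfolding Q_def by (rule integral_density) (use wmeas wnn in auto)
      also have "\<dots> = (\<integral>t. (indicator {0..1} t *\<^sub>R (w n t * k (cos (2 * pi * t)))) / (\<rho> n * d) \<partial>lborel)"
        by (simp add: mult_ac)
      also have "\<dots> = (LBINT t:{0..1}. w n t * k (cos (2 * pi * t))) / (\<rho> n * d)"
        unfolding set_lebesgue_integral_def by (rule integral_divide_zero)
      finally show ?thesis .
    qed
    have probQ: "prob_space (Q n)" for n
    proof
      have "emeasure (Q n) (space (Q n)) = (\<integral>\<^sup>+t. ennreal (indicator {0..1} t * (w n t / (\<rho> n * d))) \<partial>lborel)"
        unfolding Q_def using wmeas by (subst emeasure_density) auto
      also have "\<dots> = ennreal (\<integral>t. indicator {0..1} t * (w n t / (\<rho> n * d)) \<partial>lborel)"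
      proof (rule nn_integral_eq_integral)
        have "integrable lborel (\<lambda>t. (indicator {0..1} t *\<^sub>R w n t) / (\<rho> n * d))"
          using int0[of n] unfolding set_integrable_def by (rule integrable_divide)
        then show "integrable lborel (\<lambda>t. indicator {0..1} t * (w n t / (\<rho> n * d)))" by simp
      qed (use wnn in auto)
      also have "(\<integral>t. indicator {0..1} t * (w n t / (\<rho> n * d)) \<partial>lborel)
          = (\<integral>t. (indicator {0..1} t *\<^sub>R w n t) / (\<rho> n * d) \<partial>lborel)" by simp
      also have "\<dots> = (LBINT t:{0..1}. w n t) / (\<rho> n * d)"
        unfolding set_lebesgue_integral_def by (rule integral_divide_zero)
      also have "\<dots> = 1" using \<rho>[of n] d unfolding mass by simp
      finally show "emeasure (Q n) (space (Q n)) = 1" by simp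
    qed
    have rdP: "real_distribution (P n)" for n
    proof -
      have "(\<lambda>t. cos (2 * pi * t)) \<in> measurable (Q n) borel" by (simp add: Q_def)
      then show ?thesis
        unfolding P_def real_distribution_def real_distribution_axioms_def
        by (simp add: prob_space.prob_space_distr[OF probQ])
    qed
    \<comment> \<open>The half-open interval \<open>(-2, 1]\<close> contains the support \<open>[-1, 1]\<close>.\<close>
    have "tight P"
      unfolding tight_def
    proof (intro conjI allI impI rdP, rule exI[of _ "-2 :: real"], rule exI[of _ "1 :: real"], intro conjI allI)
      fix \<epsilon> :: real and n assume "0 < \<epsilon>"
      interpret prob_space "P n" using rdP by (simp add: real_distribution_def)
      have "AE c in P n. c \<in> {-2<..1}"
        unfolding P_def
      proof (subst AE_distr_iff)
        have "- 2 < cos (2 * pi * t)" for t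
          using cos_ge_minus_one[of "2 * pi * t"] by linarith
        then show "AE t in Q n. cos (2 * pi * t) \<in> {-2<..1}" by simp
      qed (auto simp: Q_def)
      then have "prob {-2<..1} = 1"
        by (subst prob_eq_1) (auto simp: P_def)
      then show "1 - \<epsilon> < measure (P n) {-2<..1}" using \<open>0 < \<epsilon>\<close> by simp
    qed simp
    then obtain s M where s: "strict_mono (s :: nat \<Rightarrow> nat)" and M: "real_distribution M"
      and weak: "weak_conv_m (P \<circ> id \<circ> s) M"
      using tight_imp_convergent_subsubsequence[of P id] by (auto simp: strict_mono_def)
    interpret M: real_distribution M by fact
    define \<nu> where "\<nu> = distr (density M (\<lambda>_. ennreal d)) borel clip"
    show ?thesis
    proof (rule that[of \<nu>])
      show "sets \<nu> = sets borel" by (simp add: \<nu>_def)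
      have "emeasure M UNIV = 1" using M.emeasure_space_1 by simp
      then have "emeasure \<nu> (space \<nu>) = ennreal d"
        by (simp add: \<nu>_def emeasure_distr emeasure_density nn_integral_cmult)
      then show "finite_measure \<nu>" by (intro finite_measureI) simp
      show "AE c in \<nu>. c \<in> {-1..1}"
        unfolding \<nu>_def by (subst AE_distr_iff) (auto simp: clip_def)
      fix x :: real assume x: "\<bar>x\<bar> < 1"
      let ?k = "\<lambda>c. 1 / (1 - 2 * x * clip c + x\<^sup>2)"
      have clip1: "\<bar>clip c\<bar> \<le> 1" for c by (auto simp: clip_def)
      have den: "(1 - \<bar>x\<bar>)\<^sup>2 \<le> 1 - 2 * x * clip c + x\<^sup>2" for c
        by (rule poisson_denominator_ge[OF x clip1])
      have K: "0 < (1 - \<bar>x\<bar>)\<^sup>2" using x by simp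
      have lim: "(\<lambda>n. \<integral>c. ?k c \<partial>(P \<circ> id \<circ> s) n) \<longlonglongrightarrow> (\<integral>c. ?k c \<partial>M)"
      proof (rule weak_conv_imp_integral_bdd_continuous_conv[OF _ M weak])
        show "real_distribution ((P \<circ> id \<circ> s) n)" for n using rdP by simp
        show "isCont ?k c" for c
          using less_le_trans[OF K den[of c]] by (intro continuous_intros isCont_clip) auto
        show "norm (?k c) \<le> 1 / (1 - \<bar>x\<bar>)\<^sup>2" for c
          using K den[of c] less_le_trans[OF K den[of c]] by (auto intro!: divide_left_mono)
      qed
      have "(\<integral>c. x / (1 - 2 * x * c + x\<^sup>2) \<partial>\<nu>) = (\<integral>c. x * d * ?k c \<partial>M)"
        unfolding \<nu>_def by (subst integral_distr, simp, simp, subst integral_density) (use d in \<open>auto simp: mult_ac\<close>)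
      also have "\<dots> = x * d * (\<integral>c. ?k c \<partial>M)" by (rule integral_mult_right_zero)
      also have "\<dots> = Re (f (of_real x)) - Re (f 0)"
      proof (cases "x = 0")
        case x0: False
        have "(\<integral>c. ?k c \<partial>(P \<circ> id \<circ> s) n) = (Re (F (s n) (of_real x)) - Re (f 0)) / (x * (\<rho> (s n) * d))" for n
        proof -
          have "(\<integral>c. ?k c \<partial>(P \<circ> id \<circ> s) n)
              = (LBINT t:{0..1}. w (s n) t * ?k (cos (2 * pi * t))) / (\<rho> (s n) * d)"
            by (simp add: intP)
          also have "(LBINT t:{0..1}. w (s n) t * ?k (cos (2 * pi * t)))
              = Re ((F (s n) (of_real x) - f 0) / of_real x)"
            using eq[OF x, of "s n"] x0 by simp
          finally show ?thesis by simp
        qed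
        moreover have "(\<lambda>n. (Re (F (s n) (of_real x)) - Re (f 0)) / (x * (\<rho> (s n) * d)))
            \<longlonglongrightarrow> (Re (f (of_real x)) - Re (f 0)) / (x * (1 * d))"
        proof -
          have "(\<lambda>n. Re (F (s n) (of_real x))) \<longlonglongrightarrow> Re (f (of_real x))" "(\<lambda>n. \<rho> (s n)) \<longlonglongrightarrow> 1"
            using LIMSEQ_subseq_LIMSEQ[OF F_lim[OF x] s] LIMSEQ_subseq_LIMSEQ[OF \<rho>_lim s]
            by (auto simp: o_def)
          then show ?thesis
            by (intro tendsto_divide tendsto_diff tendsto_mult tendsto_const) (use x0 d in auto)
        qed
        ultimately have "(\<integral>c. ?k c \<partial>M) = (Re (f (of_real x)) - Re (f 0)) / (x * (1 * d))"
          using lim LIMSEQ_unique by simp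
        then show ?thesis using x0 d by simp
      qed simp
      finally show "Re (f (of_real x)) - Re (f 0) = (\<integral>c. x / (1 - 2 * x * c + x\<^sup>2) \<partial>\<nu>)" by simp
    qed
  qed
qed

section \<open>The logarithmic derivative of the transform\<close>
definition stieltjes' :: "real \<Rightarrow> (real \<Rightarrow> real) \<Rightarrow> complex \<Rightarrow> complex" where
  "stieltjes' r g s = (\<integral>a. of_real (g a) * (- of_real r * of_real (exp a)
      * (1 + s * of_real (exp a)) powr (- of_real r - 1)) \<partial>lborel)"

lemma has_field_derivative_stieltjes:
  assumes g: "integrable lborel g" and r: "0 < r" and s: "s \<notin> \<real>\<^sub>\<le>\<^sub>0"
  shows "(stieltjes r g has_field_derivative stieltjes' r g s) (at s)"
proof -
  obtain c \<delta> where c: "0 < c" "0 < \<delta>" and disj: "cball s \<delta> \<inter> \<real>\<^sub>\<le>\<^sub>0 = {}"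
    and bd: "\<And>w x. w \<in> cball s \<delta> \<Longrightarrow> 0 \<le> x \<Longrightarrow> c * (1 + x) \<le> norm (1 + w * of_real x)"
    using one_plus_mult_bound[OF s] by metis
  have [measurable]: "g \<in> borel_measurable lborel" using g by auto
  define k where "k w a = (1 + w * of_real (exp a)) powr (- of_real r)" for w :: complex and a :: real
  define k' where "k' w a = - of_real r * of_real (exp a) * (1 + w * of_real (exp a)) powr (- of_real r - 1)"
    for w :: complex and a :: real
  have kd: "((\<lambda>w. k w a) has_field_derivative k' w a) (at w)" if "w \<in> cball s \<delta>" for w a
  proof -
    have "1 + w * of_real (exp a) \<notin> \<real>\<^sub>\<le>\<^sub>0"
      using that disj by (intro one_plus_mult_not_nonpos) auto
    then have "((\<lambda>z. z powr (- of_real r)) has_field_derivative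
        - of_real r * (1 + w * of_real (exp a)) powr (- of_real r - 1)) (at (1 + w * of_real (exp a)))"
      by (rule has_field_derivative_powr)
    then have "((\<lambda>w. (1 + w * of_real (exp a)) powr (- of_real r)) has_field_derivative
       - of_real r * (1 + w * of_real (exp a)) powr (- of_real r - 1) * of_real (exp a)) (at w)"
      by (rule DERIV_chain2) (auto intro!: derivative_eq_intros)
    then show ?thesis by (simp add: k_def k'_def mult_ac)
  qed
  define B where "B = r * c powr (- r - 1)"
  have k'b: "norm (k' w a) \<le> B" if "w \<in> cball s \<delta>" for w a
  proof -
    have n: "0 < c * (1 + exp a)" using c by (simp add: add_pos_pos)
    have "norm (k' w a) = r * exp a * norm (1 + w * of_real (exp a)) powr (- r - 1)"
      using r norm_powr_real_powr'[of "- of_real r - 1" "1 + w * of_real (exp a)"]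
      by (simp add: k'_def norm_mult)
    also have "\<dots> \<le> r * exp a * (c * (1 + exp a)) powr (- r - 1)"
      using bd[OF that, of "exp a"] n r by (intro mult_left_mono powr_mono2') auto
    also have "\<dots> = B * (exp a * (1 + exp a) powr (- r - 1))"
      by (simp add: B_def powr_mult)
    also have "exp a * (1 + exp a) powr (- r - 1) \<le> (1 + exp a) powr 1 * (1 + exp a) powr (- r - 1)"
      by (intro mult_right_mono) auto
    also have "\<dots> = (1 + exp a) powr (- r)" by (simp only: powr_add[symmetric]) simp
    also have "\<dots> \<le> 1"
      using r powr_mono2'[of "- r" 1 "1 + exp a"] by simp
    finally show ?thesis using r by (simp add: B_def mult_left_mono)
  qed
  have kb: "norm (k w a - k s a) \<le> B * norm (w - s)" if "w \<in> cball s \<delta>" for w a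
    by (rule field_differentiable_bound[of "cball s \<delta>" _ "\<lambda>w. k' w a"])
       (use kd k'b that c in \<open>auto intro: has_field_derivative_at_within\<close>)
  have k_meas: "k w \<in> borel_measurable borel" for w unfolding k_def[abs_def] by measurable
  have k'_meas: "k' w \<in> borel_measurable borel" for w unfolding k'_def[abs_def] by measurable
  note [measurable] = k_meas k'_meas
  have "((\<lambda>w. (stieltjes r g w - stieltjes r g s) / (w - s)) \<longlongrightarrow> stieltjes' r g s) (at s)"
    unfolding tendsto_at_iff_sequentially
  proof (intro allI impI)
    fix X :: "nat \<Rightarrow> complex"
    assume X: "\<forall>i. X i \<in> UNIV - {s}" and lim: "X \<longlonglongrightarrow> s"
    from lim c have "\<forall>\<^sub>F i in sequentially. X i \<in> ball s \<delta>"
      by (intro topological_tendstoD) auto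
    then obtain N where N: "\<And>i. N \<le> i \<Longrightarrow> X i \<in> ball s \<delta>"
      by (auto simp: eventually_sequentially)
    have Xs: "X i \<noteq> s" for i using X by auto
    have conv: "(\<lambda>i. \<integral>a. of_real (g a) * ((k (X (i + N)) a - k s a) / (X (i + N) - s)) \<partial>lborel)
      \<longlonglongrightarrow> (\<integral>a. of_real (g a) * k' s a \<partial>lborel)"
    proof (rule integral_dominated_convergence)
      show "integrable lborel (\<lambda>a. \<bar>g a\<bar> * B)" using g by simp
      show "AE a in lborel. (\<lambda>i. of_real (g a) * ((k (X (i + N)) a - k s a) / (X (i + N) - s)))
          \<longlonglongrightarrow> of_real (g a) * k' s a"
      proof (rule AE_I2)
        fix a
        have "((\<lambda>w. (k w a - k s a) / (w - s)) \<longlongrightarrow> k' s a) (at s)"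
          using kd[of s a] c by (simp add: has_field_derivative_iff)
        moreover have "filterlim (\<lambda>i. X (i + N)) (at s) sequentially"
          using LIMSEQ_ignore_initial_segment[OF lim] Xs by (auto simp: filterlim_at)
        ultimately have "(\<lambda>i. (k (X (i + N)) a - k s a) / (X (i + N) - s)) \<longlonglongrightarrow> k' s a"
          by (rule filterlim_compose)
        then show "(\<lambda>i. of_real (g a) * ((k (X (i + N)) a - k s a) / (X (i + N) - s)))
          \<longlonglongrightarrow> of_real (g a) * k' s a"
          by (rule tendsto_mult_left)
      qed
      fix i
      show "AE a in lborel. norm (of_real (g a) * ((k (X (i + N)) a - k s a) / (X (i + N) - s))) \<le> \<bar>g a\<bar> * B"
      proof (rule AE_I2)
        fix a
        have "norm ((k (X (i + N)) a - k s a) / (X (i + N) - s)) \<le> B"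
          using kb[of "X (i + N)" a] N[of "i + N"] Xs[of "i + N"]
          by (simp add: norm_divide pos_divide_le_eq)
        then show "norm (of_real (g a) * ((k (X (i + N)) a - k s a) / (X (i + N) - s))) \<le> \<bar>g a\<bar> * B"
          unfolding norm_mult norm_of_real by (rule mult_left_mono) simp
      qed
    qed measurable
    have quot: "(\<integral>a. of_real (g a) * ((k (X (i + N)) a - k s a) / (X (i + N) - s)) \<partial>lborel)
        = (stieltjes r g (X (i + N)) - stieltjes r g s) / (X (i + N) - s)" for i
    proof -
      have "X (i + N) \<notin> \<real>\<^sub>\<le>\<^sub>0" using N[of "i + N"] disj by (auto simp: disjoint_iff)
      then have i1: "integrable lborel (\<lambda>a. of_real (g a) * k (X (i + N)) a)"
        unfolding k_def using g r by (intro integrable_stieltjes)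
      have i2: "integrable lborel (\<lambda>a. of_real (g a) * k s a)"
        unfolding k_def using g r s by (intro integrable_stieltjes)
      have "(stieltjes r g (X (i + N)) - stieltjes r g s) / (X (i + N) - s)
         = (\<integral>a. of_real (g a) * k (X (i + N)) a - of_real (g a) * k s a \<partial>lborel) / (X (i + N) - s)"
        using i1 i2 by (simp add: stieltjes_def k_def[symmetric])
      also have "\<dots> = (\<integral>a. (of_real (g a) * k (X (i + N)) a - of_real (g a) * k s a) / (X (i + N) - s) \<partial>lborel)"
        by (rule integral_divide_zero[symmetric])
      finally show ?thesis by (simp add: right_diff_distrib diff_divide_distrib)
    qed
    have "(\<integral>a. of_real (g a) * k' s a \<partial>lborel) = stieltjes' r g s"
      by (simp add: stieltjes'_def k'_def)
    with conv have "(\<lambda>i. (stieltjes r g (X (i + N)) - stieltjes r g s) / (X (i + N) - s)) \<longlonglongrightarrow> stieltjes' r g s"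
      unfolding quot by simp
    then have "(\<lambda>i. (stieltjes r g (X i) - stieltjes r g s) / (X i - s)) \<longlonglongrightarrow> stieltjes' r g s"
      by (rule LIMSEQ_offset)
    then show "((\<lambda>w. (stieltjes r g w - stieltjes r g s) / (w - s)) \<circ> X) \<longlonglongrightarrow> stieltjes' r g s"
      by (simp add: o_def)
  qed
  then show ?thesis by (simp add: has_field_derivative_iff)
qed

lemma cnj_stieltjes:
  assumes "s \<notin> \<real>\<^sub>\<le>\<^sub>0"
  shows "stieltjes r g (cnj s) = cnj (stieltjes r g s)" and "stieltjes' r g (cnj s) = cnj (stieltjes' r g s)"
proof -
  have *: "cnj ((1 + s * of_real (exp a)) powr w) = (1 + cnj s * of_real (exp a)) powr cnj w" for a w
    using one_plus_mult_not_nonpos[OF assms, of "exp a"]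
    by (subst cnj_powr) (auto simp: complex_nonpos_Reals_iff)
  have "stieltjes r g (cnj s) = (\<integral>a. cnj (of_real (g a) * (1 + s * of_real (exp a)) powr (- of_real r)) \<partial>lborel)"
    unfolding stieltjes_def by (intro Bochner_Integration.integral_cong refl) (simp add: *)
  also have "\<dots> = cnj (stieltjes r g s)" unfolding stieltjes_def by (rule Bochner_Integration.integral_cnj)
  finally show "stieltjes r g (cnj s) = cnj (stieltjes r g s)" .
  have "stieltjes' r g (cnj s) = (\<integral>a. cnj (of_real (g a) * (- of_real r * of_real (exp a)
      * (1 + s * of_real (exp a)) powr (- of_real r - 1))) \<partial>lborel)"
    unfolding stieltjes'_def by (intro Bochner_Integration.integral_cong refl) (simp add: *)
  also have "\<dots> = cnj (stieltjes' r g s)" unfolding stieltjes'_def by (rule Bochner_Integration.integral_cnj)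
  finally show "stieltjes' r g (cnj s) = cnj (stieltjes' r g s)" .
qed

lemma stieltjes_of_real:
  assumes "0 < s"
  shows "stieltjes r g (of_real s) = of_real (\<integral>a. g a * (1 + s * exp a) powr (- r) \<partial>lborel)"
    and "stieltjes' r g (of_real s) = of_real (\<integral>a. g a * (- r * exp a * (1 + s * exp a) powr (- r - 1)) \<partial>lborel)"
proof -
  have *: "(1 + complex_of_real s * of_real (exp a)) powr (of_real w) = of_real ((1 + s * exp a) powr w)" for a w
    using assms powr_of_real[of "1 + s * exp a" w] by (simp add: add_nonneg_nonneg)
  show "stieltjes r g (of_real s) = of_real (\<integral>a. g a * (1 + s * exp a) powr (- r) \<partial>lborel)"
    unfolding stieltjes_def integral_complex_of_real[symmetric]
    by (intro Bochner_Integration.integral_cong refl) (use *[of _ "- r"] in simp)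
  show "stieltjes' r g (of_real s) = of_real (\<integral>a. g a * (- r * exp a * (1 + s * exp a) powr (- r - 1)) \<partial>lborel)"
    unfolding stieltjes'_def integral_complex_of_real[symmetric]
    by (intro Bochner_Integration.integral_cong refl) (use *[of _ "- r - 1"] in simp)
qed

lemma stieltjes_pos:
  fixes g :: "real \<Rightarrow> real" and r s :: real
  assumes g: "integrable lborel g" "\<And>a. 0 \<le> g a" "(\<integral>a. g a \<partial>lborel) = 1" and s: "0 \<le> s" and r: "0 < r"
  shows "0 < (\<integral>a. g a * (1 + s * exp a) powr (- r) \<partial>lborel)"
    and "integrable lborel (\<lambda>a. g a * (1 + s * exp a) powr (- r))"
proof -
  have [measurable]: "g \<in> borel_measurable lborel" using g by auto
  have le1: "(1 + s * exp a) powr (- r) \<le> 1" for a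
    using s r powr_mono2'[of "- r" 1 "1 + s * exp a"] by simp
  show int: "integrable lborel (\<lambda>a. g a * (1 + s * exp a) powr (- r))"
    by (rule Bochner_Integration.integrable_bound[OF g(1)])
       (use le1 g(2) in \<open>auto simp: abs_mult mult_left_le\<close>)
  have pos: "0 < (1 + s * exp a) powr (- r)" for a
    using s by (simp add: add_pos_nonneg less_imp_neq[symmetric])
  have "(\<integral>a. g a * (1 + s * exp a) powr (- r) \<partial>lborel) \<noteq> 0"
  proof
    assume "(\<integral>a. g a * (1 + s * exp a) powr (- r) \<partial>lborel) = 0"
    then have "AE a in lborel. g a * (1 + s * exp a) powr (- r) = 0"
      using int g(2) by (subst (asm) integral_nonneg_eq_0_iff_AE) auto
    then have "AE a in lborel. g a = 0"
      by eventually_elim (use pos in \<open>auto simp: less_imp_neq[symmetric]\<close>)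
    then have "(\<integral>a. g a \<partial>lborel) = (\<integral>a. 0 \<partial>(lborel :: real measure))"
      by (intro integral_cong_AE) auto
    then show False using g(3) by simp
  qed
  moreover have "0 \<le> (\<integral>a. g a * (1 + s * exp a) powr (- r) \<partial>lborel)"
    using g(2) by (intro Bochner_Integration.integral_nonneg) auto
  ultimately show "0 < (\<integral>a. g a * (1 + s * exp a) powr (- r) \<partial>lborel)" by simp
qed

text \<open>
  The density \<open>g\<close> of \<open>ln X\<close>. Hyperbolic monotonicity takes this form because
  \<open>g(a) = e\<^sup>a f(e\<^sup>a)\<close>; the factor \<open>K\<close> absorbs \<open>u\<^sup>2\<close> and spares a rescaling of the representing measure
  of \<open>h\<close>. In this form the condition is visibly invariant under \<open>a \<mapsto> - a\<close>.
\<close>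
locale hm_density =
  fixes g :: "real \<Rightarrow> real" and r :: real and k :: nat
  assumes g_int: "integrable lborel g" and g_nonneg: "\<And>a. 0 \<le> g a"
    and g_total: "(\<integral>a. g a \<partial>lborel) = 1"
    and g_meas [measurable]: "g \<in> borel_measurable borel"
    and r_pos: "0 < r" and r_le: "r \<le> real k"
    and HM: "\<And>p. \<exists>h K. 0 \<le> K \<and> (\<forall>q. g (p + q) * g (p - q) = K * h (2 * cosh q)) \<and> decreasing_of_order k h"
begin

definition L :: "real \<Rightarrow> real" where
  "L s = (\<integral>a. g a * (1 + s * exp a) powr (- r) \<partial>lborel)"

definition L' :: "real \<Rightarrow> real" where
  "L' s = (\<integral>a. g a * (- r * exp a * (1 + s * exp a) powr (- r - 1)) \<partial>lborel)"

definition \<psi> :: "complex \<Rightarrow> complex" where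
  "\<psi> s = - s * stieltjes' r g s / stieltjes r g s"

lemma L_pos: "0 \<le> s \<Longrightarrow> 0 < L s"
  unfolding L_def using stieltjes_pos(1) g_int g_nonneg g_total r_pos by blast

lemma stieltjes_L: "0 < s \<Longrightarrow> stieltjes r g (of_real s) = of_real (L s)"
  and stieltjes'_L': "0 < s \<Longrightarrow> stieltjes' r g (of_real s) = of_real (L' s)"
  unfolding L_def L'_def by (rule stieltjes_of_real; simp)+

lemma stieltjes_nonzero:
  assumes s: "s \<notin> \<real>\<^sub>\<le>\<^sub>0"
  shows "stieltjes r g s \<noteq> 0"
proof -
  have upper: "stieltjes r g z \<noteq> 0" if "z \<notin> \<real>\<^sub>\<le>\<^sub>0" "0 \<le> Im z" for z
  proof -
    define c where "c = Re (Ln z)"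
    define t where "t = Im (Ln z)"
    have nz: "z \<noteq> 0" using that by auto
    have "Complex c t = Ln z" unfolding c_def t_def by (rule complex_surj)
    then have z: "z = exp (Complex c t)" using nz by simp
    have t: "0 \<le> t" "t < pi"
      using Im_Ln_pos_le[OF nz] Im_Ln_less_pi[OF that(1)] that(2) by (auto simp: t_def)
    have e: "exp (Complex c 0) = of_real (exp c)" by (simp add: complex_eq_iff Re_exp Im_exp)
    have "norm (stieltjes r g (exp (Complex c 0))) = L (exp c)"
      unfolding e stieltjes_L[OF exp_gt_zero] norm_of_real using L_pos[of "exp c"] by simp
    moreover have "norm (stieltjes r g (exp (Complex c 0))) \<le> norm (stieltjes r g z)"
      unfolding z using g_int g_nonneg r_pos r_le HM t
      by (intro norm_stieltjes_mono[where k=k]) auto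
    ultimately show ?thesis using L_pos[of "exp c"] by auto
  qed
  show ?thesis
  proof (cases "0 \<le> Im s")
    case True then show ?thesis using upper s by simp
  next
    case False
    then have "stieltjes r g (cnj s) \<noteq> 0" using s by (intro upper) (auto simp: complex_nonpos_Reals_iff)
    then show ?thesis using cnj_stieltjes(1)[OF s] by auto
  qed
qed

text \<open>
  Half the derivative of \<open>|\<phi>(e\<^sup>c\<^sup>+\<^sup>i\<^sup>t)|\<^sup>2\<close> in \<open>t\<close> is \<open>|\<phi>|\<^sup>2 Im \<psi>\<close>.
\<close>
lemma Im_\<psi>_nonneg:
  assumes s: "0 < Im s"
  shows "0 \<le> Im (\<psi> s)"
proof -
  define c where "c = Re (Ln s)"
  define \<theta> where "\<theta> = Im (Ln s)"
  have nz: "s \<noteq> 0" using s by auto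
  have "Complex c \<theta> = Ln s" unfolding c_def \<theta>_def by (rule complex_surj)
  then have se: "s = exp (Complex c \<theta>)" using nz by simp
  have \<theta>: "0 < \<theta>" "\<theta> < pi" using Im_Ln_pos_lt_imp[OF s] by (auto simp: \<theta>_def)
  have snp: "s \<notin> \<real>\<^sub>\<le>\<^sub>0" using s by (auto simp: complex_nonpos_Reals_iff)
  define F where "F t = stieltjes r g (exp (Complex c t))" for t
  define z where "z = s * stieltjes' r g s"
  have "((\<lambda>t. Complex c t) has_vector_derivative \<i>) (at \<theta>)"
    unfolding Complex_eq by (auto intro!: derivative_eq_intros simp: scaleR_conv_of_real)
  moreover have "((stieltjes r g \<circ> exp) has_field_derivative stieltjes' r g s * s) (at (Complex c \<theta>))"
  proof (rule DERIV_chain)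
    show "(stieltjes r g has_field_derivative stieltjes' r g s) (at (exp (Complex c \<theta>)))"
      unfolding se[symmetric] using g_int r_pos snp by (rule has_field_derivative_stieltjes)
    show "(exp has_field_derivative s) (at (Complex c \<theta>))"
      using DERIV_exp[of "Complex c \<theta>"] by (simp add: se[symmetric])
  qed
  ultimately have "((stieltjes r g \<circ> exp) \<circ> (\<lambda>t. Complex c t) has_vector_derivative \<i> * (stieltjes' r g s * s)) (at \<theta>)"
    by (rule field_vector_diff_chain_at)
  then have F': "(F has_vector_derivative \<i> * z) (at \<theta>)"
    by (simp add: F_def[abs_def] o_def z_def mult.commute)
  have Fs: "F \<theta> = stieltjes r g s" by (simp add: F_def se[symmetric])
  have "((\<lambda>t. Re (F t)) has_real_derivative - Im z) (at \<theta>)"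
    "((\<lambda>t. Im (F t)) has_real_derivative Re z) (at \<theta>)"
    using F' by (simp_all add: has_vector_derivative_complex_iff)
  moreover have "((\<lambda>t. (P t)\<^sup>2 + (Q t)\<^sup>2) has_real_derivative 2 * P \<theta> * P' + 2 * Q \<theta> * Q') (at \<theta>)"
    if "(P has_real_derivative P') (at \<theta>)" "(Q has_real_derivative Q') (at \<theta>)" for P Q P' Q'
    using that by (auto intro!: derivative_eq_intros)
  ultimately have deriv: "((\<lambda>t. (Re (F t))\<^sup>2 + (Im (F t))\<^sup>2) has_real_derivative
      2 * Re (F \<theta>) * (- Im z) + 2 * Im (F \<theta>) * Re z) (at \<theta>)"
    by blast
  have mono: "mono_on {0..<pi} (\<lambda>t. (Re (F t))\<^sup>2 + (Im (F t))\<^sup>2)"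
  proof (rule mono_onI)
    fix u v assume "u \<in> {0..<pi}" "v \<in> {0..<pi}" "u \<le> v"
    then have "norm (F u) \<le> norm (F v)"
      unfolding F_def using g_int g_nonneg r_pos r_le HM
      by (intro norm_stieltjes_mono[where k=k]) auto
    then show "(Re (F u))\<^sup>2 + (Im (F u))\<^sup>2 \<le> (Re (F v))\<^sup>2 + (Im (F v))\<^sup>2"
      unfolding cmod_power2[symmetric] by (intro power_mono) auto
  qed
  have "0 \<le> 2 * Re (F \<theta>) * (- Im z) + 2 * Im (F \<theta>) * Re z"
    by (rule mono_on_imp_deriv_nonneg[OF mono deriv]) (use \<theta> in simp)
  then have "0 \<le> - (Im z * Re (stieltjes r g s) - Re z * Im (stieltjes r g s))"
    unfolding Fs by (simp add: algebra_simps)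
  moreover have "Im (\<psi> s) = - (Im z * Re (stieltjes r g s) - Re z * Im (stieltjes r g s)) / (norm (stieltjes r g s))\<^sup>2"
  proof -
    have "\<psi> s = - (z / stieltjes r g s)" by (simp add: \<psi>_def z_def)
    then show ?thesis by (simp add: Im_divide cmod_power2 diff_divide_distrib)
  qed
  ultimately show ?thesis by simp
qed

lemma cnj_\<psi>: "s \<notin> \<real>\<^sub>\<le>\<^sub>0 \<Longrightarrow> \<psi> (cnj s) = cnj (\<psi> s)"
  by (simp add: \<psi>_def cnj_stieltjes)

lemma Im_\<psi>_sign:
  assumes s: "s \<notin> \<real>\<^sub>\<le>\<^sub>0"
  shows "0 \<le> Im s \<Longrightarrow> 0 \<le> Im (\<psi> s)" and "Im s \<le> 0 \<Longrightarrow> Im (\<psi> s) \<le> 0"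
proof -
  have real: "Im (\<psi> s) = 0" if "Im s = 0"
  proof -
    have "cnj s = s" using that by (simp add: complex_eq_iff)
    then have "\<psi> s = cnj (\<psi> s)" using cnj_\<psi>[OF s] by simp
    then show ?thesis by (metis Im_complex_of_real Reals_cnj_iff Reals_cases)
  qed
  show "0 \<le> Im (\<psi> s)" if "0 \<le> Im s"
    using that Im_\<psi>_nonneg[of s] real by (cases "Im s = 0") auto
  show "Im (\<psi> s) \<le> 0" if "Im s \<le> 0"
  proof (cases "Im s = 0")
    case False
    then have "0 \<le> Im (\<psi> (cnj s))" using that by (intro Im_\<psi>_nonneg) simp
    then show ?thesis using cnj_\<psi>[OF s] by simp
  qed (use real in simp)
qed

lemma \<psi>_holomorphic: "\<psi> holomorphic_on (- \<real>\<^sub>\<le>\<^sub>0)"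
proof -
  have op: "open (- \<real>\<^sub>\<le>\<^sub>0 :: complex set)" by (simp add: open_Compl)
  have d: "(stieltjes r g has_field_derivative stieltjes' r g s) (at s)" if "s \<in> - \<real>\<^sub>\<le>\<^sub>0" for s
    using that g_int r_pos by (intro has_field_derivative_stieltjes) auto
  have h: "stieltjes r g holomorphic_on (- \<real>\<^sub>\<le>\<^sub>0)"
    using d by (auto simp: holomorphic_on_open[OF op])
  have "stieltjes' r g holomorphic_on (- \<real>\<^sub>\<le>\<^sub>0)"
    by (rule holomorphic_transform[OF holomorphic_deriv[OF h op]]) (use d DERIV_imp_deriv in blast)
  then show ?thesis
    unfolding \<psi>_def[abs_def] using h stieltjes_nonzero by (intro holomorphic_intros) auto
qed

text \<open>
  The restriction of \<open>\<psi>\<close> to the positive half-line.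
\<close>
definition V :: "real \<Rightarrow> real" where
  "V s = - s * L' s / L s"

lemma \<psi>_V: "0 < s \<Longrightarrow> \<psi> (of_real s) = of_real (V s)"
  by (simp add: \<psi>_def stieltjes_L stieltjes'_L' V_def)

text \<open>
  The map \<open>z \<mapsto> ((1 + z) / (1 - z))\<^sup>2\<close> carries the unit disc onto the plane without the negative
  half-line and respects the upper and lower halves. It sends \<open>(\<surd>s - 1) / (\<surd>s + 1)\<close> to \<open>s\<close>, which turns
  the kernel of the representation on the disc into the one below.
\<close>
lemma V_representation:
  obtains \<nu> :: "real measure" where "finite_measure \<nu>" "sets \<nu> = sets borel"
    "AE c in \<nu>. c \<in> {-1..1}"
    "\<And>s. 0 < s \<Longrightarrow> V s - V 1 = (\<integral>c. (s - 1) / (2 * ((1 - c) * s + (1 + c))) \<partial>\<nu>)"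
proof -
  define m where "m z = ((1 + z) / (1 - z))\<^sup>2" for z :: complex
  have nz: "1 - z \<noteq> 0" if "norm z < 1" for z :: complex using that by auto
  have quot: "(1 + z) / (1 - z) = Complex ((1 - (norm z)\<^sup>2) / (norm (1 - z))\<^sup>2) (2 * Im z / (norm (1 - z))\<^sup>2)"
    for z :: complex
    unfolding cmod_power2
    by (simp add: complex_eq_iff Re_divide Im_divide power2_eq_square algebra_simps)
  have m_not: "m z \<notin> \<real>\<^sub>\<le>\<^sub>0" and m_Im: "\<exists>q>0. Im (m z) = q * Im z" if z: "norm z < 1" for z
  proof -
    have "(norm z)\<^sup>2 < 1" using z by (simp add: power_less_one_iff abs_square_less_1)
    then have pos: "0 < (1 - (norm z)\<^sup>2) / (norm (1 - z))\<^sup>2" using nz[OF z] by simp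
    have Im_m: "Im (m z) = 2 * ((1 - (norm z)\<^sup>2) / (norm (1 - z))\<^sup>2) * (2 * Im z / (norm (1 - z))\<^sup>2)"
      unfolding m_def quot by (simp add: Im_power2)
    then have "Im (m z) = (2 * ((1 - (norm z)\<^sup>2) / (norm (1 - z))\<^sup>2) * (2 / (norm (1 - z))\<^sup>2)) * Im z"
      by simp
    moreover have "0 < 2 * ((1 - (norm z)\<^sup>2) / (norm (1 - z))\<^sup>2) * (2 / (norm (1 - z))\<^sup>2)"
      using pos nz[OF z] by (intro mult_pos_pos) auto
    ultimately show ex: "\<exists>q>0. Im (m z) = q * Im z" by blast
    show "m z \<notin> \<real>\<^sub>\<le>\<^sub>0"
    proof
      assume "m z \<in> \<real>\<^sub>\<le>\<^sub>0"
      then have *: "Re (m z) \<le> 0" "Im (m z) = 0" by (auto simp: complex_nonpos_Reals_iff)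
      then have "Im z = 0" using ex by auto
      then have "Re (m z) = ((1 - (norm z)\<^sup>2) / (norm (1 - z))\<^sup>2)\<^sup>2"
        unfolding m_def quot by (simp add: Re_power2)
      then show False using *(1) pos by (metis not_le zero_less_power)
    qed
  qed
  have "(\<psi> \<circ> m) holomorphic_on ball 0 1"
  proof (rule holomorphic_on_compose_gen[OF _ \<psi>_holomorphic])
    show "m holomorphic_on ball 0 1"
      unfolding m_def[abs_def] using nz by (intro holomorphic_intros) auto
    show "m ` ball 0 1 \<subseteq> - \<real>\<^sub>\<le>\<^sub>0" using m_not by auto
  qed
  then have hol: "(\<lambda>z. \<psi> (m z)) holomorphic_on ball 0 1" by (simp add: o_def)
  have upper: "0 \<le> Im (\<psi> (m z))" if "norm z < 1" "0 \<le> Im z" for z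
    using that m_Im[OF that(1)] by (intro Im_\<psi>_sign m_not) auto
  have lower: "Im (\<psi> (m z)) \<le> 0" if "norm z < 1" "Im z \<le> 0" for z
    using that m_Im[OF that(1)] by (intro Im_\<psi>_sign(2) m_not) (auto simp: mult_le_0_iff)
  obtain \<nu> :: "real measure" where \<nu>: "finite_measure \<nu>" "sets \<nu> = sets borel" "AE c in \<nu>. c \<in> {-1..1}"
    and rep: "\<And>x. \<bar>x\<bar> < 1 \<Longrightarrow> Re (\<psi> (m (of_real x))) - Re (\<psi> (m 0)) = (\<integral>c. x / (1 - 2 * x * c + x\<^sup>2) \<partial>\<nu>)"
    using typically_real_representation[OF hol upper lower] by metis
  show thesis
  proof (rule that[OF \<nu>])
    fix s :: real assume s: "0 < s"
    define q where "q = sqrt s"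
    have q: "0 < q" "q\<^sup>2 = s" using s by (auto simp: q_def)
    define x where "x = (q - 1) / (q + 1)"
    have x: "\<bar>x\<bar> < 1" using q by (auto simp: x_def abs_if field_simps)
    have "(1 + x) / (1 - x) = q" using q by (simp add: x_def field_simps)
    then have "complex_of_real ((1 + x) / (1 - x)) = of_real q" by simp
    then have "m (of_real x) = of_real s"
      unfolding m_def q(2)[symmetric] by simp
    moreover have "m 0 = of_real 1" by (simp add: m_def)
    ultimately have "V s - V 1 = (\<integral>c. x / (1 - 2 * x * c + x\<^sup>2) \<partial>\<nu>)"
      using rep[OF x] \<psi>_V[OF s] \<psi>_V[of 1] by simp
    also have "\<dots> = (\<integral>c. (s - 1) / (2 * ((1 - c) * s + (1 + c))) \<partial>\<nu>)"
    proof (intro Bochner_Integration.integral_cong refl)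
      fix c
      have "x / (1 - 2 * x * c + x\<^sup>2) = (x * (q + 1)\<^sup>2) / ((1 - 2 * x * c + x\<^sup>2) * (q + 1)\<^sup>2)"
        using q by simp
      also have "x * (q + 1)\<^sup>2 = s - 1"
        using q by (simp add: x_def power2_eq_square field_simps flip: q(2))
      also have "(1 - 2 * x * c + x\<^sup>2) * (q + 1)\<^sup>2 = (q + 1)\<^sup>2 - 2 * c * (x * (q + 1)\<^sup>2) + (x * (q + 1))\<^sup>2"
        by (simp add: power2_eq_square algebra_simps)
      also have "x * (q + 1)\<^sup>2 = s - 1"
        using q by (simp add: x_def power2_eq_square field_simps flip: q(2))
      also have "x * (q + 1) = q - 1" using q by (simp add: x_def)
      also have "(q + 1)\<^sup>2 - 2 * c * (s - 1) + (q - 1)\<^sup>2 = 2 * ((1 - c) * s + (1 + c))"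
        unfolding q(2)[symmetric] by (simp add: power2_eq_square algebra_simps)
      finally show "x / (1 - 2 * x * c + x\<^sup>2) = (s - 1) / (2 * ((1 - c) * s + (1 + c)))" .
    qed
    finally show "V s - V 1 = (\<integral>c. (s - 1) / (2 * ((1 - c) * s + (1 + c))) \<partial>\<nu>)" .
  qed
qed

end

section \<open>The Thorin measure\<close>

text \<open>
  All conditions on a Thorin measure follow from finiteness of \<open>\<integral> ln (1 + 1 / t) U(dt)\<close>: the
  integrand is bounded below on compact subsets of \<open>(0, \<infinity>)\<close>, dominates \<open>|ln t|\<close> on
  \<open>(0, 1)\<close>, and is at least \<open>1 / (1 + t) \<ge> 1 / (2 t)\<close> on \<open>(1, \<infinity>)\<close>.
\<close>
lemma thorin_measure_conditions:
  fixes U :: "real measure" and l :: "real \<Rightarrow> real"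
  assumes [measurable_cong]: "sets U = sets borel" and U0: "emeasure U {..0} = 0" and a: "0 \<le> a"
    and l: "\<And>s. 0 < s \<Longrightarrow> ennreal (l s) = ennreal (a * s) + (\<integral>\<^sup>+t\<in>{0<..}. ennreal (ln (1 + s / t)) \<partial>U)"
    and l_nonneg: "\<And>s. 0 < s \<Longrightarrow> 0 \<le> l s"
  shows "compact K \<Longrightarrow> K \<subseteq> {0<..} \<Longrightarrow> emeasure U K < \<infinity>"
    and "(\<integral>\<^sup>+t\<in>{0<..<1}. ennreal \<bar>ln t\<bar> \<partial>U) < \<infinity>"
    and "(\<integral>\<^sup>+t\<in>{1<..}. ennreal (1 / t) \<partial>U) < \<infinity>"
    and "0 < s \<Longrightarrow> l s = a * s - (LINT t:{0<..}|U. ln (t / (t + s)))"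
proof -
  have lnpos: "0 \<le> ln (1 + s / t)" if "0 < s" "0 < t" for s t :: real
    using that by (intro ln_ge_zero) auto
  let ?I = "\<lambda>s. \<integral>\<^sup>+t\<in>{0<..}. ennreal (ln (1 + s / t)) \<partial>U"
  have fin: "?I s < \<infinity>" if "0 < s" for s
  proof -
    have "?I s \<le> ennreal (l s)" unfolding l[OF that] by simp
    then show ?thesis using le_less_trans by fastforce
  qed
  show "emeasure U K < \<infinity>" if K: "compact K" "K \<subseteq> {0<..}"
  proof -
    obtain b where b: "\<And>x. x \<in> K \<Longrightarrow> norm x \<le> b" "0 < b"
      using compact_imp_bounded[OF K(1)] by (auto simp: bounded_pos)
    have [measurable]: "K \<in> sets borel" using K(1) by (intro borel_compact)
    define \<kappa> where "\<kappa> = ln (1 + 1 / b)"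
    have \<kappa>: "0 < \<kappa>" using b(2) by (simp add: \<kappa>_def ln_gt_zero)
    have "ennreal \<kappa> * emeasure U K = (\<integral>\<^sup>+t. ennreal \<kappa> * indicator K t \<partial>U)"
      by (rule nn_integral_cmult_indicator[symmetric]) simp
    also have "\<dots> \<le> ?I 1"
    proof (rule nn_integral_mono)
      fix t :: real
      show "ennreal \<kappa> * indicator K t \<le> ennreal (ln (1 + 1 / t)) * indicator {0<..} t"
      proof (cases "t \<in> K")
        case True
        then have t: "0 < t" "t \<le> b" using K(2) b(1)[OF True] by auto
        then have "1 / b \<le> 1 / t" by (intro divide_left_mono) auto
        then have "\<kappa> \<le> ln (1 + 1 / t)" unfolding \<kappa>_def using b(2) t
          by (subst ln_le_cancel_iff) (auto intro: add_pos_pos)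
        then show ?thesis using True t by (simp add: ennreal_leI)
      qed simp
    qed
    also have "\<dots> < \<infinity>" by (rule fin) simp
    finally have "ennreal \<kappa> * emeasure U K < \<infinity>" .
    then show ?thesis using \<kappa> by (auto simp: ennreal_mult_less_top)
  qed
  have "(\<integral>\<^sup>+t\<in>{0<..<1}. ennreal \<bar>ln t\<bar> \<partial>U) \<le> ?I 1"
  proof (rule nn_integral_mono)
    fix t :: real
    show "ennreal \<bar>ln t\<bar> * indicator {0<..<1} t \<le> ennreal (ln (1 + 1 / t)) * indicator {0<..} t"
    proof (cases "0 < t \<and> t < 1")
      case True
      then have "ln (1 / t) \<le> ln (1 + 1 / t)" by (subst ln_le_cancel_iff) (auto intro: add_pos_pos)
      then have "\<bar>ln t\<bar> \<le> ln (1 + 1 / t)" using True by (simp add: ln_div)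
      then show ?thesis using True by (simp add: ennreal_leI)
    qed auto
  qed
  then show "(\<integral>\<^sup>+t\<in>{0<..<1}. ennreal \<bar>ln t\<bar> \<partial>U) < \<infinity>"
    using fin[of 1] by (auto intro: le_less_trans)
  have "(\<integral>\<^sup>+t\<in>{1<..}. ennreal (1 / t) \<partial>U) \<le> (\<integral>\<^sup>+t. 2 * (ennreal (ln (1 + 1 / t)) * indicator {0<..} t) \<partial>U)"
  proof (rule nn_integral_mono)
    fix t :: real
    show "ennreal (1 / t) * indicator {1<..} t \<le> 2 * (ennreal (ln (1 + 1 / t)) * indicator {0<..} t)"
    proof (cases "1 < t")
      case True
      have "1 / (t + 1) \<le> ln (1 + 1 / t)"
      proof -
        have "ln (t / (t + 1)) \<le> t / (t + 1) - 1" using True by (intro ln_le_minus_one) auto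
        moreover have "ln (t / (t + 1)) = - ln (1 + 1 / t)"
        proof -
          have "1 + 1 / t = (t + 1) / t" using True by (simp add: field_simps)
          then show ?thesis using True by (simp add: ln_div)
        qed
        moreover have "t / (t + 1) - 1 = - (1 / (t + 1))" using True by (simp add: field_simps)
        ultimately show ?thesis by simp
      qed
      moreover have "1 / t \<le> 2 * (1 / (t + 1))" using True by (simp add: field_simps)
      ultimately have "1 / t \<le> 2 * ln (1 + 1 / t)" by linarith
      then have "ennreal (1 / t) \<le> ennreal (2 * ln (1 + 1 / t))" by (rule ennreal_leI)
      also have "\<dots> = 2 * ennreal (ln (1 + 1 / t))" using lnpos[of 1 t] True by (simp add: ennreal_mult')
      finally show ?thesis using True by simp
    qed simp
  qed
  also have "\<dots> = 2 * ?I 1" by (rule nn_integral_cmult) simp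
  also have "\<dots> < \<infinity>" using fin[of 1] by (simp add: ennreal_mult_less_top)
  finally show "(\<integral>\<^sup>+t\<in>{1<..}. ennreal (1 / t) \<partial>U) < \<infinity>" .
  show "l s = a * s - (LINT t:{0<..}|U. ln (t / (t + s)))" if s: "0 < s"
  proof -
    have "(LINT t:{0<..}|U. ln (t / (t + s))) = - (\<integral>t. indicator {0<..} t * ln (1 + s / t) \<partial>U)"
    proof -
      have "indicator {0<..} t *\<^sub>R ln (t / (t + s)) = - (indicator {0<..} t * ln (1 + s / t))" for t
      proof (cases "0 < t")
        case True
        have "1 + s / t = (t + s) / t" using True by (simp add: field_simps)
        then show ?thesis using True s by (simp add: ln_div)
      qed simp
      then show ?thesis unfolding set_lebesgue_integral_def by simp
    qed
    also have "(\<integral>t. indicator {0<..} t * ln (1 + s / t) \<partial>U) = enn2real (?I s)"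
    proof -
      have "(\<integral>t. indicator {0<..} t * ln (1 + s / t) \<partial>U)
          = enn2real (\<integral>\<^sup>+t. ennreal (indicator {0<..} t * ln (1 + s / t)) \<partial>U)"
        using lnpos[OF s] by (intro integral_eq_nn_integral) (auto split: split_indicator)
      also have "(\<integral>\<^sup>+t. ennreal (indicator {0<..} t * ln (1 + s / t)) \<partial>U) = ?I s"
        by (intro nn_integral_cong) (auto split: split_indicator)
      finally show ?thesis .
    qed
    also have "enn2real (?I s) = l s - a * s"
    proof -
      obtain i where i: "?I s = ennreal i" "0 \<le> i"
        using fin[OF s] by (cases "?I s") auto
      have "ennreal (l s) = ennreal (a * s + i)" using l[OF s] i a s by simp
      then have "l s = a * s + i" using l_nonneg[OF s] i a s by (subst (asm) ennreal_inj) auto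
      then show ?thesis using i by simp
    qed
    finally show ?thesis by simp
  qed
qed

context hm_density begin

lemma L_0: "L 0 = 1"
  using g_total by (simp add: L_def)

lemma L_le_1: "0 \<le> s \<Longrightarrow> L s \<le> 1"
proof -
  assume s: "0 \<le> s"
  have "L s \<le> (\<integral>a. g a \<partial>lborel)"
    unfolding L_def
  proof (rule integral_mono)
    show "integrable lborel (\<lambda>a. g a * (1 + s * exp a) powr - r)"
      using stieltjes_pos(2) g_int g_nonneg g_total r_pos s by blast
    show "g a * (1 + s * exp a) powr - r \<le> g a" for a
      using s r_pos powr_mono2'[of "- r" 1 "1 + s * exp a"] g_nonneg[of a] by (simp add: mult_left_le)
  qed (rule g_int)
  then show ?thesis using g_total by simp
qed

lemma L_deriv: "0 < s \<Longrightarrow> (L has_real_derivative L' s) (at s)"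
proof -
  assume s: "0 < s"
  have "complex_of_real s \<notin> \<real>\<^sub>\<le>\<^sub>0" using s by (auto simp: complex_nonpos_Reals_iff)
  then have "(stieltjes r g has_field_derivative of_real (L' s)) (at (of_real s))"
    using has_field_derivative_stieltjes[OF g_int r_pos, of "of_real s"] stieltjes'_L'[OF s] by simp
  then have "((\<lambda>x. stieltjes r g (of_real x)) has_vector_derivative of_real (L' s)) (at s)"
    by (rule has_vector_derivative_real_field)
  then have "((\<lambda>x. Re (stieltjes r g (of_real x))) has_real_derivative L' s) (at s)"
    by (simp add: has_vector_derivative_complex_iff)
  then show ?thesis
    by (rule has_field_derivative_transform_within_open[where S="{0<..}"]) (use s stieltjes_L in auto)
qed

lemma L_tendsto:
  assumes e: "\<And>n. 0 \<le> e n" "e \<longlonglongrightarrow> 0"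
  shows "(\<lambda>n. L (e n)) \<longlonglongrightarrow> 1"
proof -
  have "(\<lambda>n. L (e n)) \<longlonglongrightarrow> (\<integral>a. g a \<partial>lborel)"
    unfolding L_def
  proof (rule integral_dominated_convergence)
    show "integrable lborel g" by (rule g_int)
    show "AE a in lborel. (\<lambda>n. g a * (1 + e n * exp a) powr - r) \<longlonglongrightarrow> g a"
    proof (rule AE_I2)
      fix a
      have "(\<lambda>n. g a * (1 + e n * exp a) powr - r) \<longlonglongrightarrow> g a * (1 + 0 * exp a) powr - r"
        by (intro tendsto_intros e) simp_all
      then show "(\<lambda>n. g a * (1 + e n * exp a) powr - r) \<longlonglongrightarrow> g a" by simp
    qed
    show "AE a in lborel. norm (g a * (1 + e n * exp a) powr - r) \<le> g a" for n
      using e(1)[of n] r_pos powr_mono2'[of "- r" 1 "1 + e n * exp _"] g_nonneg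
      by (auto simp: abs_mult intro!: mult_left_le)
  qed simp_all
  then show ?thesis using g_total by simp
qed

lemma L'_kernel_bound: "0 \<le> s \<Longrightarrow> s * (exp a * (1 + s * exp a) powr (- r - 1)) \<le> 1"
proof -
  assume s: "0 \<le> s"
  have "s * (exp a * (1 + s * exp a) powr (- r - 1)) = (s * exp a) * (1 + s * exp a) powr (- r - 1)" by simp
  also have "\<dots> \<le> (1 + s * exp a) powr 1 * (1 + s * exp a) powr (- r - 1)"
    using s by (intro mult_right_mono) auto
  also have "\<dots> = (1 + s * exp a) powr (- r)" by (simp only: powr_add[symmetric]) simp
  also have "\<dots> \<le> 1" using s r_pos powr_mono2'[of "- r" 1 "1 + s * exp a"] by simp
  finally show ?thesis .
qed

lemma L'_nonpos: "L' s \<le> 0"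
proof -
  have "0 \<le> (\<integral>a. - (g a * (- r * exp a * (1 + s * exp a) powr (- r - 1))) \<partial>lborel)"
    using g_nonneg r_pos by (intro Bochner_Integration.integral_nonneg) (simp add: mult_nonneg_nonneg)
  then show ?thesis unfolding L'_def by simp
qed

lemma V_nonneg: "0 < s \<Longrightarrow> 0 \<le> V s"
  using L'_nonpos[of s] L_pos[of s] by (simp add: V_def divide_nonpos_pos mult_nonneg_nonpos)

lemma V_tendsto_0:
  assumes e: "\<And>n. 0 < e n" "e \<longlonglongrightarrow> 0"
  shows "(\<lambda>n. V (e n)) \<longlonglongrightarrow> 0"
proof -
  have "(\<lambda>n. \<integral>a. r * g a * (e n * (exp a * (1 + e n * exp a) powr (- r - 1))) \<partial>lborel)
      \<longlonglongrightarrow> (\<integral>a. 0 \<partial>(lborel :: real measure))"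
  proof (rule integral_dominated_convergence)
    show "integrable lborel (\<lambda>a. r * g a)" using g_int by simp
    show "AE a in lborel. (\<lambda>n. r * g a * (e n * (exp a * (1 + e n * exp a) powr (- r - 1)))) \<longlonglongrightarrow> 0"
    proof (rule AE_I2)
      fix a
      have "(\<lambda>n. r * g a * (e n * (exp a * (1 + e n * exp a) powr (- r - 1))))
          \<longlonglongrightarrow> r * g a * (0 * (exp a * (1 + 0 * exp a) powr (- r - 1)))"
        by (intro tendsto_intros e) simp_all
      then show "(\<lambda>n. r * g a * (e n * (exp a * (1 + e n * exp a) powr (- r - 1)))) \<longlonglongrightarrow> 0" by simp
    qed
    fix n
    show "AE a in lborel. norm (r * g a * (e n * (exp a * (1 + e n * exp a) powr (- r - 1)))) \<le> r * g a"
    proof (rule AE_I2)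
      fix a
      have "0 \<le> r * g a" "0 \<le> e n * (exp a * (1 + e n * exp a) powr (- r - 1))"
        using r_pos g_nonneg[of a] e(1)[of n] by auto
      then show "norm (r * g a * (e n * (exp a * (1 + e n * exp a) powr (- r - 1)))) \<le> r * g a"
      proof -
        have "\<bar>x * y\<bar> \<le> x" if "0 \<le> x" "0 \<le> y" "y \<le> 1" for x y :: real
          using that by (simp add: mult_left_le)
        from this[OF \<open>0 \<le> r * g a\<close> \<open>0 \<le> e n * _\<close> L'_kernel_bound[of "e n" a]] e(1)[of n]
        show ?thesis by simp
      qed
    qed
  qed simp_all
  moreover have "(\<integral>a. r * g a * (s * (exp a * (1 + s * exp a) powr (- r - 1))) \<partial>lborel) = - s * L' s" for s
  proof -
    have "(\<integral>a. r * g a * (s * (exp a * (1 + s * exp a) powr (- r - 1))) \<partial>lborel)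
      = (\<integral>a. (- s) * (g a * (- r * exp a * (1 + s * exp a) powr (- r - 1))) \<partial>lborel)"
      by (simp add: mult_ac)
    also have "\<dots> = - s * L' s" unfolding L'_def by (rule integral_mult_right_zero)
    finally show ?thesis .
  qed
  ultimately have "(\<lambda>n. - e n * L' (e n)) \<longlonglongrightarrow> 0" by simp
  then have "(\<lambda>n. - e n * L' (e n) / L (e n)) \<longlonglongrightarrow> 0 / 1"
    using e by (intro tendsto_divide L_tendsto) (auto intro: less_imp_le)
  then show ?thesis by (simp add: V_def)
qed

end

text \<open>
  The primitive in \<open>s\<close>, vanishing at \<open>0\<close>, of \<open>1 / ((1 + c) ((1 - c) s + (1 + c)))\<close>. For \<open>c < 1\<close> it is
  \<open>ln (1 + s / t) / (1 - c\<^sup>2)\<close> with \<open>t = (1 + c) / (1 - c)\<close>; the case \<open>c = 1\<close> corresponds to \<open>t = \<infinity>\<close>.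
\<close>
definition thorin_primitive :: "real \<Rightarrow> real \<Rightarrow> real" where
  "thorin_primitive c s = (if c = 1 then s / 4
     else ln (1 + s * (1 - c) / (1 + c)) / ((1 - c) * (1 + c)))"

lemma measurable_thorin_primitive [measurable]: "(\<lambda>c. thorin_primitive c s) \<in> borel_measurable borel"
  unfolding thorin_primitive_def by measurable

lemma thorin_primitive_0 [simp]: "thorin_primitive c 0 = 0"
  by (simp add: thorin_primitive_def)

lemma thorin_primitive_deriv:
  assumes c: "-1 < c" "c \<le> 1" and s: "0 \<le> s"
  shows "(thorin_primitive c has_real_derivative 1 / ((1 + c) * ((1 - c) * s + (1 + c)))) (at s)"
proof (cases "c = 1")
  case True
  then show ?thesis unfolding thorin_primitive_def[abs_def] by (auto intro!: derivative_eq_intros)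
next
  case False
  have "0 \<le> s * (1 - c) / (1 + c)" using c s by simp
  then have pos: "0 < 1 + s * (1 - c) / (1 + c)" by linarith
  have nz: "1 + c \<noteq> 0" "1 - c \<noteq> 0" "(1 - c) * s + (1 + c) \<noteq> 0"
  proof -
    have "0 \<le> (1 - c) * s" using c s by simp
    then show "1 + c \<noteq> 0" "1 - c \<noteq> 0" "(1 - c) * s + (1 + c) \<noteq> 0" using c False by linarith+
  qed
  have "((\<lambda>s. ln (1 + s * (1 - c) / (1 + c)) / ((1 - c) * (1 + c))) has_real_derivative
      ((1 - c) / (1 + c)) / (1 + s * (1 - c) / (1 + c)) / ((1 - c) * (1 + c))) (at s)"
    using pos nz by (auto intro!: derivative_eq_intros)
  also have "1 + s * (1 - c) / (1 + c) = ((1 - c) * s + (1 + c)) / (1 + c)"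
    using nz by (simp add: field_simps)
  also have "((1 - c) / (1 + c)) / (((1 - c) * s + (1 + c)) / (1 + c)) / ((1 - c) * (1 + c))
      = 1 / ((1 + c) * ((1 - c) * s + (1 + c)))"
    using nz by simp
  finally show ?thesis using False unfolding thorin_primitive_def[abs_def] by simp
qed

lemma thorin_primitive_mono:
  assumes c: "-1 < c" "c \<le> 1" and s: "0 \<le> s" "s \<le> t"
  shows "thorin_primitive c s \<le> thorin_primitive c t"
proof (rule DERIV_nonneg_imp_nondecreasing[OF s(2)])
  fix x assume x: "s \<le> x" "x \<le> t"
  then have "0 \<le> 1 / ((1 + c) * ((1 - c) * x + (1 + c)))" using c s by auto
  then show "\<exists>y. (thorin_primitive c has_real_derivative y) (at x) \<and> 0 \<le> y"
    using thorin_primitive_deriv[OF c, of x] x s by auto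
qed

context hm_density begin

text \<open>
  Letting \<open>s\<close> decrease to \<open>0\<close> in the representation of \<open>V s - V 1\<close>, monotone convergence and
  \<open>V(0+) = 0\<close> give \<open>V 1 = \<integral> 1 / (2 (1 + c)) \<nu>(dc)\<close>. Finiteness of this integral excludes mass at
  \<open>c = -1\<close>, and adding it back to \<open>V s - V 1\<close> leaves a nonnegative kernel.
\<close>
lemma V_kernel_representation:
  obtains \<nu> :: "real measure" where "finite_measure \<nu>" "sets \<nu> = sets borel"
    "AE c in \<nu>. c \<in> {-1<..1}"
    "\<And>s. 0 < s \<Longrightarrow> (\<integral>\<^sup>+c. ennreal (1 / ((1 + c) * ((1 - c) * s + (1 + c)))) \<partial>\<nu>) = ennreal (V s / s)"
proof -
  obtain \<nu> :: "real measure" where fm: "finite_measure \<nu>" and sets[measurable_cong]: "sets \<nu> = sets borel"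
    and supp: "AE c in \<nu>. c \<in> {-1..1}"
    and rep: "\<And>s. 0 < s \<Longrightarrow> V s - V 1 = (\<integral>c. (s - 1) / (2 * ((1 - c) * s + (1 + c))) \<partial>\<nu>)"
    by (rule V_representation) (rule that)
  interpret finite_measure \<nu> by fact
  \<comment> \<open>This is \<open>(1 - s) / (2 ((1 - c) s + (1 + c)))\<close> at \<open>s = 1 / (m + 1)\<close>; it increases with \<open>m\<close>.\<close>
  define \<Phi> where "\<Phi> m c = real m / (2 * (2 + (1 + c) * real m))" for m :: nat and c :: real
  have \<Phi>_nonneg: "0 \<le> \<Phi> m c" and \<Phi>_le: "\<Phi> m c \<le> real m / 4" if "c \<in> {-1..1}" for m c
  proof -
    have "0 \<le> (1 + c) * real m" using that by simp
    then show "0 \<le> \<Phi> m c" "\<Phi> m c \<le> real m / 4"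
      unfolding \<Phi>_def using divide_left_mono[of 4 "2 * (2 + (1 + c) * real m)" "real m"] by simp_all
  qed
  have [measurable]: "\<Phi> m \<in> borel_measurable borel" for m unfolding \<Phi>_def[abs_def] by measurable
  define e where "e m = 1 / (real m + 1)" for m
  have e: "0 < e m" "e \<longlonglongrightarrow> 0" for m unfolding e_def[abs_def] by (simp, real_asymp)
  have int\<Phi>: "integrable \<nu> (\<Phi> m)" for m
    using \<Phi>_nonneg \<Phi>_le
    by (intro integrable_const_bound[where B="real m / 4"] eventually_mono[OF supp]) auto
  have V\<Phi>: "V 1 - V (e m) = (\<integral>c. \<Phi> m c \<partial>\<nu>)" for m
  proof -
    have "(e m - 1) / (2 * ((1 - c) * e m + (1 + c))) = - \<Phi> m c" for c
    proof -
      have 1: "e m - 1 = - real m / (real m + 1)" by (simp add: e_def field_simps)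
      have 2: "2 * ((1 - c) * e m + (1 + c)) = 2 * (2 + (1 + c) * real m) / (real m + 1)"
        by (simp add: e_def field_simps)
      have "real m + 1 \<noteq> 0" by linarith
      then show ?thesis unfolding 1 2 \<Phi>_def by simp
    qed
    then show ?thesis using rep[OF e(1)[of m]] by simp
  qed
  let ?f = "\<lambda>m c. ennreal (\<Phi> m c) * indicator {-1..1} c"
  \<comment> \<open>In real arithmetic \<open>1 / 0 = 0\<close>, so the infinite limit at \<open>c = -1\<close> is written out.\<close>
  let ?u = "\<lambda>c. (if c = -1 then \<infinity> else ennreal (1 / (2 * (1 + c)))) * indicator {-1..1::real} c"
  have "(\<lambda>m. \<integral>\<^sup>+c. ?f m c \<partial>\<nu>) \<longlonglongrightarrow> (\<integral>\<^sup>+c. ?u c \<partial>\<nu>)"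
  proof (rule nn_integral_LIMSEQ)
    have "\<Phi> m c \<le> \<Phi> (Suc m) c" if "c \<in> {-1..1}" for m c
    proof -
      have p: "0 \<le> (1 + c) * real n" for n using that by simp
      have "real m * (2 * (2 + (1 + c) * real (Suc m))) \<le> real (Suc m) * (2 * (2 + (1 + c) * real m))"
        by (simp add: algebra_simps)
      then show ?thesis
        unfolding \<Phi>_def using p[of m] p[of "Suc m"]
        by (subst frac_le_eq) (auto simp: divide_nonpos_pos add_pos_nonneg simp del: of_nat_Suc)
    qed
    then show "incseq ?f"
      by (auto intro!: incseq_SucI simp: le_fun_def ennreal_leI split: split_indicator)
    show "?f m \<in> borel_measurable \<nu>" for m by measurable
    fix c :: real
    show "(\<lambda>m. ?f m c) \<longlonglongrightarrow> ?u c"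
    proof (cases "c \<in> {-1..1}")
      case c: True
      have "(\<lambda>m. ennreal (\<Phi> m c)) \<longlonglongrightarrow> (if c = -1 then \<infinity> else ennreal (1 / (2 * (1 + c))))"
      proof (cases "c = -1")
        case True
        have "filterlim (\<lambda>m. real m / 4) at_top sequentially" by real_asymp
        then have "(\<lambda>m. ennreal (real m / 4)) \<longlonglongrightarrow> \<infinity>"
          by (subst infinity_ennreal_def, subst ennreal_tendsto_top_eq_at_top)
        then show ?thesis using True by (simp add: \<Phi>_def)
      next
        case False
        define b where "b = 1 + c"
        have "0 < b" using False c by (simp add: b_def)
        then have "(\<lambda>m. real m / (2 * (2 + b * real m))) \<longlonglongrightarrow> inverse b / 2" by real_asymp
        also have "inverse b / 2 = 1 / (2 * b)" by (simp add: field_simps)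
        finally have "(\<lambda>m. real m / (2 * (2 + b * real m))) \<longlonglongrightarrow> 1 / (2 * b)" .
        then show ?thesis using False by (simp add: \<Phi>_def b_def tendsto_ennrealI)
      qed
      then show ?thesis using c by simp
    qed simp
  qed
  moreover have "(\<integral>\<^sup>+c. ?f m c \<partial>\<nu>) = ennreal (V 1 - V (e m))" for m
  proof -
    have "(\<integral>\<^sup>+c. ?f m c \<partial>\<nu>) = (\<integral>\<^sup>+c. ennreal (\<Phi> m c) \<partial>\<nu>)"
      by (intro nn_integral_cong_AE eventually_mono[OF supp]) auto
    also have "\<dots> = ennreal (\<integral>c. \<Phi> m c \<partial>\<nu>)"
      using \<Phi>_nonneg by (intro nn_integral_eq_integral int\<Phi> eventually_mono[OF supp]) auto
    finally show ?thesis by (simp add: V\<Phi>)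
  qed
  moreover have "(\<lambda>m. ennreal (V 1 - V (e m))) \<longlonglongrightarrow> ennreal (V 1 - 0)"
    by (intro tendsto_ennrealI tendsto_intros V_tendsto_0 e)
  ultimately have u: "(\<integral>\<^sup>+c. ?u c \<partial>\<nu>) = ennreal (V 1)"
    using LIMSEQ_unique by auto
  have "AE c in \<nu>. ?u c \<noteq> \<infinity>"
    by (rule nn_integral_noteq_infinite) (simp_all add: u)
  with supp have supp': "AE c in \<nu>. c \<in> {-1<..1}"
    by eventually_elim (auto split: if_splits simp: less_le)
  have nnV1: "(\<integral>\<^sup>+c. ennreal (1 / (2 * (1 + c))) \<partial>\<nu>) = ennreal (V 1)"
    unfolding u[symmetric] by (intro nn_integral_cong_AE eventually_mono[OF supp']) auto
  have nonneg1: "AE c in \<nu>. 0 \<le> 1 / (2 * (1 + c))"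
    using supp' by eventually_elim auto
  have int1: "integrable \<nu> (\<lambda>c. 1 / (2 * (1 + c)))"
    using nonneg1 nnV1 by (intro integrableI_nonneg) auto
  have V1: "(\<integral>c. 1 / (2 * (1 + c)) \<partial>\<nu>) = V 1"
    using nonneg1 nnV1 V_nonneg[of 1] by (subst integral_eq_nn_integral) auto
  show thesis
  proof (rule that[OF fm sets supp'])
    fix s :: real assume s: "0 < s"
    \<comment> \<open>The denominator interpolates between \<open>2 s\<close> at \<open>c = -1\<close> and \<open>2\<close> at \<open>c = 1\<close>.\<close>
    define \<mu> where "\<mu> = min s 1"
    have \<mu>: "0 < \<mu>" using s by (simp add: \<mu>_def)
    have den: "2 * \<mu> \<le> (1 - c) * s + (1 + c)" if "c \<in> {-1<..1}" for c
    proof -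
      have "(1 - c) * \<mu> + (1 + c) * \<mu> \<le> (1 - c) * s + (1 + c) * 1"
        using that by (intro add_mono mult_left_mono) (auto simp: \<mu>_def)
      then show ?thesis by (simp add: algebra_simps)
    qed
    have int2: "integrable \<nu> (\<lambda>c. (s - 1) / (2 * ((1 - c) * s + (1 + c))))"
    proof (rule integrable_const_bound[where B="\<bar>s - 1\<bar> / (2 * (2 * \<mu>))"])
      show "AE c in \<nu>. norm ((s - 1) / (2 * ((1 - c) * s + (1 + c)))) \<le> \<bar>s - 1\<bar> / (2 * (2 * \<mu>))"
        using supp'
      proof eventually_elim
        case (elim c)
        note d = den[OF elim]
        have "norm ((s - 1) / (2 * ((1 - c) * s + (1 + c)))) = \<bar>s - 1\<bar> / (2 * ((1 - c) * s + (1 + c)))"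
          using d \<mu> by (simp add: abs_divide)
        also have "\<dots> \<le> \<bar>s - 1\<bar> / (2 * (2 * \<mu>))"
          using d \<mu> by (intro divide_left_mono mult_pos_pos) auto
        finally show ?case .
      qed
    qed measurable
    let ?k = "\<lambda>c. 1 / ((1 + c) * ((1 - c) * s + (1 + c)))"
    have sum: "AE c in \<nu>. (1 / (2 * (1 + c)) + (s - 1) / (2 * ((1 - c) * s + (1 + c)))) / s = ?k c"
      using supp'
    proof eventually_elim
      case (elim c)
      have nz: "1 + c \<noteq> 0" "(1 - c) * s + (1 + c) \<noteq> 0" "s \<noteq> 0" using elim den[OF elim] \<mu> s by auto
      have "1 / (2 * (1 + c)) + (s - 1) / (2 * ((1 - c) * s + (1 + c)))
          = (((1 - c) * s + (1 + c)) + (s - 1) * (1 + c)) / (2 * ((1 + c) * ((1 - c) * s + (1 + c))))"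
      proof -
        have "1 / (2 * p) + z / (2 * q) = (q + z * p) / (2 * (p * q))" if "p \<noteq> 0" "q \<noteq> 0" for p q z :: real
          using that by (simp add: field_simps)
        from this[OF nz(1,2)] show ?thesis .
      qed
      also have "((1 - c) * s + (1 + c)) + (s - 1) * (1 + c) = 2 * s" by (simp add: algebra_simps)
      finally show ?case using nz(3) by simp
    qed
    have intsum: "integrable \<nu> (\<lambda>c. (1 / (2 * (1 + c)) + (s - 1) / (2 * ((1 - c) * s + (1 + c)))) / s)"
      by (intro integrable_divide Bochner_Integration.integrable_add int1 int2)
    have A: "(\<integral>c. (1 / (2 * (1 + c)) + (s - 1) / (2 * ((1 - c) * s + (1 + c)))) / s \<partial>\<nu>) = V s / s"
      using int1 int2 V1 rep[OF s] by (simp add: integral_divide_zero)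
    have B: "(\<integral>c. (1 / (2 * (1 + c)) + (s - 1) / (2 * ((1 - c) * s + (1 + c)))) / s \<partial>\<nu>) = (\<integral>c. ?k c \<partial>\<nu>)"
      using sum by (intro integral_cong_AE) auto
    have I: "integrable \<nu> ?k"
      using intsum sum by (subst (asm) integrable_cong_AE) auto
    have N: "AE c in \<nu>. 0 \<le> ?k c"
      using supp'
    proof eventually_elim
      case (elim c)
      then show ?case using den[OF elim] \<mu> by auto
    qed
    have "(\<integral>\<^sup>+c. ennreal (?k c) \<partial>\<nu>) = ennreal (\<integral>c. ?k c \<partial>\<nu>)"
      by (rule nn_integral_eq_integral[OF I N])
    then show "(\<integral>\<^sup>+c. ennreal (?k c) \<partial>\<nu>) = ennreal (V s / s)"
      unfolding A[symmetric] B .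
  qed
qed

lemma measurable_L [measurable]: "L \<in> borel_measurable borel"
  unfolding L_def[abs_def] by measurable

lemma measurable_L' [measurable]: "L' \<in> borel_measurable borel"
  unfolding L'_def[abs_def] by measurable

text \<open>
  \<open>V s / s\<close> is the derivative of \<open>- ln L\<close>, so the previous representation is integrated over \<open>[e, s]\<close> by
  Tonelli's theorem, and \<open>e\<close> tends to \<open>0\<close>.
\<close>
lemma ln_L_representation:
  obtains \<nu> :: "real measure" where "finite_measure \<nu>" "sets \<nu> = sets borel"
    "AE c in \<nu>. c \<in> {-1<..1}"
    "\<And>s. 0 < s \<Longrightarrow> (\<integral>\<^sup>+c. ennreal (thorin_primitive c s) \<partial>\<nu>) = ennreal (- ln (L s))"
proof -
  obtain \<nu> :: "real measure" where fm: "finite_measure \<nu>" and sets[measurable_cong]: "sets \<nu> = sets borel"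
    and supp: "AE c in \<nu>. c \<in> {-1<..1}"
    and rep: "\<And>s. 0 < s \<Longrightarrow> (\<integral>\<^sup>+c. ennreal (1 / ((1 + c) * ((1 - c) * s + (1 + c)))) \<partial>\<nu>) = ennreal (V s / s)"
    by (rule V_kernel_representation) (rule that)
  interpret finite_measure \<nu> by fact
  interpret P: pair_sigma_finite \<nu> "lborel :: real measure" by standard
  let ?k = "\<lambda>c s. 1 / ((1 + c) * ((1 - c) * s + (1 + c))) :: real"
  let ?J = thorin_primitive
  have incr: "(\<integral>\<^sup>+c. ennreal (?J c s - ?J c e) \<partial>\<nu>) = ennreal (ln (L e) - ln (L s))" if es: "0 < e" "e \<le> s" for e s
  proof -
    have "ennreal (ln (L e) - ln (L s)) = ennreal ((- ln (L s)) - (- ln (L e)))" by simp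
    also have "\<dots> = (\<integral>\<^sup>+x. ennreal (V x / x) * indicator {e..s} x \<partial>lborel)"
    proof (rule nn_integral_FTC_Icc[symmetric, OF _ _ _ es(2)])
      show "(\<lambda>x. V x / x) \<in> borel_measurable borel" unfolding V_def by measurable
      fix x assume "x \<in> {e..s}"
      then have x: "0 < x" using es by auto
      show "0 \<le> V x / x" using V_nonneg[OF x] x by simp
      have "((\<lambda>x. - ln (L x)) has_real_derivative - (L' x / L x)) (at x)"
        using L_pos[of x] x by (auto intro!: derivative_eq_intros L_deriv)
      also have "- (L' x / L x) = V x / x" using x by (simp add: V_def)
      finally show "((\<lambda>x. - ln (L x)) has_real_derivative V x / x) (at x)" .
    qed
    also have "\<dots> = (\<integral>\<^sup>+x. (\<integral>\<^sup>+c. ennreal (?k c x) * indicator {e..s} x \<partial>\<nu>) \<partial>lborel)"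
    proof (rule nn_integral_cong)
      fix x :: real
      show "ennreal (V x / x) * indicator {e..s} x = (\<integral>\<^sup>+c. ennreal (?k c x) * indicator {e..s} x \<partial>\<nu>)"
        using rep[of x] es by (auto split: split_indicator)
    qed
    also have "\<dots> = (\<integral>\<^sup>+c. (\<integral>\<^sup>+x. ennreal (?k c x) * indicator {e..s} x \<partial>lborel) \<partial>\<nu>)"
      by (rule P.Fubini') measurable
    also have "\<dots> = (\<integral>\<^sup>+c. ennreal (?J c s - ?J c e) \<partial>\<nu>)"
    proof (rule nn_integral_cong_AE)
      show "AE c in \<nu>. (\<integral>\<^sup>+x. ennreal (?k c x) * indicator {e..s} x \<partial>lborel) = ennreal (?J c s - ?J c e)"
        using supp
      proof eventually_elim
        case (elim c)
        then have c: "-1 < c" "c \<le> 1" by auto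
        show ?case
        proof (rule nn_integral_FTC_Icc[OF _ _ _ es(2)])
          fix x assume "x \<in> {e..s}"
          then have x: "0 \<le> x" using es by auto
          show "(?J c has_real_derivative ?k c x) (at x)" by (rule thorin_primitive_deriv[OF c x])
          show "0 \<le> ?k c x" using c x by auto
        qed measurable
      qed
    qed
    finally show ?thesis by simp
  qed
  show thesis
  proof (rule that[OF fm sets supp])
    fix s :: real assume s: "0 < s"
    define e where "e n = s / (real n + 1)" for n
    have e: "0 < e n" "e n \<le> s" "e (Suc n) \<le> e n" for n
      using s by (auto simp: e_def field_simps)
    have e_lim: "e \<longlonglongrightarrow> 0" unfolding e_def[abs_def] by real_asymp
    let ?f = "\<lambda>n c. ennreal (?J c s - ?J c (e n)) * indicator {-1<..1} c"
    have "(\<lambda>n. \<integral>\<^sup>+c. ?f n c \<partial>\<nu>) \<longlonglongrightarrow> (\<integral>\<^sup>+c. ennreal (?J c s) * indicator {-1<..1} c \<partial>\<nu>)"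
    proof (rule nn_integral_LIMSEQ)
      show "incseq ?f"
        using thorin_primitive_mono[of _ "e (Suc _)" "e _"] e
        by (auto intro!: incseq_SucI ennreal_leI simp: le_fun_def less_imp_le split: split_indicator)
      show "?f n \<in> borel_measurable \<nu>" for n by measurable
      fix c :: real
      show "(\<lambda>n. ?f n c) \<longlonglongrightarrow> ennreal (?J c s) * indicator {-1<..1} c"
      proof (cases "c \<in> {-1<..1}")
        case True
        then have "isCont (?J c) 0"
          using thorin_primitive_deriv[of c 0] by (auto intro: DERIV_isCont)
        then have "(\<lambda>n. ?J c (e n)) \<longlonglongrightarrow> ?J c 0"
          using e_lim by (rule isCont_tendsto_compose)
        then have "(\<lambda>n. ennreal (?J c s - ?J c (e n))) \<longlonglongrightarrow> ennreal (?J c s - ?J c 0)"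
          by (intro tendsto_ennrealI tendsto_intros)
        then show ?thesis using True by simp
      qed simp
    qed
    moreover have "(\<integral>\<^sup>+c. ?f n c \<partial>\<nu>) = ennreal (ln (L (e n)) - ln (L s))" for n
      unfolding incr[OF e(1,2), symmetric] 
      by (intro nn_integral_cong_AE eventually_mono[OF supp]) auto
    moreover have "(\<lambda>n. ennreal (ln (L (e n)) - ln (L s))) \<longlonglongrightarrow> ennreal (ln 1 - ln (L s))"
      using e by (intro tendsto_ennrealI tendsto_diff tendsto_ln tendsto_const L_tendsto e_lim)
         (auto intro: less_imp_le)
    ultimately have "(\<integral>\<^sup>+c. ennreal (?J c s) * indicator {-1<..1} c \<partial>\<nu>) = ennreal (- ln (L s))"
      using LIMSEQ_unique by auto
    moreover have "(\<integral>\<^sup>+c. ennreal (?J c s) * indicator {-1<..1} c \<partial>\<nu>) = (\<integral>\<^sup>+c. ennreal (?J c s) \<partial>\<nu>)"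
      by (intro nn_integral_cong_AE eventually_mono[OF supp]) auto
    ultimately show "(\<integral>\<^sup>+c. ennreal (?J c s) \<partial>\<nu>) = ennreal (- ln (L s))" by simp
  qed
qed

theorem thorin_representation:
  obtains a :: real and U :: "real measure" where "0 \<le> a" "sets U = sets borel" "emeasure U {..0} = 0"
    "\<And>s. 0 < s \<Longrightarrow> ennreal (- ln (L s)) = ennreal (a * s) + (\<integral>\<^sup>+t\<in>{0<..}. ennreal (ln (1 + s / t)) \<partial>U)"
proof -
  obtain \<nu> :: "real measure" where fm: "finite_measure \<nu>" and sets[measurable_cong]: "sets \<nu> = sets borel"
    and supp: "AE c in \<nu>. c \<in> {-1<..1}"
    and rep: "\<And>s. 0 < s \<Longrightarrow> (\<integral>\<^sup>+c. ennreal (thorin_primitive c s) \<partial>\<nu>) = ennreal (- ln (L s))"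
    by (rule ln_L_representation) (rule that)
  interpret finite_measure \<nu> by fact
  define W where "W = density \<nu> (\<lambda>c. ennreal (indicator {-1<..<1} c / ((1 - c) * (1 + c))))"
  define t where "t c = (1 + c) / (1 - c)" for c :: real
  define U where "U = distr W borel t"
  have [measurable]: "t \<in> borel_measurable borel" unfolding t_def[abs_def] by measurable
  have U: "(\<integral>\<^sup>+x. F x \<partial>U) = (\<integral>\<^sup>+c. ennreal (indicator {-1<..<1} c / ((1 - c) * (1 + c))) * F (t c) \<partial>\<nu>)"
    if [measurable]: "F \<in> borel_measurable borel" for F
  proof -
    have "(\<integral>\<^sup>+x. F x \<partial>U) = (\<integral>\<^sup>+c. F (t c) \<partial>W)"
      unfolding U_def by (rule nn_integral_distr) (auto simp: W_def)
    also have "\<dots> = (\<integral>\<^sup>+c. ennreal (indicator {-1<..<1} c / ((1 - c) * (1 + c))) * F (t c) \<partial>\<nu>)"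
      unfolding W_def by (rule nn_integral_density) auto
    finally show ?thesis .
  qed
  have t_pos: "0 < t c" if "c \<in> {-1<..<1}" for c using that by (simp add: t_def)
  show thesis
  proof (rule that[of "measure \<nu> {1} / 4" U])
    show "sets U = sets borel" by (simp add: U_def)
    have "emeasure U {..0} = (\<integral>\<^sup>+x. indicator {..0} x \<partial>U)" by (simp add: U_def)
    also have "\<dots> = (\<integral>\<^sup>+c. 0 \<partial>\<nu>)"
      unfolding U[OF borel_measurable_indicator[OF borel_closed[OF closed_atMost]]]
      by (intro nn_integral_cong) (use t_pos in \<open>fastforce split: split_indicator\<close>)
    finally show "emeasure U {..0} = 0" by simp
    fix s :: real assume s: "0 < s"
    have "ennreal (- ln (L s)) = (\<integral>\<^sup>+c. ennreal (thorin_primitive c s) \<partial>\<nu>)" using rep[OF s] by simp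
    also have "\<dots> = (\<integral>\<^sup>+c. ennreal (s / 4) * indicator {1} c
        + ennreal (indicator {-1<..<1} c / ((1 - c) * (1 + c))) * (ennreal (ln (1 + s / t c)) * indicator {0<..} (t c)) \<partial>\<nu>)"
    proof (rule nn_integral_cong_AE)
      show "AE c in \<nu>. ennreal (thorin_primitive c s) = ennreal (s / 4) * indicator {1} c
        + ennreal (indicator {-1<..<1} c / ((1 - c) * (1 + c))) * (ennreal (ln (1 + s / t c)) * indicator {0<..} (t c))"
        using supp
      proof eventually_elim
        case (elim c)
        show ?case
        proof (cases "c = 1")
          case True then show ?thesis by (simp add: thorin_primitive_def)
        next
          case False
          then have c: "c \<in> {-1<..<1}" using elim by auto
          have "s / t c = s * (1 - c) / (1 + c)" using c by (simp add: t_def)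
          then have "thorin_primitive c s = 1 / ((1 - c) * (1 + c)) * ln (1 + s / t c)"
            using False by (simp add: thorin_primitive_def)
          moreover have "0 \<le> 1 / ((1 - c) * (1 + c))" using c by simp
          ultimately have "ennreal (thorin_primitive c s)
              = ennreal (1 / ((1 - c) * (1 + c))) * ennreal (ln (1 + s / t c))"
            by (simp only: ennreal_mult')
          then show ?thesis using c t_pos[OF c] by simp
        qed
      qed
    qed
    also have "\<dots> = (\<integral>\<^sup>+c. ennreal (s / 4) * indicator {1} c \<partial>\<nu>) + (\<integral>\<^sup>+x\<in>{0<..}. ennreal (ln (1 + s / x)) \<partial>U)"
      by (subst nn_integral_add) (auto simp: U)
    also have "(\<integral>\<^sup>+c. ennreal (s / 4) * indicator {1} c \<partial>\<nu>) = ennreal (measure \<nu> {1} / 4 * s)"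
    proof -
      have "(\<integral>\<^sup>+c. ennreal (s / 4) * indicator {1} c \<partial>\<nu>) = ennreal (s / 4) * ennreal (measure \<nu> {1})"
        by (subst nn_integral_cmult_indicator) (auto simp: emeasure_eq_measure)
      also have "\<dots> = ennreal (s / 4 * measure \<nu> {1})" using s by (intro ennreal_mult'[symmetric]) auto
      finally show ?thesis by (simp add: mult.commute)
    qed
    finally show "ennreal (- ln (L s)) = ennreal (measure \<nu> {1} / 4 * s) + (\<integral>\<^sup>+x\<in>{0<..}. ennreal (ln (1 + s / x)) \<partial>U)" .
  qed simp
qed

end

lemma (in hm_density) GGC_if_Laplace_transform:
  assumes "prob_space \<mu>" "sets \<mu> = sets borel" "AE x in \<mu>. 0 \<le> x"
    and lap: "\<And>s. 0 \<le> s \<Longrightarrow> (\<integral>x. exp (- s * x) \<partial>\<mu>) = L s"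
  shows "GGC \<mu>"
proof -
  obtain a :: real and U :: "real measure" where a: "0 \<le> a" and U: "sets U = sets borel" "emeasure U {..0} = 0"
    and rep: "\<And>s. 0 < s \<Longrightarrow> ennreal (- ln (L s)) = ennreal (a * s) + (\<integral>\<^sup>+t\<in>{0<..}. ennreal (ln (1 + s / t)) \<partial>U)"
    by (rule thorin_representation) (rule that)
  have nonneg: "0 \<le> - ln (L s)" if "0 < s" for s
    using L_le_1[of s] L_pos[of s] that by simp
  have cond: "emeasure U K < \<infinity>" if "compact K" "K \<subseteq> {0<..}" for K
    by (rule thorin_measure_conditions(1)[OF U a rep nonneg]) (use that in auto)
  have cond2: "(\<integral>\<^sup>+t\<in>{0<..<1}. ennreal \<bar>ln t\<bar> \<partial>U) < \<infinity>"
    by (rule thorin_measure_conditions(2)[OF U a rep nonneg]) auto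
  have cond3: "(\<integral>\<^sup>+t\<in>{1<..}. ennreal (1 / t) \<partial>U) < \<infinity>"
    by (rule thorin_measure_conditions(3)[OF U a rep nonneg]) auto
  have "(\<integral>x. exp (- s * x) \<partial>\<mu>) = exp (- a * s + (LINT t:{0<..}|U. ln (t / (t + s))))" if s: "0 \<le> s" for s
  proof (cases "s = 0")
    case True
    have "(LINT t:{0<..}|U. ln (t / (t + 0))) = 0"
      unfolding set_lebesgue_integral_def by (intro integral_eq_zero_AE) (auto split: split_indicator)
    then show ?thesis using True lap[of 0] L_0 by simp
  next
    case False
    then have s: "0 < s" using s by simp
    have "ln (L s) = - a * s + (LINT t:{0<..}|U. ln (t / (t + s)))"
    proof -
      have "- ln (L s) = a * s - (LINT t:{0<..}|U. ln (t / (t + s)))"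
        by (rule thorin_measure_conditions(4)[OF U a rep nonneg]) (use s in auto)
      then show ?thesis by simp
    qed
    then have "exp (- a * s + (LINT t:{0<..}|U. ln (t / (t + s)))) = L s"
      using L_pos[of s] s by (metis exp_ln less_imp_le)
    then show ?thesis using lap[of s] s by simp
  qed
  then show ?thesis
    unfolding GGC_def using assms(1-3) a U cond cond2 cond3 by blast
qed

section \<open>Products and quotients\<close>
lemma gamma_density_nonneg: "0 < r \<Longrightarrow> 0 \<le> gamma_density r t x"
  by (simp add: gamma_density_def Gamma_real_pos less_imp_le)

lemma measurable_gamma_density [measurable]: "gamma_density r t \<in> borel_measurable borel"
  unfolding gamma_density_def[abs_def] by measurable

lemma gamma_density_Laplace_transform:
  assumes r: "0 < r" and total: "(\<integral>y. gamma_density r 1 y \<partial>lborel) = 1" and c: "0 \<le> c"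
  shows "(\<integral>y. gamma_density r 1 y * exp (- (c * y)) \<partial>lborel) = (1 + c) powr (- r)"
proof -
  \<comment> \<open>Scaling by \<open>d\<close> reduces the transform to the total mass.\<close>
  define d where "d = 1 + c"
  have d: "0 < d" using c by (simp add: d_def)
  have scaled: "gamma_density r 1 (0 + 1 / d * y) * exp (- (c * (0 + 1 / d * y)))
      = d powr (1 - r) * gamma_density r 1 y" for y
  proof (cases "0 < y")
    case True
    have "exp (- (y / d)) * exp (- (c * (y / d))) = exp (- y)"
    proof -
      have "y / d + c * (y / d) = d * (y / d)" by (simp add: d_def distrib_right add_divide_distrib)
      then have "y / d + c * (y / d) = y" using d by simp
      then have "- (y / d) + - (c * (y / d)) = - y" by linarith
      then show ?thesis by (simp flip: exp_add)
    qed
    moreover have "(y / d) powr (r - 1) = d powr (1 - r) * y powr (r - 1)"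
    proof -
      have "(y / d) powr (r - 1) = y powr (r - 1) / d powr (r - 1)" by (rule powr_divide)
      also have "\<dots> = y powr (r - 1) * d powr (- (r - 1))" by (simp only: powr_minus divide_inverse)
      finally show ?thesis by simp
    qed
    ultimately show ?thesis using True d by (simp add: gamma_density_def)
  next
    case False
    then have "\<not> 0 < y / d" using d by (simp add: zero_less_divide_iff)
    then show ?thesis using False by (simp add: gamma_density_def)
  qed
  have "(\<integral>y. gamma_density r 1 y * exp (- (c * y)) \<partial>lborel)
      = \<bar>1 / d\<bar> *\<^sub>R (\<integral>y. gamma_density r 1 (0 + 1 / d * y) * exp (- (c * (0 + 1 / d * y))) \<partial>lborel)"
    using d by (intro lborel_integral_real_affine) simp
  also have "\<dots> = 1 / d * (d powr (1 - r) * 1)"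
    unfolding scaled using d total by simp
  also have "\<dots> = d powr (- 1) * d powr (1 - r)" using d by (simp add: powr_minus divide_inverse)
  also have "\<dots> = d powr (- r)" unfolding powr_add[symmetric] by simp
  finally show ?thesis by (simp add: d_def)
qed

lemma density_positive_eq_distr_exp:
  fixes f :: "real \<Rightarrow> real"
  assumes [measurable]: "f \<in> borel_measurable borel"
    and nonneg: "\<And>x. 0 \<le> f x" and zero: "\<And>x. x \<le> 0 \<Longrightarrow> f x = 0"
  shows "density lborel (\<lambda>x. ennreal (f x))
       = distr (density lborel (\<lambda>a. ennreal (f (exp a) * exp a))) borel exp"
proof -
  have range: "range (exp :: real \<Rightarrow> real) = {0<..}"
    by (auto simp: image_iff) (metis exp_ln)
  have "distr (density lborel (\<lambda>x. ennreal (exp x))) borel exp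
       = density lborel (indicator (range (exp :: real \<Rightarrow> real)))"
    by (rule distr_density_deriv_lborel) (auto intro!: derivative_eq_intros continuous_intros)
  then have exp: "distr (density lborel (\<lambda>x. ennreal (exp x))) borel exp = density lborel (indicator {0<..})"
    unfolding range .
  have "density lborel (\<lambda>x. ennreal (f x)) = density (density lborel (indicator {0<..})) (\<lambda>x. ennreal (f x))"
  proof -
    have "density lborel (\<lambda>x. ennreal (f x)) = density lborel (\<lambda>x. indicator {0<..} x * ennreal (f x))"
      by (rule density_cong) (auto simp: zero not_less split: split_indicator)
    also have "\<dots> = density (density lborel (indicator {0<..})) (\<lambda>x. ennreal (f x))"
      by (rule density_density_eq[symmetric]) simp_all
    finally show ?thesis .
  qed
  also have "\<dots> = distr (density (density lborel (\<lambda>a. ennreal (exp a))) (\<lambda>a. ennreal (f (exp a)))) borel exp"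
    unfolding exp[symmetric] by (rule density_distr) simp_all
  also have "density (density lborel (\<lambda>a. ennreal (exp a))) (\<lambda>a. ennreal (f (exp a)))
      = density lborel (\<lambda>a. ennreal (f (exp a) * exp a))"
    by (subst density_density_eq) (auto simp: ennreal_mult'' mult.commute nonneg)
  finally show ?thesis .
qed

lemma hm_density_log:
  assumes f: "hyperbolically_monotone k f" and r: "0 < r" "r \<le> real k"
    and meas: "(\<lambda>x. if 0 < x then f x else 0) \<in> borel_measurable borel"
    and g: "\<And>a. g a = f (exp a) * exp a"
    and total: "(\<integral>\<^sup>+a. ennreal (g a) \<partial>lborel) = 1"
  shows "hm_density g r k"
proof
  have "g = (\<lambda>a. (if 0 < exp a then f (exp a) else 0) * exp a)" by (auto simp: g)
  also have "\<dots> \<in> borel_measurable borel"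
    using measurable_compose[OF _ meas, of exp borel] by measurable
  finally show g_meas[measurable]: "g \<in> borel_measurable borel" .
  have "0 \<le> f x" if "0 < x" for x using f that by (simp add: hyperbolically_monotone_def)
  then show nonneg: "0 \<le> g a" for a by (simp add: g)
  show "integrable lborel g" by (rule integrableI_nonneg) (auto simp: nonneg total)
  show "(\<integral>a. g a \<partial>lborel) = 1" by (subst integral_eq_nn_integral) (auto simp: nonneg total)
  show "0 < r" "r \<le> real k" by fact+
  fix p :: real
  have "\<exists>h. (\<forall>v>0. h (v + 1 / v) = f (exp p * v) * f (exp p / v)) \<and> decreasing_of_order k h"
    using f exp_gt_zero[of p] unfolding hyperbolically_monotone_def by (elim conjE allE[of _ "exp p"] impE)
  then obtain h where h: "\<And>v. 0 < v \<Longrightarrow> h (v + 1 / v) = f (exp p * v) * f (exp p / v)"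
    and dec: "decreasing_of_order k h"
    by auto
  have "g (p + q) * g (p - q) = (exp p)\<^sup>2 * h (2 * cosh q)" for q
  proof -
    have "2 * cosh q = exp q + 1 / exp q" by (simp add: cosh_def exp_minus inverse_eq_divide)
    then have "h (2 * cosh q) = f (exp (p + q)) * f (exp (p - q))"
      using h[of "exp q"] by (simp add: exp_add exp_diff)
    moreover have "exp (p + q) * exp (p - q) = (exp p)\<^sup>2"
      by (simp add: exp_add exp_diff power2_eq_square)
    ultimately show ?thesis by (simp add: g mult_ac)
  qed
  then show "\<exists>h K. 0 \<le> K \<and> (\<forall>q. g (p + q) * g (p - q) = K * h (2 * cosh q)) \<and> decreasing_of_order k h"
    using dec by (intro exI[of _ h] exI[of _ "(exp p)\<^sup>2"]) auto
qed

lemma (in hm_density) hm_density_reflect: "hm_density (\<lambda>a. g (- a)) r k"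
proof
  show "integrable lborel (\<lambda>a. g (- a))"
    using lborel_integrable_real_affine_iff[of "-1" g 0] g_int by simp
  show "(\<integral>a. g (- a) \<partial>lborel) = 1"
    using lborel_integral_real_affine[of "-1" g 0] g_total by simp
  show "\<exists>h K. 0 \<le> K \<and> (\<forall>q. g (- (p + q)) * g (- (p - q)) = K * h (2 * cosh q)) \<and> decreasing_of_order k h" for p
  proof -
    obtain h K where "0 \<le> K" "\<And>q. g (- p + q) * g (- p - q) = K * h (2 * cosh q)" "decreasing_of_order k h"
      using HM[of "- p"] by auto
    then show ?thesis by (intro exI[of _ h] exI[of _ K]) (auto simp: mult.commute)
  qed
qed (use g_nonneg r_pos r_le in auto)

theorem corollary1:
  fixes M :: "'a measure" and X Y :: "'a \<Rightarrow> real" and r :: real and k :: nat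
  assumes "prob_space M"
    and "r > 0"
    and "real k \<ge> r"
    and "distributed M lborel Y (\<lambda>y. ennreal (gamma_density r 1 y))"
    and "HM_distributed M k X"
    and "prob_space.indep_var M borel Y borel X"
  shows "GGC (distr M borel (\<lambda>\<omega>. Y \<omega> * X \<omega>)) \<and> GGC (distr M borel (\<lambda>\<omega>. Y \<omega> / X \<omega>))"
proof -
  interpret M: prob_space M by fact
  note r = \<open>r > 0\<close> and Y = assms(4) and ind = assms(6)
  obtain f where f: "hyperbolically_monotone k f"
    and X: "distributed M lborel X (\<lambda>x. ennreal (if x > 0 then f x else 0))"
    using assms(5) by (auto simp: HM_distributed_def)
  define F where "F x = (if x > 0 then f x else 0)" for x :: real
  have F_nonneg: "0 \<le> F x" for x using f by (simp add: F_def hyperbolically_monotone_def)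
  have "(\<lambda>x. ennreal (F x)) \<in> borel_measurable lborel"
    using distributed_borel_measurable[OF X] by (simp add: F_def)
  then have "(\<lambda>x. enn2real (ennreal (F x))) \<in> borel_measurable borel" by measurable
  then have F_meas[measurable]: "F \<in> borel_measurable borel" using F_nonneg by simp
  define g where "g a = f (exp a) * exp a" for a
  have gF: "g a = F (exp a) * exp a" for a by (simp add: g_def F_def)
  have [measurable]: "X \<in> borel_measurable M" "Y \<in> borel_measurable M"
    using distributed_measurable[OF X] distributed_measurable[OF Y] by simp_all
  have distrX: "distr M borel X = distr (density lborel (\<lambda>a. ennreal (g a))) borel exp"
  proof -
    have "distr M borel X = distr M lborel X" by (rule distr_cong) auto
    also have "\<dots> = density lborel (\<lambda>x. ennreal (F x))"
      using distributed_distr_eq_density[OF X] by (simp add: F_def)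
    also have "\<dots> = distr (density lborel (\<lambda>a. ennreal (g a))) borel exp"
      unfolding gF by (rule density_positive_eq_distr_exp[OF F_meas F_nonneg]) (simp add: F_def)
    finally show ?thesis .
  qed
  have [measurable]: "g \<in> borel_measurable borel" unfolding gF[abs_def] by measurable
  have g_nonneg: "0 \<le> g a" for a by (simp add: gF F_nonneg)
  have distrY: "distr M borel Y = density lborel (\<lambda>y. ennreal (gamma_density r 1 y))"
  proof -
    have "distr M borel Y = distr M lborel Y" by (rule distr_cong) auto
    then show ?thesis using distributed_distr_eq_density[OF Y] by simp
  qed
  have totalg: "(\<integral>\<^sup>+a. ennreal (g a) \<partial>lborel) = 1"
  proof -
    interpret PX: prob_space "distr M borel X" by (rule M.prob_space_distr) simp
    have "1 = emeasure (distr M borel X) UNIV" using PX.emeasure_space_1 by simp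
    also have "\<dots> = (\<integral>\<^sup>+a. ennreal (g a) \<partial>lborel)"
      unfolding distrX by (simp add: emeasure_distr emeasure_density)
    finally show ?thesis by simp
  qed
  have totalY: "(\<integral>y. gamma_density r 1 y \<partial>lborel) = 1"
  proof -
    interpret PY: prob_space "distr M borel Y" by (rule M.prob_space_distr) simp
    have "1 = emeasure (distr M borel Y) UNIV" using PY.emeasure_space_1 by simp
    also have "\<dots> = (\<integral>\<^sup>+y. ennreal (gamma_density r 1 y) \<partial>lborel)"
      unfolding distrY by (simp add: emeasure_density)
    finally show ?thesis
      by (subst integral_eq_nn_integral) (auto simp: gamma_density_nonneg r)
  qed
  interpret hm: hm_density g r k
    by (rule hm_density_log[OF f r \<open>real k \<ge> r\<close> F_meas[unfolded F_def[abs_def]] g_def totalg])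
  interpret hm': hm_density "\<lambda>a. g (- a)" r k by (rule hm.hm_density_reflect)
  have pair: "distr M borel Y \<Otimes>\<^sub>M distr M borel X = distr M (borel \<Otimes>\<^sub>M borel) (\<lambda>\<omega>. (Y \<omega>, X \<omega>))"
    using ind by (simp add: M.indep_var_distribution_eq)
  have AE_X: "AE \<omega> in M. 0 < X \<omega>"
  proof -
    have "AE x in distr M borel X. 0 < x" unfolding distrX by (subst AE_distr_iff) auto
    then show ?thesis by (subst (asm) AE_distr_iff) auto
  qed
  have AE_Y: "AE \<omega> in M. 0 \<le> Y \<omega>"
  proof -
    have "AE x in distr M borel Y. 0 \<le> x"
      unfolding distrY by (subst AE_density) (auto simp: gamma_density_def)
    then show ?thesis by (subst (asm) AE_distr_iff) auto
  qed
  have Laplace: "(\<integral>z. exp (- s * z) \<partial>distr M borel (\<lambda>\<omega>. Y \<omega> * \<xi> (X \<omega>)))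
      = (\<integral>a. g a * (1 + s * \<xi> (exp a)) powr (- r) \<partial>lborel)"
    if s: "0 \<le> s" and [measurable]: "\<xi> \<in> borel_measurable borel" and \<xi>: "\<And>x. 0 < x \<Longrightarrow> 0 < \<xi> x"
    for s and \<xi> :: "real \<Rightarrow> real"
  proof -
    interpret PX: prob_space "distr M borel X" by (rule M.prob_space_distr) simp
    interpret PY: prob_space "distr M borel Y" by (rule M.prob_space_distr) simp
    interpret P: pair_prob_space "distr M borel Y" "distr M borel X" ..
    let ?h = "\<lambda>y x. exp (- s * (y * \<xi> x))"
    have AE_le: "AE z in distr M borel Y \<Otimes>\<^sub>M distr M borel X. norm (case_prod ?h z) \<le> 1"
      unfolding pair
    proof (subst AE_distr_iff)
      show "AE \<omega> in M. norm (case_prod ?h (Y \<omega>, X \<omega>)) \<le> 1"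
        using AE_X AE_Y
      proof eventually_elim
        case (elim \<omega>)
        then have "0 \<le> s * (Y \<omega> * \<xi> (X \<omega>))" using s \<xi> by (simp add: less_imp_le)
        then show ?case by simp
      qed
    qed measurable
    have int: "integrable (distr M borel Y \<Otimes>\<^sub>M distr M borel X) (case_prod ?h)"
      by (rule P.integrable_const_bound[OF AE_le]) measurable
    have "(\<integral>z. exp (- s * z) \<partial>distr M borel (\<lambda>\<omega>. Y \<omega> * \<xi> (X \<omega>))) = (\<integral>\<omega>. ?h (Y \<omega>) (X \<omega>) \<partial>M)"
      by (subst integral_distr) auto
    also have "\<dots> = (\<integral>z. case_prod ?h z \<partial>(distr M borel Y \<Otimes>\<^sub>M distr M borel X))"
      unfolding pair by (subst integral_distr) auto
    also have "\<dots> = (\<integral>x. (\<integral>y. ?h y x \<partial>distr M borel Y) \<partial>distr M borel X)"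
      by (rule P.integral_snd[OF int, symmetric])
    also have "\<dots> = (\<integral>a. (\<integral>y. ?h y (exp a) \<partial>distr M borel Y) \<partial>density lborel (\<lambda>a. ennreal (g a)))"
      unfolding distrX by (rule integral_distr) measurable
    also have "\<dots> = (\<integral>a. g a *\<^sub>R (\<integral>y. ?h y (exp a) \<partial>distr M borel Y) \<partial>lborel)"
      by (rule integral_density) (auto simp: g_nonneg)
    also have "(\<lambda>a. \<integral>y. ?h y (exp a) \<partial>distr M borel Y) = (\<lambda>a. (1 + s * \<xi> (exp a)) powr (- r))"
    proof
      fix a :: real
      have "(\<integral>y. ?h y (exp a) \<partial>distr M borel Y) = (\<integral>y. gamma_density r 1 y *\<^sub>R ?h y (exp a) \<partial>lborel)"
        unfolding distrY by (rule integral_density) (auto simp: gamma_density_nonneg r)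
      also have "\<dots> = (\<integral>y. gamma_density r 1 y * exp (- ((s * \<xi> (exp a)) * y)) \<partial>lborel)"
        by (simp add: mult_ac)
      also have "\<dots> = (1 + s * \<xi> (exp a)) powr (- r)"
        using s \<xi>[of "exp a"] by (intro gamma_density_Laplace_transform r totalY) auto
      finally show "(\<integral>y. ?h y (exp a) \<partial>distr M borel Y) = (1 + s * \<xi> (exp a)) powr (- r)" .
    qed
    finally show ?thesis by simp
  qed
  have "GGC (distr M borel (\<lambda>\<omega>. Y \<omega> * X \<omega>))"
  proof (rule hm.GGC_if_Laplace_transform)
    show "AE z in distr M borel (\<lambda>\<omega>. Y \<omega> * X \<omega>). 0 \<le> z"
    proof (subst AE_distr_iff)
      show "AE \<omega> in M. 0 \<le> Y \<omega> * X \<omega>" using AE_X AE_Y by eventually_elim simp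
    qed auto
    show "(\<integral>z. exp (- s * z) \<partial>distr M borel (\<lambda>\<omega>. Y \<omega> * X \<omega>)) = hm.L s" if "0 \<le> s" for s
      using Laplace[OF that, of "\<lambda>x. x"] by (simp add: hm.L_def)
  qed (auto intro!: M.prob_space_distr)
  moreover have "GGC (distr M borel (\<lambda>\<omega>. Y \<omega> / X \<omega>))"
  proof (rule hm'.GGC_if_Laplace_transform)
    show "AE z in distr M borel (\<lambda>\<omega>. Y \<omega> / X \<omega>). 0 \<le> z"
    proof (subst AE_distr_iff)
      show "AE \<omega> in M. 0 \<le> Y \<omega> / X \<omega>" using AE_X AE_Y by eventually_elim simp
    qed auto
    fix s :: real assume s: "0 \<le> s"
    have "(\<integral>z. exp (- s * z) \<partial>distr M borel (\<lambda>\<omega>. Y \<omega> / X \<omega>))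
        = (\<integral>a. g a * (1 + s * (1 / exp a)) powr (- r) \<partial>lborel)"
      using Laplace[OF s, of "\<lambda>x. 1 / x"] by simp
    also have "\<dots> = (\<integral>a. g (0 + (-1) * a) * (1 + s * (1 / exp (0 + (-1) * a))) powr (- r) \<partial>lborel)"
      by (subst lborel_integral_real_affine[of "-1" _ 0]) simp_all
    also have "\<dots> = hm'.L s" by (simp add: hm'.L_def exp_minus inverse_eq_divide)
    finally show "(\<integral>z. exp (- s * z) \<partial>distr M borel (\<lambda>\<omega>. Y \<omega> / X \<omega>)) = hm'.L s" .
  qed (auto intro!: M.prob_space_distr)
  ultimately show ?thesis ..
qed

end
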